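(* For any $n\ge1$ and $k\in[n]$, the four sets $\mathscr{T}_{n,k},\mathscr{U}_{n,k},\mathscr{V}_{n,k},\mathscr{W}_{n,k}$ are in bijection with one another. Consequently the number of $k$-dimensional faces of the Shi arrangement in $\mathbb{R}^n$ equals $|\mathscr{T}_{n,k}|=|\mathscr{U}_{n,k}|=|\mathscr{V}_{n,k}|=|\mathscr{W}_{n,k}|$.
   Context: $[n]=\{1,\dots,n\}$. The Shi arrangement in $\mathbb{R}^n$ consists of the hyperplanes $x_i-x_j=0$ and $x_i-x_j=1$, $1\le i<j\le n$; a face is a nonempty solution set of a system choosing for each hyperplane one of $<,=,>$, and its dimension is that of its affine span. A binary tree is a rooted plane tree in which every vertex has 0 or 2 children (left child and right child); childless vertices are leaves, others nodes; an internal edge joins two nodes. An $[n]$-decorated binary tree is a binary tree whose nodes are labeled by nonempty subsets of $[n]$ forming a set partition of $[n]$, with each right internal edge declared solid or dashed (others solid); a captive node is a node joined to its parent by a dashed edge, a free node one that is not captive. An internal edge is a descent if $\max A>\min B$ where $A$ is the parent's label and $B$ the child's label. $\mathscr{T}_{n,k}$: $[n]$-decorated binary trees in which all right internal edges are descents, with exactly $k$ free nodes. $\mathscr{U}_{n,k}$: binary trees with $n$ nodes, the nodes labeled bijectively by $[n]$, such that all right internal edges are descents, together with a set of $n-k$ marked nodes each of which has a left child that is not a leaf. $\mathscr{V}_{n,k}$: trees on the vertex set $[n+1]$ (Cayley trees) together with a set of $n-k$ marked internal vertices (vertices of degree at least two) among those labeled $1,\dots,n$. $\mathscr{W}_{n,k}$: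 pairs $(f,S)$ with $f:[n-1]\to[n+1]$ a function and $S\subset \mathrm{Im}(f)\cap[n]$ with $|S|=n-k$. *)

theory Defs
  imports
    "HOL-Analysis.Analysis"
    "HOL-Library.Tree"
    "HOL-Library.Disjoint_Sets"
    "HOL-Library.Equipollence"
    "HOL-Library.FuncSet"
begin

text \<open>
  The space \<open>\<real>\<^sup>n\<close> is \<open>real ^ 'd\<close>, whose coordinates are numbered by a bijection
  \<open>e\<close> from \<open>{1..n}\<close> onto the index type: the coordinate \<open>x\<^sub>i\<close> is \<open>x $ e i\<close>.
  A face is given by choosing, for each hyperplane \<open>x\<^sub>i - x\<^sub>j = c\<close>, one of the relations
  \<open><\<close>, \<open>=\<close>, \<open>>\<close>.
\<close>

definition shi_faces :: "nat \<Rightarrow> (nat \<Rightarrow> 'd::finite) \<Rightarrow> (real ^ 'd) set set" where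
  "shi_faces n e =
    {F. F \<noteq> {} \<and>
        (\<exists>\<sigma> :: nat \<Rightarrow> nat \<Rightarrow> real \<Rightarrow> (real \<Rightarrow> real \<Rightarrow> bool).
           (\<forall>i j c. \<sigma> i j c \<in> {(<), (=), (>)}) \<and>
           F = {x. \<forall>i j. 1 \<le> i \<and> i < j \<and> j \<le> n \<longrightarrow>
                     (\<forall>c\<in>{0, 1}. \<sigma> i j c (x $ e i - x $ e j) c)})}"

definition shi_faces_dim :: "nat \<Rightarrow> (nat \<Rightarrow> 'd::finite) \<Rightarrow> nat \<Rightarrow> (real ^ 'd) set set" where
  "shi_faces_dim n e k = {F \<in> shi_faces n e. aff_dim F = int k}"

text \<open>
  The trees of type \<open>'a tree\<close> are the binary trees with labelled nodes and unlabelled leaves.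
  An internal edge is given by the labels of its parent and its child.
\<close>

definition left_internal_edges :: "'a tree \<Rightarrow> ('a \<times> 'a) set" where
  "left_internal_edges t = {(a, b). \<exists>l r r'. Node (Node l b r) a r' \<in> subtrees t}"

definition right_internal_edges :: "'a tree \<Rightarrow> ('a \<times> 'a) set" where
  "right_internal_edges t = {(a, b). \<exists>l' l r. Node l' a (Node l b r) \<in> subtrees t}"

definition descent :: "nat set \<Rightarrow> nat set \<Rightarrow> bool" where
  "descent A B \<longleftrightarrow> Max A > Min B"

text \<open>
  In a decorated tree a node carries a pair \<open>(A, c)\<close>, where \<open>A\<close> is its label and \<open>c\<close> says
  that the edge to its parent is dashed, that is, that the node is captive.
  As only right internal edges can be dashed, the root and the left children are not captive.
\<close>

definition decorated_trees :: "nat \<Rightarrow> (nat set \<times> bool) tree set" where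
  "decorated_trees n =
    {t. distinct (map fst (inorder t)) \<and>
        partition_on {1..n} (fst ` set_tree t) \<and>
        (\<forall>l A c r. t = Node l (A, c) r \<longrightarrow> \<not> c) \<and>
        (\<forall>(a, (B, c)) \<in> left_internal_edges t. \<not> c)}"

definition T_trees :: "nat \<Rightarrow> nat \<Rightarrow> (nat set \<times> bool) tree set" where
  "T_trees n k =
    {t \<in> decorated_trees n.
        (\<forall>((A, c), (B, d)) \<in> right_internal_edges t. descent A B) \<and>
        card {(A, c) \<in> set_tree t. \<not> c} = k}"

definition U_trees :: "nat \<Rightarrow> nat \<Rightarrow> (nat tree \<times> nat set) set" where
  "U_trees n k =
    {(t, M). distinct (inorder t) \<and> set_tree t = {1..n} \<and>
        (\<forall>(a, b) \<in> right_internal_edges t. descent {a} {b}) \<and>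
        M \<subseteq> {a \<in> set_tree t. \<exists>b. (a, b) \<in> left_internal_edges t} \<and>
        card M = n - k}"

text \<open>A simple graph on a vertex set \<open>X\<close> is given by its set of edges, the edges being
  two-element subsets of \<open>X\<close>.\<close>

definition graph_connected :: "'a set \<Rightarrow> 'a set set \<Rightarrow> bool" where
  "graph_connected X E \<longleftrightarrow> (\<forall>u\<in>X. \<forall>v\<in>X. (u, v) \<in> {(x, y). {x, y} \<in> E}\<^sup>*)"

definition graph_cycle :: "'a set set \<Rightarrow> 'a list \<Rightarrow> bool" where
  "graph_cycle E p \<longleftrightarrow> length p \<ge> 3 \<and> distinct p \<and>
     (\<forall>i. Suc i < length p \<longrightarrow> {p ! i, p ! Suc i} \<in> E) \<and> {last p, hd p} \<in> E"

definition tree_on :: "'a set \<Rightarrow> 'a set set \<Rightarrow> bool" where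
  "tree_on X E \<longleftrightarrow> E \<subseteq> {{u, v} | u v. u \<in> X \<and> v \<in> X \<and> u \<noteq> v} \<and>
     graph_connected X E \<and> (\<nexists>p. graph_cycle E p)"

definition vertex_degree :: "'a set set \<Rightarrow> 'a \<Rightarrow> nat" where
  "vertex_degree E v = card {d \<in> E. v \<in> d}"

definition V_trees :: "nat \<Rightarrow> nat \<Rightarrow> (nat set set \<times> nat set) set" where
  "V_trees n k =
    {(E, M). tree_on {1..n + 1} E \<and>
        M \<subseteq> {v \<in> {1..n}. vertex_degree E v \<ge> 2} \<and> card M = n - k}"

definition W_pairs :: "nat \<Rightarrow> nat \<Rightarrow> ((nat \<Rightarrow> nat) \<times> nat set) set" where
  "W_pairs n k =
    {(f, S). f \<in> {1..n - 1} \<rightarrow>\<^sub>E {1..n + 1} \<and>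
        S \<subseteq> f ` {1..n - 1} \<inter> {1..n} \<and> card S = n - k}"

end

theory Submission
  imports Defs "HOL-Library.Multiset"
begin

text \<open>
  Order the distinct coordinates of a point of a Shi face increasingly and let the parent of a
  coordinate value be the largest value that the recorded relations force to lie at least 1 below it.
  The blocks of equal coordinates with these parents form an ordered forest listed in breadth-first
  order, in which only the first child of a block carries a condition, namely a descent;
  read with right child = first child and left child = next sibling it is an element of T. A dashed
  edge records a forced equality, so the dimension is the number of free nodes.

  T and U are related by a local rewriting which turns a block into a marked left chain and a dashed
  edge into a mark. Elements of U, read with left child = first child and right child = next sibling,
  are rooted forests on [n]. Forests, Cayley trees, and functions into [n + 1] are compared through
  the number of structures having prescribed leaves: deleting a leaf multiplies this number by the
  number of possible neighbours, and no structure is without leaves.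
\<close>

section \<open>Counting by leaf removal\<close>

text \<open>Faces, T and U are compared by explicit bijections, U, V and W only by finite cardinals,
  but for each fixed mark set separately: marks lie on non-leaves or on attained values of a
  function, so a value that is not attained plays the part of a leaf, as in a Pruefer code. The two
  readings of a binary tree as a forest differ for a reason. In U the marks sit on nodes with a left
  child, so left child = first child makes these the internal vertices, and descents on right edges
  say that siblings decrease, a normal form of unordered forests. In T descents and dashes sit on
  right edges and have to express the relation between a block and its parent, so there right child
  = first child. Why only a first child is constrained: the arrangement compares x_j with x_i + 1
  only for j < i. When the parent changes from one value to the next, the pair causing the change
  has j in the new block and i in the parent block itself; a later sibling inherits its parent from
  the value before it.\<close>

definition funs_hitting :: "nat \<Rightarrow> nat set \<Rightarrow> nat set \<Rightarrow> nat set \<Rightarrow> (nat \<Rightarrow> nat) set" where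
  "funs_hitting rt X L M =
    {f \<in> {1..card X - 1} \<rightarrow>\<^sub>E insert rt X. L \<inter> f ` {1..card X - 1} = {} \<and> M \<subseteq> f ` {1..card X - 1}}"

lemma finite_funs_hitting: "finite X \<Longrightarrow> finite (funs_hitting rt X L M)"
  unfolding funs_hitting_def by (rule finite_subset[OF _ finite_PiE[of "{1..card X - 1}" "\<lambda>_. insert rt X"]]) auto

lemma card_split_by_element:
  assumes "finite A"
  shows "card {s \<in> A. L \<subseteq> g s \<and> M \<inter> g s = {}} =
    card {s \<in> A. L \<subseteq> g s \<and> insert v M \<inter> g s = {}} + card {s \<in> A. insert v L \<subseteq> g s \<and> M \<inter> g s = {}}"
proof -
  have "{s \<in> A. L \<subseteq> g s \<and> M \<inter> g s = {}} =
    {s \<in> A. L \<subseteq> g s \<and> insert v M \<inter> g s = {}} \<union> {s \<in> A. insert v L \<subseteq> g s \<and> M \<inter> g s = {}}" by auto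
  moreover have "card \<dots> = card {s \<in> A. L \<subseteq> g s \<and> insert v M \<inter> g s = {}} + card {s \<in> A. insert v L \<subseteq> g s \<and> M \<inter> g s = {}}"
    by (rule card_Un_disjoint) (use assms in auto)
  ultimately show ?thesis by simp
qed

text \<open>Either \<open>v\<close> is attained or it is not. This is the recursion of
  \<open>card_split_by_element\<close> with attained values in place of non-leaves, so both counts
  can be reduced in parallel.\<close>

lemma card_funs_hitting_split:
  assumes "finite X"
  shows "card (funs_hitting rt X L M) =
    card (funs_hitting rt X L (insert v M)) + card (funs_hitting rt X (insert v L) M)"
proof -
  have "funs_hitting rt X L M = funs_hitting rt X L (insert v M) \<union> funs_hitting rt X (insert v L) M"
    unfolding funs_hitting_def by auto
  moreover have "card \<dots> = card (funs_hitting rt X L (insert v M)) + card (funs_hitting rt X (insert v L) M)"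
    by (rule card_Un_disjoint[OF finite_funs_hitting[OF assms] finite_funs_hitting[OF assms]]) (auto simp: funs_hitting_def)
  ultimately show ?thesis by simp
qed

lemma card_funs_hitting_avoiding:
  assumes "finite X" "rt \<notin> X" "L \<subseteq> X"
  shows "card (funs_hitting rt X L {}) = (card X + 1 - card L) ^ (card X - 1)"
proof -
  have "funs_hitting rt X L {} = {1..card X - 1} \<rightarrow>\<^sub>E (insert rt X - L)"
  proof -
    have "{f \<in> D \<rightarrow>\<^sub>E Y. L \<inter> f ` D = {} \<and> {} \<subseteq> f ` D} = D \<rightarrow>\<^sub>E (Y - L)" for D :: "nat set" and Y
      unfolding PiE_def Pi_def by blast
    then show ?thesis unfolding funs_hitting_def .
  qed
  moreover have "card (insert rt X - L) = card X + 1 - card L"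
    using assms by (subst card_Diff_subset) (auto intro: finite_subset)
  ultimately show ?thesis by (simp add: card_PiE)
qed

text \<open>There are \<open>card X - 1\<close> arguments, one too few to attain all of
  \<open>X\<close>.\<close>

lemma funs_hitting_all:
  assumes "finite X" "X \<noteq> {}"
  shows "funs_hitting rt X {} X = {}"
proof -
  have "card X \<le> card X - 1" if "X \<subseteq> f ` {1..card X - 1}" for f :: "nat \<Rightarrow> nat"
    using surj_card_le[OF _ that] by simp
  moreover have "card X > 0" using assms by (simp add: card_gt_0_iff)
  ultimately show ?thesis unfolding funs_hitting_def by force
qed

text \<open>What Cayley trees and rooted forests share: a structure with leaf \<open>v\<close> is a
  structure without \<open>v\<close> together with a neighbour \<open>p\<close>, possibly the extra
  vertex \<open>rt\<close>, which never counts as a leaf. \<open>lv_att\<close> records the only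
  effect on the other leaves: \<open>p\<close> stops being one.\<close>

locale leaf_class =
  fixes C :: "nat set \<Rightarrow> 's set" and lv :: "nat set \<Rightarrow> 's \<Rightarrow> nat set"
    and rt :: nat and att :: "nat \<Rightarrow> 's \<times> nat \<Rightarrow> 's"
  assumes card_C_empty: "card (C {}) = 1"
    and lv_subset: "s \<in> C X \<Longrightarrow> lv X s \<subseteq> X"
    and lv_nonempty: "finite X \<Longrightarrow> rt \<notin> X \<Longrightarrow> X \<noteq> {} \<Longrightarrow> s \<in> C X \<Longrightarrow> lv X s \<noteq> {}"
    and att_bij: "finite X \<Longrightarrow> rt \<notin> X \<Longrightarrow> v \<in> X \<Longrightarrow>
      bij_betw (att v) (C (X - {v}) \<times> insert rt (X - {v})) {s \<in> C X. v \<in> lv X s}"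
    and lv_att: "finite X \<Longrightarrow> rt \<notin> X \<Longrightarrow> v \<in> X \<Longrightarrow> s \<in> C (X - {v}) \<Longrightarrow> p \<in> insert rt (X - {v}) \<Longrightarrow>
      lv X (att v (s, p)) = insert v (lv (X - {v}) s - {p})"
begin

text \<open>Every structure on a nonempty \<open>X\<close> has a leaf, so \<open>C X\<close> is
  covered by finitely many images of smaller finite products.\<close>

lemma finite_C: "finite X \<Longrightarrow> rt \<notin> X \<Longrightarrow> finite (C X)"
proof (induction "card X" arbitrary: X rule: less_induct)
  case less
  show ?case
  proof (cases "X = {}")
    case True
    then show ?thesis using card_C_empty by (metis card.infinite zero_neq_one)
  next
    case False
    have "finite {s \<in> C X. v \<in> lv X s}" if v: "v \<in> X" for v
    proof -
      have "card (X - {v}) < card X" using v less.prems by (metis card_Diff1_less)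
      then have "finite (C (X - {v}))" using less by auto
      then have "finite (C (X - {v}) \<times> insert rt (X - {v}))" using less.prems by auto
      then show ?thesis using bij_betw_finite[OF att_bij[OF less.prems v]] by simp
    qed
    moreover have "C X \<subseteq> (\<Union>v\<in>X. {s \<in> C X. v \<in> lv X s})"
      using lv_nonempty[OF less.prems False] lv_subset by fast
    ultimately show ?thesis using less.prems finite_subset by (metis (no_types, lifting) finite_UN)
  qed
qed

text \<open>The elements of \<open>L\<close> stay leaves exactly if \<open>v\<close> is hung on none
  of them, which leaves \<open>card X - card L\<close> neighbours to choose from.\<close>

lemma card_leaf_step:
  assumes X: "finite X" "rt \<notin> X" and v: "v \<in> X" and L: "L \<subseteq> X - {v}"
  shows "card {s \<in> C X. insert v L \<subseteq> lv X s} = card {s \<in> C (X - {v}). L \<subseteq> lv (X - {v}) s} * (card X - card L)"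
proof -
  let ?X = "X - {v}"
  let ?A = "{s \<in> C ?X. L \<subseteq> lv ?X s} \<times> (insert rt ?X - L)"
  have b: "bij_betw (att v) (C ?X \<times> insert rt ?X) {s \<in> C X. v \<in> lv X s}" by (rule att_bij[OF X v])
  have sub: "?A \<subseteq> C ?X \<times> insert rt ?X" by auto
  have "att v ` ?A = {s \<in> C X. insert v L \<subseteq> lv X s}"
  proof
    show "att v ` ?A \<subseteq> {s \<in> C X. insert v L \<subseteq> lv X s}"
    proof clarify
      fix s p assume sp: "s \<in> C ?X" "L \<subseteq> lv ?X s" "p \<in> insert rt ?X" "p \<notin> L"
      then have "att v (s, p) \<in> C X" using b unfolding bij_betw_def by fast
      moreover have "lv X (att v (s, p)) = insert v (lv ?X s - {p})" using sp by (intro lv_att X v) auto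
      ultimately show "att v (s, p) \<in> C X \<and> insert v L \<subseteq> lv X (att v (s, p))" using sp by auto
    qed
    show "{s \<in> C X. insert v L \<subseteq> lv X s} \<subseteq> att v ` ?A"
    proof clarify
      fix s assume s: "s \<in> C X" "insert v L \<subseteq> lv X s"
      then have "s \<in> att v ` (C ?X \<times> insert rt ?X)" using b unfolding bij_betw_def by simp
      then obtain t p where tp: "t \<in> C ?X" "p \<in> insert rt ?X" "s = att v (t, p)" by blast
      have "lv X s = insert v (lv ?X t - {p})" unfolding tp(3) using tp by (intro lv_att X v) auto
      then have "L \<subseteq> lv ?X t" "p \<notin> L" using s L by auto
      then show "s \<in> att v ` ?A" using tp by auto
    qed
  qed
  moreover have "inj_on (att v) ?A" using b sub unfolding bij_betw_def by (blast intro: inj_on_subset)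
  then have "card (att v ` ?A) = card ?A" by (rule card_image)
  ultimately have "card {s \<in> C X. insert v L \<subseteq> lv X s} = card ?A" by simp
  moreover have "card (insert rt ?X - L) = card X - card L"
  proof -
    have "card (insert rt ?X) = card X" using X v card_Suc_Diff1[of X v] by simp
    then show ?thesis using X L by (subst card_Diff_subset) (auto intro: finite_subset)
  qed
  ultimately show ?thesis by (simp add: card_cartesian_product)
qed

text \<open>Detaching \<open>L\<close> leaves a structure on \<open>X - L\<close>; each element of
  \<open>L\<close> may then be hung on any vertex of \<open>insert rt X - L\<close>, because no
  prescribed leaf can carry another one.\<close>

lemma card_leaves_superset:
  assumes "finite X" "rt \<notin> X" "L \<subseteq> X"
  shows "card {s \<in> C X. L \<subseteq> lv X s} = card (C (X - L)) * (card X + 1 - card L) ^ card L"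
proof -
  have "finite L" using assms finite_subset by blast
  then show ?thesis using assms
  proof (induction L arbitrary: X rule: finite_induct)
    case empty
    then show ?case by simp
  next
    case (insert v L)
    have Xv: "card X = Suc (card (X - {v}))" using insert.prems by (intro card.remove) auto
    have "L \<subseteq> X - {v}" using insert by auto
    then have "card {s \<in> C X. insert v L \<subseteq> lv X s} = card {s \<in> C (X - {v}). L \<subseteq> lv (X - {v}) s} * (card X - card L)"
      using insert by (intro card_leaf_step) auto
    also have "card {s \<in> C (X - {v}). L \<subseteq> lv (X - {v}) s} = card (C (X - {v} - L)) * (card (X - {v}) + 1 - card L) ^ card L"
      using insert by (intro insert.IH) auto
    also have "X - {v} - L = X - insert v L" by auto
    finally show ?case using insert.hyps Xv by simp
  qed
qed

text \<open>The forbidden-leaf sets M are treated by moving one element at a time between the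
  two side conditions; for M = X both sides vanish, which is how Cayley's formula comes out.\<close>

lemma card_nonleaves_superset:
  assumes "finite X" "rt \<notin> X" "X \<noteq> {}" "M \<subseteq> X"
  shows "card {s \<in> C X. M \<inter> lv X s = {}} = card (funs_hitting rt X {} M)"
  using assms
proof (induction "card X" arbitrary: X M rule: less_induct)
  case less
  note X = less.prems(1-3)
  \<comment> \<open>A nonempty \<open>L\<close> makes \<open>X - L\<close> strictly smaller, so the
    induction hypothesis with empty mark set gives the number of structures there, and both sides
    become the same power of \<open>card X + 1 - card L\<close>.\<close>
  have h: "card {s \<in> C X. L \<subseteq> lv X s} = card (funs_hitting rt X L {})" if L: "L \<subseteq> X" "L \<noteq> {}" for L
  proof -
    have fL: "finite L" using L X finite_subset by blast
    have cXL: "card (X - L) = card X - card L" using fL L by (simp add: card_Diff_subset)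
    have le: "card L \<le> card X" and pos: "card L > 0" using L X fL by (auto intro: card_mono simp: card_gt_0_iff)
    have "card (C (X - L)) * (card X + 1 - card L) ^ card L = (card X + 1 - card L) ^ (card X - 1)"
    proof (cases "X - L = {}")
      case True
      \<comment> \<open>Here the base of the power is 1 and only the single structure on the empty
        set remains.\<close>
      then have "L = X" using L by auto
      then show ?thesis using card_C_empty by simp
    next
      case False
      have "card {s \<in> C (X - L). {} \<inter> lv (X - L) s = {}} = card (funs_hitting rt (X - L) {} {})"
        using False X pos le cXL by (intro less.hyps) auto
      then have "card (C (X - L)) = (card X + 1 - card L) ^ (card X - card L - 1)"
        using X cXL le card_funs_hitting_avoiding[of "X - L" rt "{}"] by (simp add: Suc_diff_le)
      moreover have "card X - card L > 0" using False cXL X by (metis card_gt_0_iff finite_Diff)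
      ultimately show ?thesis using pos by (simp flip: power_add)
    qed
    then show ?thesis using card_leaves_superset[OF X(1,2) L(1)] card_funs_hitting_avoiding[OF X(1,2) L(1)] by simp
  qed
  have h2: "card {s \<in> C X. L \<subseteq> lv X s \<and> M \<inter> lv X s = {}} = card (funs_hitting rt X L M)"
    if "M \<subseteq> X" "L \<subseteq> X" "L \<noteq> {}" for L M
  proof -
    have "finite M" using that X finite_subset by blast
    then show ?thesis using that
    proof (induction M arbitrary: L rule: finite_induct)
      case empty
      then show ?case using h by simp
    next
      case (insert v M)
      have "card {s \<in> C X. L \<subseteq> lv X s \<and> M \<inter> lv X s = {}} = card (funs_hitting rt X L M)"
        "card {s \<in> C X. insert v L \<subseteq> lv X s \<and> M \<inter> lv X s = {}} = card (funs_hitting rt X (insert v L) M)"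
        using insert.IH[of L] insert.IH[of "insert v L"] insert.prems by simp_all
      then show ?case
        using card_split_by_element[OF finite_C[OF X(1,2)], of L "lv X" M v]
          card_funs_hitting_split[OF X(1), of rt L M v] by simp
    qed
  qed
  from less.prems(4) show ?case
  proof (induction "card (X - M)" arbitrary: M)
    case 0
    then have "M = X" using X by auto
    then have none: "{s \<in> C X. M \<inter> lv X s = {}} = {}" using lv_nonempty[OF X] lv_subset by blast
    show ?case unfolding none using funs_hitting_all[OF X(1,3)] \<open>M = X\<close> by simp
  next
    case (Suc m)
    then obtain v where v: "v \<in> X" "v \<notin> M" by (metis DiffE card.empty ex_in_conv nat.distinct(1))
    have "card (X - insert v M) = m" using Suc.hyps(2) v X
      by (metis Diff_insert DiffI card_Diff_singleton diff_Suc_1)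
    then have "card {s \<in> C X. insert v M \<inter> lv X s = {}} = card (funs_hitting rt X {} (insert v M))"
      using Suc v by (metis insert_subset)
    moreover have "card {s \<in> C X. {v} \<subseteq> lv X s \<and> M \<inter> lv X s = {}} = card (funs_hitting rt X {v} M)"
      using h2[of M "{v}"] Suc.prems v by simp
    ultimately show ?case
      using card_split_by_element[OF finite_C[OF X(1,2)], of "{}" "lv X" M v]
        card_funs_hitting_split[OF X(1), of rt "{}" M v] by simp
  qed
qed

end

section \<open>Structures together with a set of marked non-leaves\<close>

lemma card_marked:
  assumes "finite A" "finite X"
  shows "card {(s, M). s \<in> A \<and> M \<subseteq> X \<and> R s M \<and> card M = m} =
    (\<Sum>M \<in> {M. M \<subseteq> X \<and> card M = m}. card {s \<in> A. R s M})"
proof -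
  have "{(s, M). s \<in> A \<and> M \<subseteq> X \<and> R s M \<and> card M = m} =
    prod.swap ` (SIGMA M : {M. M \<subseteq> X \<and> card M = m}. {s \<in> A. R s M})" by (auto simp: image_iff)
  then have "card {(s, M). s \<in> A \<and> M \<subseteq> X \<and> R s M \<and> card M = m} =
    card (SIGMA M : {M. M \<subseteq> X \<and> card M = m}. {s \<in> A. R s M})" by (simp add: card_image)
  also have "\<dots> = (\<Sum>M \<in> {M. M \<subseteq> X \<and> card M = m}. card {s \<in> A. R s M})"
    using assms by (intro card_SigmaI) auto
  finally show ?thesis .
qed

lemma finite_marked:
  assumes "finite A" "finite X"
  shows "finite {(s, M). s \<in> A \<and> M \<subseteq> X \<and> R s M \<and> card M = m}"
  by (rule finite_subset[of _ "A \<times> Pow X"]) (use assms in auto)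

text \<open>Summing over the mark set first reduces the claim to
  \<open>card_nonleaves_superset\<close> for each \<open>M\<close>; no single bijection respecting
  all \<open>M\<close> is constructed.\<close>

lemma (in leaf_class) card_marked_nonleaves:
  assumes "finite X" "rt \<notin> X" "X \<noteq> {}"
  shows "card {(s, M). s \<in> C X \<and> M \<subseteq> X \<and> M \<inter> lv X s = {} \<and> card M = m} =
    card {(f, S). f \<in> {1..card X - 1} \<rightarrow>\<^sub>E insert rt X \<and> S \<subseteq> X \<and> S \<subseteq> f ` {1..card X - 1} \<and> card S = m}"
proof -
  have "card {s \<in> C X. M \<inter> lv X s = {}} = card {f \<in> {1..card X - 1} \<rightarrow>\<^sub>E insert rt X. M \<subseteq> f ` {1..card X - 1}}"
    if "M \<subseteq> X" for M
    using card_nonleaves_superset[OF assms that] unfolding funs_hitting_def by simp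
  moreover have "finite ({1..card X - 1} \<rightarrow>\<^sub>E insert rt X)" using assms by (intro finite_PiE) auto
  ultimately show ?thesis using assms finite_C[OF assms(1,2)]
    by (subst (1 2) card_marked) (auto intro!: sum.cong)
qed

section \<open>Cayley trees\<close>

text \<open>The neighbours are the predecessor and the successor along the cycle, with the closing
  edge serving at the two ends of the list; length at least 3 keeps them distinct.\<close>

lemma graph_cycle_two_neighbours:
  assumes "graph_cycle E q" "v \<in> set q"
  shows "\<exists>a b. a \<noteq> b \<and> {v, a} \<in> E \<and> {v, b} \<in> E"
proof -
  have len: "length q \<ge> 3" and d: "distinct q" and st: "\<And>i. Suc i < length q \<Longrightarrow> {q ! i, q ! Suc i} \<in> E"
    and cl: "{last q, hd q} \<in> E" using assms(1) unfolding graph_cycle_def by auto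
  have ne: "q \<noteq> []" using len by auto
  obtain i where i: "i < length q" "v = q ! i" using assms(2) by (metis in_set_conv_nth)
  consider "i = 0" | "Suc i = length q" | "i > 0" "Suc i < length q" using i by linarith
  then show ?thesis
  proof cases
    case 1
    have "{v, last q} \<in> E" using cl 1 i ne by (simp add: hd_conv_nth insert_commute)
    moreover have "{v, q ! 1} \<in> E" using st[of 0] len 1 i by auto
    moreover have "last q \<noteq> q ! 1" using d len ne by (simp add: last_conv_nth nth_eq_iff_index_eq)
    ultimately show ?thesis by blast
  next
    case 2
    have v: "v = last q" using 2 i ne by (metis diff_Suc_1 last_conv_nth)
    obtain j where j: "i = Suc j" using 2 len by (cases i) auto
    have "{v, q ! j} \<in> E" using st[of j] 2 i j by (simp add: insert_commute)
    moreover have "q ! j \<noteq> hd q" using d len ne 2 j by (simp add: hd_conv_nth nth_eq_iff_index_eq)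
    ultimately show ?thesis using v cl by blast
  next
    case 3
    obtain j where j: "i = Suc j" using 3 by (cases i) auto
    have "{v, q ! j} \<in> E" using st[of j] 3 i j by (simp add: insert_commute)
    moreover have "{v, q ! Suc i} \<in> E" using st[of i] 3 i by simp
    moreover have "q ! j \<noteq> q ! Suc i" using d 3 j by (simp add: nth_eq_iff_index_eq)
    ultimately show ?thesis by blast
  qed
qed

lemma graph_cycle_mono: "graph_cycle E q \<Longrightarrow> E \<subseteq> E' \<Longrightarrow> graph_cycle E' q"
  unfolding graph_cycle_def by blast

lemma tree_on_edgeD: "tree_on X E \<Longrightarrow> {u, v} \<in> E \<Longrightarrow> u \<in> X \<and> v \<in> X \<and> u \<noteq> v"
  unfolding tree_on_def by (auto simp: doubleton_eq_iff subset_iff) 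

lemma tree_on_edge_subset: "tree_on X E \<Longrightarrow> d \<in> E \<Longrightarrow> d \<subseteq> X"
  unfolding tree_on_def by blast

lemma tree_on_finite: "tree_on X E \<Longrightarrow> finite X \<Longrightarrow> finite E"
  by (rule finite_subset[of _ "Pow X"]) (auto dest: tree_on_edge_subset)

lemma tree_on_edge_cases: 
  assumes "tree_on X E" "d \<in> E" "v \<in> d" obtains u where "d = {v, u}" "u \<in> X" "u \<noteq> v"
  using assms unfolding tree_on_def by blast

text \<open>The new vertex has \<open>p\<close> as its only neighbour, so no cycle passes through
  it, and it is reached from every old vertex through \<open>p\<close>.\<close>

lemma tree_on_insert_leaf:
  assumes t: "tree_on Y E" and v: "v \<notin> Y" and p: "p \<in> Y"
  shows "tree_on (insert v Y) (insert {v, p} E)"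
  unfolding tree_on_def
proof (intro conjI)
  have sub: "E \<subseteq> {{u, w} |u w. u \<in> Y \<and> w \<in> Y \<and> u \<noteq> w}" using t unfolding tree_on_def by blast
  then show "insert {v, p} E \<subseteq> {{u, w} |u w. u \<in> insert v Y \<and> w \<in> insert v Y \<and> u \<noteq> w}" using v p by blast
  let ?R = "{(x, y). {x, y} \<in> insert {v, p} E}"
  have "{(x, y). {x, y} \<in> E}\<^sup>* \<subseteq> ?R\<^sup>*" by (rule rtrancl_mono) auto
  then have con: "(a, b) \<in> ?R\<^sup>*" if "a \<in> Y" "b \<in> Y" for a b
    using t that unfolding tree_on_def graph_connected_def by blast
  have "(v, p) \<in> ?R" "(p, v) \<in> ?R" by (auto simp: insert_commute)
  then have "(a, v) \<in> ?R\<^sup>* \<and> (v, a) \<in> ?R\<^sup>*" if "a \<in> Y" for a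
    using con[OF that p] con[OF p that] by (meson converse_rtrancl_into_rtrancl rtrancl.rtrancl_into_rtrancl)
  then show "graph_connected (insert v Y) (insert {v, p} E)"
    unfolding graph_connected_def using con by auto
  show "\<nexists>q. graph_cycle (insert {v, p} E) q"
  proof
    assume "\<exists>q. graph_cycle (insert {v, p} E) q"
    then obtain q where q: "graph_cycle (insert {v, p} E) q" by blast
    show False
    proof (cases "v \<in> set q")
      case True
      then obtain a b where ab: "a \<noteq> b" "{v, a} \<in> insert {v, p} E" "{v, b} \<in> insert {v, p} E"
        using graph_cycle_two_neighbours[OF q] by blast
      have "{v, c} \<notin> E" for c using tree_on_edgeD[OF t] v by blast
      then show False using ab by (auto simp: doubleton_eq_iff)
    next
      case False
      have len: "length q \<ge> 3" using q unfolding graph_cycle_def by blast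
      then have "q ! i \<noteq> v" if "i < length q" for i using False that nth_mem by blast
      moreover have "q \<noteq> []" using len by auto
      then have "last q \<noteq> v" "hd q \<noteq> v" using False last_in_set hd_in_set by blast+
      ultimately have "graph_cycle E q"
        using q unfolding graph_cycle_def by (auto simp: doubleton_eq_iff)
      then show False using t unfolding tree_on_def by blast
    qed
  qed
qed

lemma tree_on_has_neighbour:
  assumes t: "tree_on Y E" and "v \<in> Y" "u \<in> Y" "u \<noteq> v"
  shows "\<exists>p. {v, p} \<in> E"
proof -
  have "(v, u) \<in> {(x, y). {x, y} \<in> E}\<^sup>*" using assms unfolding tree_on_def graph_connected_def by blast
  then show ?thesis using assms(4) by (auto elim: converse_rtranclE)
qed

lemma tree_on_remove_leaf:
  assumes t: "tree_on (insert v Y) E" and v: "v \<notin> Y" and Y: "finite Y" "Y \<noteq> {}"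
    and deg: "vertex_degree E v < 2"
  shows "\<exists>p\<in>Y. {v, p} \<in> E \<and> tree_on Y (E - {{v, p}})"
proof -
  obtain p where p: "{v, p} \<in> E" using tree_on_has_neighbour[OF t] Y v by blast
  then have pY: "p \<in> Y" using tree_on_edgeD[OF t] by blast
  have fE: "finite E" using tree_on_finite[OF t] Y by simp
  have only: "d = {v, p}" if "d \<in> E" "v \<in> d" for d
  proof (rule ccontr)
    assume "d \<noteq> {v, p}"
    then have "card {d, {v, p}} = 2" by simp
    moreover have "card {d, {v, p}} \<le> vertex_degree E v"
      unfolding vertex_degree_def using that p fE by (intro card_mono) auto
    ultimately show False using deg by simp
  qed
  let ?E = "E - {{v, p}}"
  have "tree_on Y ?E" unfolding tree_on_def
  proof (intro conjI)
    show "?E \<subseteq> {{u, w} |u w. u \<in> Y \<and> w \<in> Y \<and> u \<noteq> w}"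
    proof
      fix d assume d: "d \<in> ?E"
      then obtain u w where "d = {u, w}" "u \<in> insert v Y" "w \<in> insert v Y" "u \<noteq> w"
        using t unfolding tree_on_def by blast
      moreover have "v \<notin> d" using only d by blast
      ultimately show "d \<in> {{u, w} |u w. u \<in> Y \<and> w \<in> Y \<and> u \<noteq> w}" by blast
    qed
    show "\<nexists>q. graph_cycle ?E q"
      using t graph_cycle_mono[of ?E] unfolding tree_on_def by blast
    show "graph_connected Y ?E" unfolding graph_connected_def
    proof (intro ballI)
      fix a b assume ab: "a \<in> Y" "b \<in> Y"
      then have "(a, b) \<in> {(x, y). {x, y} \<in> E}\<^sup>*" using t unfolding tree_on_def graph_connected_def by blast
      \<comment> \<open>The walk is followed with \<open>v\<close> replaced by \<open>p\<close>: as
        \<open>{v, p}\<close> is the only edge at \<open>v\<close>, a visit to \<open>v\<close>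
        comes from \<open>p\<close> and returns to \<open>p\<close>, and can be cut out.\<close>
      then have "if b = v then (a, p) \<in> {(x, y). {x, y} \<in> ?E}\<^sup>* else (a, b) \<in> {(x, y). {x, y} \<in> ?E}\<^sup>*"
      proof (induction rule: rtrancl_induct)
        case base
        then show ?case using ab v by auto
      next
        case (step y z)
        have yz: "{y, z} \<in> E" "y \<noteq> z" using step tree_on_edgeD[OF t] by auto
        show ?case
        proof (cases "y = v \<or> z = v")
          case True
          then have "{y, z} = {v, p}" using only yz by blast
          then have "y = v \<and> z = p \<or> y = p \<and> z = v" by (auto simp: doubleton_eq_iff)
          then show ?thesis using step.IH yz by auto
        next
          case False
          then have "{y, z} \<in> ?E" using yz by (auto simp: doubleton_eq_iff)
          then show ?thesis using step.IH False by (auto intro: rtrancl.rtrancl_into_rtrancl)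
        qed
      qed
      moreover have "b \<noteq> v" using ab v by blast
      ultimately show "(a, b) \<in> {(x, y). {x, y} \<in> ?E}\<^sup>*" by (simp only: if_False)
    qed
  qed
  then show ?thesis using p pY by blast
qed

text \<open>The end of a longest path starting at the root is a leaf.\<close>

lemma tree_on_has_leaf:
  assumes t: "tree_on (insert rt X) E" and X: "finite X" "rt \<notin> X" "X \<noteq> {}"
  shows "\<exists>v\<in>X. vertex_degree E v < 2"
proof -
  define P where "P = {q. distinct q \<and> q \<noteq> [] \<and> hd q = rt \<and> set q \<subseteq> insert rt X \<and>
    (\<forall>i. Suc i < length q \<longrightarrow> {q ! i, q ! Suc i} \<in> E)}"
  obtain y where y: "{rt, y} \<in> E" using tree_on_has_neighbour[OF t] X by blast
  have "y \<in> insert rt X" "y \<noteq> rt" using tree_on_edgeD[OF t y] by auto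
  then have P2: "[rt, y] \<in> P" using y unfolding P_def by auto
  have "length q \<le> card (insert rt X)" if "q \<in> P" for q
    using that X unfolding P_def by (metis (mono_tags, lifting) card_mono distinct_card finite_insert mem_Collect_eq)
  then have bound: "\<forall>q. q \<in> P \<longrightarrow> length q < Suc (card (insert rt X))" by (simp add: le_imp_less_Suc)
  obtain q where q: "q \<in> P" and qmax: "\<And>q'. q' \<in> P \<Longrightarrow> length q' \<le> length q"
    using ex_has_greatest_nat[of "\<lambda>q. q \<in> P" "[rt, y]" length] P2 bound by blast
  have len: "length q \<ge> 2" using qmax[OF P2] by simp
  have qp: "distinct q" "q \<noteq> []" "hd q = rt" "set q \<subseteq> insert rt X"
    "\<And>i. Suc i < length q \<Longrightarrow> {q ! i, q ! Suc i} \<in> E" using q unfolding P_def by auto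
  let ?v = "last q"
  have v_nth: "?v = q ! (length q - 1)" using qp by (simp add: last_conv_nth)
  have "?v \<noteq> rt" using qp len by (auto simp: v_nth hd_conv_nth nth_eq_iff_index_eq)
  then have vX: "?v \<in> X" using qp by (meson insertE last_in_set subsetD)
  have "vertex_degree E ?v < 2"
  proof (rule ccontr)
    assume "\<not> vertex_degree E ?v < 2"
    moreover define u where "u = q ! (length q - 2)"
    moreover have "card {d \<in> E. ?v \<in> d} \<le> card {{?v, u}}" if "{d \<in> E. ?v \<in> d} \<subseteq> {{?v, u}}"
      by (rule card_mono) (use that in auto)
    ultimately have "\<not> {d \<in> E. ?v \<in> d} \<subseteq> {{?v, u}}"
      unfolding vertex_degree_def by auto
    then obtain d where d: "d \<in> E" "?v \<in> d" "d \<noteq> {?v, u}" by blast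
    then obtain w where w: "d = {?v, w}" "w \<in> insert rt X" "w \<noteq> ?v" using tree_on_edge_cases[OF t] by metis
    then have wu: "w \<noteq> u" using d by auto
    \<comment> \<open>A second neighbour \<open>w\<close> of the end either prolongs the longest
      path or lies on it. In the latter case it is neither the end nor its predecessor
      \<open>u\<close>, so the segment from \<open>w\<close> on has at least three vertices and
      closes to a cycle.\<close>
    show False
    proof (cases "w \<in> set q")
      case False
      have "{(q @ [w]) ! i, (q @ [w]) ! Suc i} \<in> E" if i: "Suc i < length (q @ [w])" for i
      proof (cases "Suc i = length q")
        case True
        then have "q ! i = ?v" by (simp add: v_nth flip: True)
        then show ?thesis using True d w by (simp add: nth_append)
      next
        case False
        then show ?thesis using qp(5)[of i] i by (simp add: nth_append)
      qed
      then have "q @ [w] \<in> P" unfolding P_def using qp(1-4) w(2) False by auto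
      then show False using qmax by fastforce
    next
      case True
      then obtain i where i: "i < length q" "q ! i = w" by (metis in_set_conv_nth)
      have "i \<noteq> length q - 1" "i \<noteq> length q - 2" using i w wu v_nth u_def by auto
      then have i3: "i + 3 \<le> length q" using i len by linarith
      have "graph_cycle E (drop i q)" unfolding graph_cycle_def
        using i3 qp i d w by (auto simp: hd_drop_conv_nth)
      then show False using t unfolding tree_on_def by blast
    qed
  qed
  then show ?thesis using vX by blast
qed

text \<open>Degree below 2 is the negation of being internal. The root \<open>rt\<close> will be
  \<open>n + 1\<close>, the vertex that may not be marked; it lies outside \<open>X\<close> and so
  is no leaf in the sense of the locale, whatever its degree.\<close>

lemma leaf_class_Cayley:
  "leaf_class (\<lambda>X. {E. tree_on (insert rt X) E}) (\<lambda>X E. {v \<in> X. vertex_degree E v < 2}) rt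
    (\<lambda>v (E, p). insert {v, p} E)"
proof
  have "{E. tree_on {rt} E} = {{}}"
    unfolding tree_on_def graph_connected_def graph_cycle_def by auto
  then show "card {E. tree_on (insert rt {}) E} = 1" by simp
  fix X :: "nat set" and s assume "s \<in> {E. tree_on (insert rt X) E}"
  then show "{v \<in> X. vertex_degree s v < 2} \<subseteq> X" by auto
  assume "finite X" "rt \<notin> X" "X \<noteq> {}" "s \<in> {E. tree_on (insert rt X) E}"
  then show "{v \<in> X. vertex_degree s v < 2} \<noteq> {}" using tree_on_has_leaf[of rt X s] by auto
next
  fix X v assume X: "finite X" "rt \<notin> X" "v \<in> X"
  let ?X = "X - {v}"
  have Y: "insert rt X = insert v (insert rt ?X)" "v \<notin> insert rt ?X" using X by auto
  have notin: "d \<in> E \<Longrightarrow> v \<notin> d" if "tree_on (insert rt ?X) E" for E d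
    using tree_on_edge_subset[OF that] Y(2) by blast
  have deg_v: "vertex_degree (insert {v, p} E) v = 1" if "tree_on (insert rt ?X) E" for E p
  proof -
    have "{d \<in> insert {v, p} E. v \<in> d} = {{v, p}}" using notin[OF that] by auto
    then show ?thesis unfolding vertex_degree_def by simp
  qed
  show "bij_betw (\<lambda>(E, p). insert {v, p} E) ({E. tree_on (insert rt ?X) E} \<times> insert rt ?X)
    {s \<in> {E. tree_on (insert rt X) E}. v \<in> {v \<in> X. vertex_degree s v < 2}}"
    unfolding bij_betw_def
  proof
    show "inj_on (\<lambda>(E, p). insert {v, p} E) ({E. tree_on (insert rt ?X) E} \<times> insert rt ?X)"
    proof (rule inj_onI, clarify)
      fix E p E' p' assume E: "tree_on (insert rt ?X) E" "tree_on (insert rt ?X) E'"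
        and eq: "insert {v, p} E = insert {v, p'} E'"
      have n: "{v, p} \<notin> E" "{v, p} \<notin> E'" "{v, p'} \<notin> E'" using notin E by blast+
      then have "{v, p} = {v, p'}" using eq by blast
      then show "E = E' \<and> p = p'" using n eq by (metis doubleton_eq_iff insert_ident)
    qed
    show "(\<lambda>(E, p). insert {v, p} E) ` ({E. tree_on (insert rt ?X) E} \<times> insert rt ?X) =
      {s \<in> {E. tree_on (insert rt X) E}. v \<in> {v \<in> X. vertex_degree s v < 2}}" (is "?l = ?r")
    proof
      show "?l \<subseteq> ?r"
      proof
        fix E' assume "E' \<in> ?l"
        then obtain E p where E: "tree_on (insert rt ?X) E" and p: "p \<in> insert rt ?X" and E': "E' = insert {v, p} E" by auto
        have "tree_on (insert rt X) E'"
          unfolding Y(1) E' using tree_on_insert_leaf[OF E Y(2) p] .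
        then show "E' \<in> ?r" using X deg_v[OF E] E' by simp
      qed
      show "?r \<subseteq> ?l"
      proof clarify
        fix E assume E: "tree_on (insert rt X) E" "vertex_degree E v < 2"
        then obtain p where "p \<in> insert rt ?X" "{v, p} \<in> E" "tree_on (insert rt ?X) (E - {{v, p}})"
          using tree_on_remove_leaf[of v "insert rt ?X" E] X Y by auto
        then show "E \<in> ?l" by (intro image_eqI[of _ _ "(E - {{v, p}}, p)"]) auto
      qed
    qed
  qed
  fix E p assume "E \<in> {E. tree_on (insert rt ?X) E}" and p: "p \<in> insert rt ?X"
  then have E: "tree_on (insert rt ?X) E" by auto
  have pE: "{v, p} \<notin> E" using notin[OF E] by blast
  have fE: "finite E" using tree_on_finite[OF E] X by simp
  have deg_other: "vertex_degree (insert {v, p} E) w = vertex_degree E w" if "w \<noteq> v" "w \<noteq> p" for w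
  proof -
    have "{d \<in> insert {v, p} E. w \<in> d} = {d \<in> E. w \<in> d}" using that by auto
    then show ?thesis unfolding vertex_degree_def by simp
  qed
  \<comment> \<open>The smaller tree contains \<open>rt\<close> besides \<open>p\<close>, so
    \<open>p\<close> already had a neighbour there; with \<open>v\<close> it has two.\<close>
  have deg_p: "\<not> vertex_degree (insert {v, p} E) p < 2" if pX: "p \<in> ?X"
  proof -
    obtain u where "{p, u} \<in> E" using tree_on_has_neighbour[OF E, of p rt] pX X by blast
    then have "{{v, p}, {p, u}} \<subseteq> {d \<in> insert {v, p} E. p \<in> d}" "{v, p} \<noteq> {p, u}" using pE by auto
    then have "card {{v, p}, {p, u}} \<le> vertex_degree (insert {v, p} E) p"
      unfolding vertex_degree_def using fE by (intro card_mono) auto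
    then show ?thesis using \<open>{v, p} \<noteq> {p, u}\<close> by simp
  qed
  have "w \<in> X \<and> vertex_degree (insert {v, p} E) w < 2 \<longleftrightarrow>
    w \<in> insert v ({w \<in> ?X. vertex_degree E w < 2} - {p})" for w
    using deg_v[OF E, of p] X p deg_p deg_other[of w] by (cases "w = v"; cases "w = p") auto
  then show "{w \<in> X. vertex_degree (case (E, p) of (E, p) \<Rightarrow> insert {v, p} E) w < 2} =
    insert v ({w \<in> ?X. vertex_degree E w < 2} - {p})" by auto
qed

section \<open>Binary trees with decreasing right edges\<close>

fun root_less :: "nat tree \<Rightarrow> nat \<Rightarrow> bool" where
  "root_less Leaf b = True" |
  "root_less (Node l a r) b = (a < b)"

fun right_decreasing :: "nat tree \<Rightarrow> bool" where
  "right_decreasing Leaf = True" |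
  "right_decreasing (Node l a r) = (right_decreasing l \<and> right_decreasing r \<and> root_less r a)"

text \<open>In the forest reading below these are the vertices having a child, so the complement is
  the set of leaves.\<close>

fun left_parents :: "'a tree \<Rightarrow> 'a set" where
  "left_parents Leaf = {}" |
  "left_parents (Node l a r) = (if l = Leaf then {} else {a}) \<union> left_parents l \<union> left_parents r"

text \<open>
  Reading the left child as first child and the right child as next sibling, a tree with
  decreasing right edges is a rooted forest. In this reading \<open>forest_parent q t v\<close> is the parent
  of \<open>v\<close>, where \<open>q\<close> is the parent of the roots, and \<open>attach_leaf\<close>/\<open>detach_leaf\<close> insert and
  remove a childless vertex \<open>v\<close>.
\<close>

fun forest_parent :: "nat \<Rightarrow> nat tree \<Rightarrow> nat \<Rightarrow> nat" where
  "forest_parent q Leaf v = q" |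
  "forest_parent q (Node l a r) v =
    (if v = a then q else if v \<in> set_tree l then forest_parent a l v else forest_parent q r v)"

fun detach_leaf :: "nat \<Rightarrow> nat tree \<Rightarrow> nat tree" where
  "detach_leaf v Leaf = Leaf" |
  "detach_leaf v (Node l a r) = (if a = v then r else Node (detach_leaf v l) a (detach_leaf v r))"

fun attach_leaf :: "nat \<Rightarrow> nat \<Rightarrow> nat \<Rightarrow> nat tree \<Rightarrow> nat tree" where
  "attach_leaf q v p Leaf = Node Leaf v Leaf" |
  "attach_leaf q v p (Node l a r) =
    (if p = q then (if a < v then Node Leaf v (Node l a r) else Node l a (attach_leaf q v q r))
     else if p = a \<or> p \<in> set_tree l then Node (attach_leaf a v p l) a r
     else Node l a (attach_leaf q v p r))"

lemma attach_leaf_not_Leaf [simp]: "attach_leaf q v p t \<noteq> Leaf"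
  by (cases t) auto

lemma set_attach_leaf: "set_tree (attach_leaf q v p t) = insert v (set_tree t)"
  by (induction q v p t rule: attach_leaf.induct) auto

lemma distinct_attach_leaf:
  "distinct (inorder t) \<Longrightarrow> v \<notin> set_tree t \<Longrightarrow> distinct (inorder (attach_leaf q v p t))"
  by (induction q v p t rule: attach_leaf.induct) (auto simp: set_attach_leaf)

lemma root_less_attach_leaf:
  "root_less t b \<Longrightarrow> p = q \<longrightarrow> v < b \<Longrightarrow> p \<in> insert q (set_tree t) \<Longrightarrow> root_less (attach_leaf q v p t) b"
  by (cases t) auto

lemma right_decreasing_attach_leaf:
  "right_decreasing t \<Longrightarrow> v \<notin> set_tree t \<Longrightarrow> p \<in> insert q (set_tree t) \<Longrightarrow>
    right_decreasing (attach_leaf q v p t)"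
  by (induction q v p t rule: attach_leaf.induct) (auto intro!: root_less_attach_leaf)

lemma detach_leaf_notin: "v \<notin> set_tree t \<Longrightarrow> detach_leaf v t = t"
  by (induction t) auto

lemma detach_attach_leaf:
  "v \<notin> set_tree t \<Longrightarrow> p \<in> insert q (set_tree t) \<Longrightarrow> detach_leaf v (attach_leaf q v p t) = t"
  by (induction q v p t rule: attach_leaf.induct) (auto simp: detach_leaf_notin)

lemma forest_parent_attach_leaf:
  "v \<notin> set_tree t \<Longrightarrow> q \<notin> set_tree t \<Longrightarrow> distinct (inorder t) \<Longrightarrow> p \<in> insert q (set_tree t) \<Longrightarrow>
    forest_parent q (attach_leaf q v p t) v = p"
  by (induction q v p t rule: attach_leaf.induct) (auto simp: set_attach_leaf)

lemma left_parents_subset: "left_parents t \<subseteq> set_tree t"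
  by (induction t) auto

text \<open>Only \<open>p\<close> gains a child. For \<open>p = q\<close> the new vertex joins the
  roots and no vertex of the tree changes its status.\<close>

lemma left_parents_attach_leaf:
  "q \<notin> set_tree t \<Longrightarrow> distinct (inorder t) \<Longrightarrow> p \<in> insert q (set_tree t) \<Longrightarrow>
    left_parents (attach_leaf q v p t) = left_parents t \<union> ({p} - {q})"
  by (induction q v p t rule: attach_leaf.induct) auto

text \<open>Detaching keeps only the right subtree of \<open>v\<close>, that is, its later siblings;
  nothing else is lost exactly because \<open>v\<close> has no left child.\<close>

lemma set_detach_leaf:
  "distinct (inorder t) \<Longrightarrow> v \<notin> left_parents t \<Longrightarrow> set_tree (detach_leaf v t) = set_tree t - {v}"
  by (induction t) (auto simp: detach_leaf_notin split: if_splits)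

lemma distinct_detach_leaf:
  "distinct (inorder t) \<Longrightarrow> v \<notin> left_parents t \<Longrightarrow> distinct (inorder (detach_leaf v t))"
  by (induction t) (auto simp: set_detach_leaf split: if_splits)

lemma root_less_detach_leaf:
  "right_decreasing t \<Longrightarrow> root_less t b \<Longrightarrow> root_less (detach_leaf v t) b"
proof (cases t)
  case (Node l a r)
  then show "right_decreasing t \<Longrightarrow> root_less t b \<Longrightarrow> root_less (detach_leaf v t) b" by (cases r) auto
qed auto

lemma right_decreasing_detach_leaf: "right_decreasing t \<Longrightarrow> right_decreasing (detach_leaf v t)"
  by (induction t) (auto intro: root_less_detach_leaf)

lemma forest_parent_in:
  "distinct (inorder t) \<Longrightarrow> q \<notin> set_tree t \<Longrightarrow> v \<in> set_tree t \<Longrightarrow> forest_parent q t v \<in> insert q (set_tree t - {v})"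
proof (induction q t v rule: forest_parent.induct)
  case (2 q l a r v)
  then show ?case by (auto split: if_splits)
qed auto

text \<open>A vertex with parent \<open>q\<close> lies on the right spine, along which the labels
  decrease from a root below \<open>b\<close>.\<close>

lemma forest_parent_top_less:
  "right_decreasing t \<Longrightarrow> root_less t b \<Longrightarrow> distinct (inorder t) \<Longrightarrow> q \<notin> set_tree t \<Longrightarrow> v \<in> set_tree t \<Longrightarrow>
    forest_parent q t v = q \<Longrightarrow> v < b"
proof (induction t arbitrary: b)
  case (Node l a r)
  show ?case
  proof (cases "v = a")
    case False
    have "v \<notin> set_tree l"
    proof
      assume v: "v \<in> set_tree l"
      then have "forest_parent a l v \<in> insert a (set_tree l - {v})" using Node.prems by (intro forest_parent_in) auto
      then show False using Node.prems False v by auto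
    qed
    then have "v < a" using Node False by auto
    then show ?thesis using Node.prems by auto
  qed (use Node in auto)
qed auto

text \<open>Siblings decrease, so the place of \<open>v\<close> among the children of its parent is
  forced and reinsertion finds it again; \<open>forest_parent_top_less\<close> makes
  \<open>v\<close> pass the larger siblings before it.\<close>

lemma attach_detach_leaf:
  "right_decreasing t \<Longrightarrow> distinct (inorder t) \<Longrightarrow> q \<notin> set_tree t \<Longrightarrow> v \<in> set_tree t \<Longrightarrow> v \<notin> left_parents t \<Longrightarrow>
    attach_leaf q v (forest_parent q t v) (detach_leaf v t) = t"
proof (induction t arbitrary: q)
  case (Node l a r)
  consider "v = a" | "v \<in> set_tree l" "v \<noteq> a" "v \<notin> set_tree r" | "v \<in> set_tree r" "v \<noteq> a" "v \<notin> set_tree l"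
    using Node.prems by auto
  then show ?case
  proof cases
    case 1
    then have "l = Leaf" using Node.prems by (auto split: if_splits)
    then show ?thesis using 1 Node.prems by (cases r) auto
  next
    case 2
    let ?p = "forest_parent a l v"
    have p: "?p \<in> insert a (set_tree l - {v})" using Node.prems 2 by (intro forest_parent_in) auto
    have "attach_leaf a v ?p (detach_leaf v l) = l" using Node.prems 2 by (intro Node.IH) (auto split: if_splits)
    moreover have "set_tree (detach_leaf v l) = set_tree l - {v}" using Node.prems 2 by (intro set_detach_leaf) auto
    moreover have "?p \<noteq> q" using p Node.prems by auto
    ultimately show ?thesis using 2 p by (auto simp: detach_leaf_notin)
  next
    case 3
    let ?p = "forest_parent q r v"
    have p: "?p \<in> insert q (set_tree r - {v})" using Node.prems 3 by (intro forest_parent_in) auto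
    have a: "attach_leaf q v ?p (detach_leaf v r) = r" using Node.prems 3 by (intro Node.IH) (auto split: if_splits)
    show ?thesis
    proof (cases "?p = q")
      case True
      then have "v < a" using forest_parent_top_less[of r a q v] Node.prems 3 by auto
      then show ?thesis using a True 3 by (simp add: detach_leaf_notin)
    next
      case False
      then have "?p \<noteq> a" "?p \<notin> set_tree l" using p Node.prems by auto
      then show ?thesis using a False 3 by (simp add: detach_leaf_notin)
    qed
  qed
qed auto

definition right_decreasing_trees :: "nat set \<Rightarrow> nat tree set" where
  "right_decreasing_trees X = {t. distinct (inorder t) \<and> set_tree t = X \<and> right_decreasing t}"

text \<open>Descending along left children ends at a node without left child, a childless vertex of
  the forest.\<close>

lemma has_leaf_node: "t \<noteq> Leaf \<Longrightarrow> distinct (inorder t) \<Longrightarrow> set_tree t - left_parents t \<noteq> {}"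
proof (induction t)
  case (Node l a r)
  show ?case
  proof (cases "l = Leaf")
    case True
    then show ?thesis using Node.prems left_parents_subset[of r] by auto
  next
    case False
    then obtain v where "v \<in> set_tree l" "v \<notin> left_parents l" using Node by auto
    then show ?thesis using Node.prems left_parents_subset[of r] by auto
  qed
qed auto

lemma leaf_class_right_decreasing_trees:
  "leaf_class right_decreasing_trees (\<lambda>X t. X - left_parents t) rt (\<lambda>v (t, p). attach_leaf rt v p t)"
proof
  have "right_decreasing_trees {} = {Leaf}" unfolding right_decreasing_trees_def by auto
  then show "card (right_decreasing_trees {}) = 1" by simp
  fix X :: "nat set" and s :: "nat tree"
  show "X - left_parents s \<subseteq> X" by auto
  assume "finite X" "rt \<notin> X" "X \<noteq> {}" "s \<in> right_decreasing_trees X"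
  then have "s \<noteq> Leaf" "distinct (inorder s)" "set_tree s = X" unfolding right_decreasing_trees_def by auto
  then show "X - left_parents s \<noteq> {}" using has_leaf_node[of s] by simp
next
  fix X :: "nat set" and v assume X: "finite X" "rt \<notin> X" "v \<in> X"
  let ?X = "X - {v}"
  show "bij_betw (\<lambda>(t, p). attach_leaf rt v p t) (right_decreasing_trees ?X \<times> insert rt ?X)
    {s \<in> right_decreasing_trees X. v \<in> X - left_parents s}"
  proof (rule bij_betw_byWitness[where f' = "\<lambda>t. (detach_leaf v t, forest_parent rt t v)"])
    show "\<forall>a\<in>right_decreasing_trees ?X \<times> insert rt ?X.
      (\<lambda>t. (detach_leaf v t, forest_parent rt t v)) ((\<lambda>(t, p). attach_leaf rt v p t) a) = a"
      using X by (auto simp: right_decreasing_trees_def intro!: detach_attach_leaf forest_parent_attach_leaf)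
    show "\<forall>t\<in>{s \<in> right_decreasing_trees X. v \<in> X - left_parents s}.
      (\<lambda>(t, p). attach_leaf rt v p t) (detach_leaf v t, forest_parent rt t v) = t"
      using X by (auto simp: right_decreasing_trees_def intro!: attach_detach_leaf)
    show "(\<lambda>(t, p). attach_leaf rt v p t) ` (right_decreasing_trees ?X \<times> insert rt ?X) \<subseteq>
      {s \<in> right_decreasing_trees X. v \<in> X - left_parents s}"
    proof clarify
      fix t p assume t: "t \<in> right_decreasing_trees ?X" and p: "p \<in> insert rt ?X"
      then have s: "distinct (inorder t)" "set_tree t = ?X" "right_decreasing t" unfolding right_decreasing_trees_def by auto
      have "left_parents (attach_leaf rt v p t) = left_parents t \<union> ({p} - {rt})"
        using s p X by (intro left_parents_attach_leaf) auto
      then have "v \<notin> left_parents (attach_leaf rt v p t)" using left_parents_subset[of t] s p by auto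
      then show "attach_leaf rt v p t \<in> right_decreasing_trees X \<and> v \<in> X - left_parents (attach_leaf rt v p t)"
        using s p X unfolding right_decreasing_trees_def
        by (auto simp: set_attach_leaf intro!: distinct_attach_leaf right_decreasing_attach_leaf)
    qed
    show "(\<lambda>t. (detach_leaf v t, forest_parent rt t v)) ` {s \<in> right_decreasing_trees X. v \<in> X - left_parents s} \<subseteq>
      right_decreasing_trees ?X \<times> insert rt ?X"
    proof clarify
      fix t assume t: "t \<in> right_decreasing_trees X" "v \<notin> left_parents t"
      then have s: "distinct (inorder t)" "set_tree t = X" "right_decreasing t" unfolding right_decreasing_trees_def by auto
      then have "forest_parent rt t v \<in> insert rt ?X" using forest_parent_in[of t rt v] X by auto
      then show "detach_leaf v t \<in> right_decreasing_trees ?X \<and> forest_parent rt t v \<in> insert rt ?X"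
        using s t unfolding right_decreasing_trees_def
        by (auto simp: set_detach_leaf intro!: distinct_detach_leaf right_decreasing_detach_leaf)
    qed
  qed
  fix t p assume t: "t \<in> right_decreasing_trees ?X" and p: "p \<in> insert rt ?X"
  then have s: "distinct (inorder t)" "set_tree t = ?X" "right_decreasing t" unfolding right_decreasing_trees_def by auto
  have "left_parents (attach_leaf rt v p t) = left_parents t \<union> ({p} - {rt})"
    using s p X by (intro left_parents_attach_leaf) auto
  then show "X - left_parents (case (t, p) of (t, p) \<Rightarrow> attach_leaf rt v p t) = insert v (?X - left_parents t - {p})"
    using left_parents_subset[of t] s p X by auto
qed

section \<open>Internal edges computed recursively, and U, V, W in a common form\<close>

lemma right_internal_edges_Leaf [simp]: "right_internal_edges Leaf = {}"
  and left_internal_edges_Leaf [simp]: "left_internal_edges Leaf = {}"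
  unfolding right_internal_edges_def left_internal_edges_def by auto

lemma right_internal_edges_Node [simp]:
  "right_internal_edges (Node l a r) =
    (case r of Leaf \<Rightarrow> {} | Node _ b _ \<Rightarrow> {(a, b)}) \<union> right_internal_edges l \<union> right_internal_edges r"
proof -
  have "(x, y) \<in> right_internal_edges (Node l a r) \<longleftrightarrow>
    x = a \<and> (\<exists>l' r'. r = Node l' y r') \<or> (x, y) \<in> right_internal_edges l \<or> (x, y) \<in> right_internal_edges r" for x y
    unfolding right_internal_edges_def by auto
  then show ?thesis by (auto split: tree.splits)
qed

lemma left_internal_edges_Node [simp]:
  "left_internal_edges (Node l a r) =
    (case l of Leaf \<Rightarrow> {} | Node _ b _ \<Rightarrow> {(a, b)}) \<union> left_internal_edges l \<union> left_internal_edges r"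
proof -
  have "(x, y) \<in> left_internal_edges (Node l a r) \<longleftrightarrow>
    x = a \<and> (\<exists>l' r'. l = Node l' y r') \<or> (x, y) \<in> left_internal_edges l \<or> (x, y) \<in> left_internal_edges r" for x y
    unfolding left_internal_edges_def by auto
  then show ?thesis by (auto split: tree.splits)
qed

lemma right_decreasing_iff: "right_decreasing t \<longleftrightarrow> (\<forall>(a, b)\<in>right_internal_edges t. descent {a} {b})"
proof (induction t)
  case (Node l a r)
  then show ?case by (cases r) (auto simp: descent_def)
qed auto

lemma left_parents_conv: "left_parents t = {a \<in> set_tree t. \<exists>b. (a, b) \<in> left_internal_edges t}"
proof -
  have "a \<in> left_parents t \<longleftrightarrow> (\<exists>b. (a, b) \<in> left_internal_edges t)" for a
  proof (induction t)
    case (Node l c r)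
    then show ?case by (cases l) auto
  qed auto
  then show ?thesis using left_parents_subset[of t] by auto
qed

text \<open>Marks are rewritten as avoiding the leaf set, the shape required by
  \<open>card_marked_nonleaves\<close>; the next two lemmas do the same for V and bring W to the
  function side of that equation.\<close>

lemma U_trees_conv:
  "U_trees n k = {(t, M). t \<in> right_decreasing_trees {1..n} \<and> M \<subseteq> {1..n} \<and> M \<inter> ({1..n} - left_parents t) = {} \<and> card M = n - k}"
proof -
  have "M \<subseteq> left_parents t \<longleftrightarrow> M \<subseteq> {1..n} \<and> M \<inter> ({1..n} - left_parents t) = {}" if "set_tree t = {1..n}" for M t
    using left_parents_subset[of t] that by auto
  then show ?thesis
    unfolding U_trees_def right_decreasing_trees_def left_parents_conv[symmetric] right_decreasing_iff[symmetric] by auto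
qed

lemma V_trees_conv:
  "V_trees n k = {(E, M). E \<in> {E. tree_on (insert (n + 1) {1..n}) E} \<and> M \<subseteq> {1..n} \<and>
    M \<inter> {v \<in> {1..n}. vertex_degree E v < 2} = {} \<and> card M = n - k}"
proof -
  have "M \<subseteq> {v \<in> {1..n}. vertex_degree E v \<ge> 2} \<longleftrightarrow>
    M \<subseteq> {1..n} \<and> M \<inter> {v \<in> {1..n}. vertex_degree E v < 2} = {}" for M E
    by (auto simp: subset_iff disjoint_iff simp flip: not_less)
  moreover have "{1..n + 1} = insert (n + 1) {1..n}" by auto
  ultimately show ?thesis unfolding V_trees_def by simp
qed

lemma W_pairs_conv:
  "W_pairs n k = {(f, S). f \<in> {1..card {1..n} - 1} \<rightarrow>\<^sub>E insert (n + 1) {1..n} \<and> S \<subseteq> {1..n} \<and>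
    S \<subseteq> f ` {1..card {1..n} - 1} \<and> card S = n - k}"
proof -
  have "{1..n + 1} = insert (n + 1) {1..n}" by auto
  then show ?thesis unfolding W_pairs_def by auto
qed

lemma card_U_trees:
  assumes "n \<ge> 1"
  shows "card (U_trees n k) = card (W_pairs n k)" and "finite (U_trees n k)"
proof -
  interpret leaf_class right_decreasing_trees "\<lambda>X t. X - left_parents t" "n + 1" "\<lambda>v (t, p). attach_leaf (n + 1) v p t"
    by (rule leaf_class_right_decreasing_trees)
  show "card (U_trees n k) = card (W_pairs n k)"
    unfolding U_trees_conv W_pairs_conv using assms by (intro card_marked_nonleaves) auto
  show "finite (U_trees n k)"
    unfolding U_trees_conv by (intro finite_marked finite_C) auto
qed

lemma card_V_trees:
  assumes "n \<ge> 1"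
  shows "card (V_trees n k) = card (W_pairs n k)" and "finite (V_trees n k)"
proof -
  interpret leaf_class "\<lambda>X. {E. tree_on (insert (n + 1) X) E}" "\<lambda>X E. {v \<in> X. vertex_degree E v < 2}" "n + 1"
    "\<lambda>v (E, p). insert {v, p} E"
    by (rule leaf_class_Cayley)
  show "card (V_trees n k) = card (W_pairs n k)"
    unfolding V_trees_conv W_pairs_conv using assms by (intro card_marked_nonleaves) auto
  show "finite (V_trees n k)"
    unfolding V_trees_conv by (intro finite_marked finite_C) auto
qed

lemma finite_W_pairs: "finite (W_pairs n k)"
  unfolding W_pairs_conv by (intro finite_marked finite_PiE) auto

section \<open>Decorated trees and marked trees\<close>

fun labels :: "(nat set \<times> bool) tree \<Rightarrow> nat set" where
  "labels Leaf = {}" |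
  "labels (Node l (A, f) r) = A \<union> labels l \<union> labels r"

text \<open>The partition condition in a form that passes to subtrees;
  \<open>disjoint_labels_iff\<close> connects it with \<open>partition_on\<close>.\<close>

fun disjoint_labels :: "(nat set \<times> bool) tree \<Rightarrow> bool" where
  "disjoint_labels Leaf = True" |
  "disjoint_labels (Node l (A, f) r) = (A \<noteq> {} \<and> finite A \<and> A \<inter> labels l = {} \<and> A \<inter> labels r = {} \<and>
    labels l \<inter> labels r = {} \<and> disjoint_labels l \<and> disjoint_labels r)"

text \<open>The first argument is the label of the parent if the edge to the parent is a right one, and
  \<open>None\<close> otherwise.\<close>

fun edge_ok :: "nat set option \<Rightarrow> nat set \<times> bool \<Rightarrow> bool" where
  "edge_ok None (A, f) = (\<not> f)" |
  "edge_ok (Some B) (A, f) = descent B A"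

fun edges_ok :: "nat set option \<Rightarrow> (nat set \<times> bool) tree \<Rightarrow> bool" where
  "edges_ok P Leaf = True" |
  "edges_ok P (Node l (A, f) r) = (edge_ok P (A, f) \<and> edges_ok None l \<and> edges_ok (Some A) r)"

definition free_count :: "(nat set \<times> bool) tree \<Rightarrow> nat" where
  "free_count t = length (filter (\<lambda>(A, c). \<not> c) (inorder t))"

lemma free_count_simps [simp]:
  "free_count Leaf = 0"
  "free_count (Node l (A, f) r) = free_count l + free_count r + (if f then 0 else 1)"
  unfolding free_count_def by auto

lemma labels_conv: "labels t = \<Union>(fst ` set_tree t)"
  by (induction t rule: labels.induct) auto

lemma labels_inorder: "labels t = \<Union>(set (map fst (inorder t)))"
  unfolding labels_conv by simp

lemma sorted_wrt_all_append_Cons: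
  "sorted_wrt R (xs @ x # ys) \<and> (\<forall>z\<in>set (xs @ x # ys). Q z) \<longleftrightarrow>
    Q x \<and> (\<forall>y\<in>set xs. R y x) \<and> (\<forall>z\<in>set ys. R x z) \<and> (\<forall>y\<in>set xs. \<forall>z\<in>set ys. R y z) \<and>
    (sorted_wrt R xs \<and> (\<forall>z\<in>set xs. Q z)) \<and> (sorted_wrt R ys \<and> (\<forall>z\<in>set ys. Q z))"
  by (auto simp: sorted_wrt_append)

lemma disjoint_labels_inorder:
  "disjoint_labels t \<longleftrightarrow> sorted_wrt (\<lambda>A B. A \<inter> B = {}) (map fst (inorder t)) \<and>
    (\<forall>A\<in>set (map fst (inorder t)). A \<noteq> {} \<and> finite A)"
proof (induction t rule: labels.induct)
  case (2 l A f r)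
  have e: "A \<inter> labels l = {} \<longleftrightarrow> (\<forall>B\<in>set (map fst (inorder l)). B \<inter> A = {})"
    "A \<inter> labels r = {} \<longleftrightarrow> (\<forall>B\<in>set (map fst (inorder r)). A \<inter> B = {})"
    "labels l \<inter> labels r = {} \<longleftrightarrow>
      (\<forall>B\<in>set (map fst (inorder l)). \<forall>C\<in>set (map fst (inorder r)). B \<inter> C = {})"
    unfolding labels_inorder by blast+
  have "map fst (inorder (Node l (A, f) r)) = map fst (inorder l) @ A # map fst (inorder r)" by simp
  then show ?case
    unfolding disjoint_labels.simps 2 e by (simp only: sorted_wrt_all_append_Cons conj_assoc)
qed auto

lemma sorted_wrt_disjoint_iff:
  "(\<forall>A\<in>set xs. A \<noteq> {}) \<Longrightarrow> sorted_wrt (\<lambda>A B. A \<inter> B = {}) xs \<longleftrightarrow> distinct xs \<and> disjoint (set xs)"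
  by (induction xs) (auto simp: pairwise_insert disjnt_def Int_commute)

lemma disjoint_labels_iff:
  assumes "finite X"
  shows "disjoint_labels t \<and> labels t = X \<longleftrightarrow>
    distinct (map fst (inorder t)) \<and> partition_on X (fst ` set_tree t)"
proof -
  have s: "fst ` set_tree t = set (map fst (inorder t))" by simp
  have "finite A" if "A \<in> set (map fst (inorder t))" "labels t = X" for A
    using that assms unfolding labels_inorder by (metis Union_upper finite_subset)
  then show ?thesis
    unfolding partition_on_def s labels_inorder[symmetric] disjoint_labels_inorder
    using sorted_wrt_disjoint_iff[of "map fst (inorder t)"] by metis
qed

lemma edges_ok_iff:
  "edges_ok P t \<longleftrightarrow> (\<forall>((A, c), (B, d))\<in>right_internal_edges t. descent A B) \<and>
    (\<forall>(a, (B, c))\<in>left_internal_edges t. \<not> c) \<and> (case t of Leaf \<Rightarrow> True | Node l x r \<Rightarrow> edge_ok P x)"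
proof (induction P t rule: edges_ok.induct)
  case (2 P l A f r)
  have "(\<forall>((A, c), (B, d))\<in>(case r of Leaf \<Rightarrow> {} | Node _ b _ \<Rightarrow> {((A, f), b)}). descent A B) \<longleftrightarrow>
      (case r of Leaf \<Rightarrow> True | Node l x r \<Rightarrow> edge_ok (Some A) x)"
    by (cases r rule: labels.cases) auto
  moreover have "(\<forall>(a, (B, c))\<in>(case l of Leaf \<Rightarrow> {} | Node _ b _ \<Rightarrow> {((A, f), b)}). \<not> c) \<longleftrightarrow>
      (case l of Leaf \<Rightarrow> True | Node l x r \<Rightarrow> edge_ok None x)"
    by (cases l rule: labels.cases) auto
  ultimately show ?case
    unfolding edges_ok.simps 2 right_internal_edges_Node left_internal_edges_Node ball_Un tree.case by argo
qed auto

lemma card_free: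
  assumes "distinct (map fst (inorder t))"
  shows "card {(A, c) \<in> set_tree t. \<not> c} = free_count t"
proof -
  have "{(A, c) \<in> set_tree t. \<not> c} = set (filter (\<lambda>(A, c). \<not> c) (inorder t))" by auto
  moreover have "distinct (filter (\<lambda>(A, c). \<not> c) (inorder t))"
    using assms by (simp add: distinct_map)
  ultimately show ?thesis unfolding free_count_def by (simp only: distinct_card)
qed

definition block_trees :: "nat set \<Rightarrow> (nat set \<times> bool) tree set" where
  "block_trees X = {t. disjoint_labels t \<and> labels t = X \<and> edges_ok None t}"

lemma T_trees_conv: "T_trees n k = {t \<in> block_trees {1..n}. free_count t = k}"
proof -
  have T: "t \<in> T_trees n k \<longleftrightarrow> (distinct (map fst (inorder t)) \<and> partition_on {1..n} (fst ` set_tree t)) \<and>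
    edges_ok None t \<and> card {(A, c) \<in> set_tree t. \<not> c} = k" for t
  proof -
    have "(\<forall>l A c r. t = Node l (A, c) r \<longrightarrow> \<not> c) \<longleftrightarrow> (case t of Leaf \<Rightarrow> True | Node l x r \<Rightarrow> edge_ok None x)"
      by (cases t rule: labels.cases) auto
    then show ?thesis unfolding T_trees_def decorated_trees_def edges_ok_iff mem_Collect_eq by argo
  qed
  show ?thesis
  proof (rule set_eqI)
    fix t
    show "t \<in> T_trees n k \<longleftrightarrow> t \<in> {t \<in> block_trees {1..n}. free_count t = k}"
    proof (cases "distinct (map fst (inorder t))")
      case True
      then show ?thesis
        unfolding T block_trees_def disjoint_labels_iff[OF finite_atLeastAtMost, symmetric] card_free[OF True] by blast
    next
      case False
      then show ?thesis using disjoint_labels_iff[of "{1..n}" t] unfolding T block_trees_def by blast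
    qed
  qed
qed

section \<open>The rewriting between blocks and marked left chains\<close>

fun flagged :: "(nat set \<times> bool) tree \<Rightarrow> bool" where
  "flagged Leaf = False" |
  "flagged (Node l (A, f) r) = f"

text \<open>A captive node carries its own flag, whereas after expansion the information is a mark
  on the parent. Hence \<open>collapse\<close> always returns an unflagged root, to be flagged by
  the call for its parent.\<close>

fun set_flag :: "bool \<Rightarrow> (nat set \<times> bool) tree \<Rightarrow> (nat set \<times> bool) tree" where
  "set_flag b Leaf = Leaf" |
  "set_flag b (Node l (A, f) r) = Node l (A, b) r"

text \<open>
  A block becomes a left chain of its elements in increasing order, all but the last marked.
  A dashed right edge becomes a mark on the last element of the parent block; if that
  element has no left child to justify the mark, the right subtree moves to the left.
\<close>

fun expand :: "(nat set \<times> bool) tree \<Rightarrow> (nat \<times> bool) tree" where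
  "expand Leaf = Leaf" |
  "expand (Node l (A, f) r) =
    foldr (\<lambda>a u. Node u (a, True) Leaf) (sorted_list_of_set (A - {Max A}))
      (if flagged r
       then if l = Leaf then Node (expand r) (Max A, True) Leaf else Node (expand l) (Max A, True) (expand r)
       else Node (expand l) (Max A, False) (expand r))"

text \<open>A mark is decoded by what lies below it. With a right child present it stands for a
  dashed edge. Otherwise the left child continues the block if its label exceeds \<open>a\<close>,
  and is a displaced captive subtree if not, since a right edge is a descent. The value
  \<open>Leaf\<close> for a marked node without children is a dummy excluded by
  \<open>marks_ok\<close>.\<close>

fun collapse :: "(nat \<times> bool) tree \<Rightarrow> (nat set \<times> bool) tree" where
  "collapse Leaf = Leaf" |
  "collapse (Node l (a, m) r) =
    (if \<not> m then Node (collapse l) ({a}, False) (collapse r)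
     else if r \<noteq> Leaf then Node (collapse l) ({a}, False) (set_flag True (collapse r))
     else case collapse l of
       Leaf \<Rightarrow> Leaf
     | Node l' (B, f) r' \<Rightarrow>
         if a < Min B then Node l' (insert a B, False) r'
         else Node Leaf ({a}, False) (set_flag True (collapse l)))"

fun marks_ok :: "(nat \<times> bool) tree \<Rightarrow> bool" where
  "marks_ok Leaf = True" |
  "marks_ok (Node l (a, m) r) = ((m \<longrightarrow> l \<noteq> Leaf) \<and> marks_ok l \<and> marks_ok r)"

definition mark_count :: "(nat \<times> bool) tree \<Rightarrow> nat" where
  "mark_count u = length (filter snd (inorder u))"

lemma mark_count_simps [simp]:
  "mark_count Leaf = 0"
  "mark_count (Node l (a, m) r) = mark_count l + mark_count r + (if m then 1 else 0)"
  unfolding mark_count_def by auto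

lemma set_flag_simps [simp]:
  "labels (set_flag b t) = labels t" "disjoint_labels (set_flag b t) = disjoint_labels t"
  "expand (set_flag b t) = expand t" "set_flag b (set_flag c t) = set_flag b t"
  "set_flag b t = Leaf \<longleftrightarrow> t = Leaf" "flagged (set_flag b t) \<longleftrightarrow> b \<and> t \<noteq> Leaf"
  by (cases t rule: labels.cases; simp)+

lemma set_flag_flagged: "set_flag (flagged t) t = t"
  by (cases t rule: labels.cases) auto

lemma edges_ok_None_not_flagged: "edges_ok None t \<Longrightarrow> \<not> flagged t"
  by (cases t rule: labels.cases) auto

lemma expand_single:
  "expand (Node l ({a}, f) r) =
    (if flagged r then if l = Leaf then Node (expand r) (a, True) Leaf else Node (expand l) (a, True) (expand r)
     else Node (expand l) (a, False) (expand r))"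
  by simp

text \<open>The chain lists the block increasingly from the top down, so a new minimum is put on
  top; the bottom of the chain depends on the block only through its maximum.\<close>

lemma expand_insert:
  assumes "finite B" "B \<noteq> {}" "a < Min B"
  shows "expand (Node l (insert a B, f) r) = Node (expand (Node l (B, f) r)) (a, True) Leaf"
proof -
  have lt: "\<And>b. b \<in> B \<Longrightarrow> a < b" using assms by simp
  have "a < Max B" using lt[of "Max B"] assms by simp
  then have M: "Max (insert a B) = Max B" using assms by simp
  have "Max B \<in> B" using assms by simp
  then have eq: "insert a B - {Max B} = insert a (B - {Max B})" using lt[of "Max B"] by auto
  have min: "Min (insert a (B - {Max B})) = a" using assms(1) lt by (intro Min_eqI) (auto intro: less_imp_le)
  have "a \<notin> B" using lt by blast
  then have "insert a (B - {Max B}) - {a} = B - {Max B}" by auto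
  then have "sorted_list_of_set (insert a B - {Max B}) = a # sorted_list_of_set (B - {Max B})"
    unfolding eq using assms(1) min by (subst sorted_list_of_set_nonempty) auto
  then show ?thesis by (simp add: M del: sorted_list_of_set.sorted_key_list_of_set_insert_remove)
qed

declare expand.simps(2) [simp del]

text \<open>Blocks are stripped of their minima down to a singleton. The two node cases match
  \<open>expand_single\<close> and \<open>expand_insert\<close>, so the \<open>foldr\<close> need
  not be unfolded again.\<close>

lemma disjoint_labels_induct [consumes 1, case_names Leaf Single Insert]:
  assumes "disjoint_labels t"
    and Leaf: "P Leaf"
    and Single: "\<And>l a f r. disjoint_labels (Node l ({a}, f) r) \<Longrightarrow> P l \<Longrightarrow> P r \<Longrightarrow> P (Node l ({a}, f) r)"
    and Insert: "\<And>l a B f r. disjoint_labels (Node l (insert a B, f) r) \<Longrightarrow> finite B \<Longrightarrow> B \<noteq> {} \<Longrightarrow> a < Min B \<Longrightarrow>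
      P (Node l (B, f) r) \<Longrightarrow> P (Node l (insert a B, f) r)"
  shows "P t"
  using assms(1)
proof (induction t rule: labels.induct)
  case 1
  then show ?case using Leaf by simp
next
  case (2 l A f r)
  then have lr: "P l" "P r" and "finite A" by auto
  from \<open>finite A\<close> 2(3) show ?case
  proof (induction A rule: finite_linorder_min_induct)
    case empty
    then show ?case by simp
  next
    case (insert b A)
    show ?case
    proof (cases "A = {}")
      case True
      then show ?thesis using Single lr insert.prems by simp
    next
      case False
      then have "P (Node l (A, f) r)" using insert by auto
      moreover have "b < Min A" using insert False by simp
      ultimately show ?thesis using Insert insert False by blast
    qed
  qed
qed

lemma expand_eq_Leaf [simp]: "disjoint_labels t \<Longrightarrow> expand t = Leaf \<longleftrightarrow> t = Leaf"
  by (induction t rule: disjoint_labels_induct) (simp_all add: expand_single expand_insert)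

lemma set_expand: "disjoint_labels t \<Longrightarrow> fst ` set_tree (expand t) = labels t"
proof (induction t rule: disjoint_labels_induct)
  case (Insert l a B f r)
  then show ?case by (simp add: expand_insert)
qed (auto simp: expand_single)

lemma distinct_expand: "disjoint_labels t \<Longrightarrow> distinct (map fst (inorder (expand t)))"
proof (induction t rule: disjoint_labels_induct)
  case (Single l a f r)
  then have "fst ` set_tree (expand l) = labels l" "fst ` set_tree (expand r) = labels r" using set_expand by auto
  then show ?case using Single by (auto simp: expand_single)
next
  case (Insert l a B f r)
  then have B: "disjoint_labels (Node l (B, f) r)" by auto
  have "fst ` set_tree (expand (Node l (B, f) r)) = B \<union> labels l \<union> labels r"
    using set_expand[OF B] by simp
  moreover have "a \<notin> B" using Insert by auto
  ultimately show ?case using Insert by (simp add: expand_insert)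
qed auto

lemma marks_ok_expand: "disjoint_labels t \<Longrightarrow> marks_ok (expand t)"
proof (induction t rule: disjoint_labels_induct)
  case (Single l a f r)
  then have "flagged r \<Longrightarrow> expand r \<noteq> Leaf" by auto
  then show ?case using Single by (auto simp: expand_single)
next
  case (Insert l a B f r)
  then show ?case by (simp add: expand_insert)
qed auto

text \<open>The top of the chain is the minimum, while right edges leave a chain only at its bottom,
  the maximum. Thus a descent between blocks turns into a plain decrease along a right edge.\<close>

lemma expand_root:
  assumes "disjoint_labels (Node l (A, f) r)"
  shows "\<exists>l' m r'. expand (Node l (A, f) r) = Node l' (Min A, m) r'"
proof -
  have A: "finite A" "A \<noteq> {}" using assms by auto
  show ?thesis
  proof (cases "A - {Min A} = {}")
    case True
    then obtain a where "A = {a}" using A by auto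
    then show ?thesis by (simp add: expand_single ex_bool_eq)
  next
    case False
    have "Min (A - {Min A}) \<in> A - {Min A}" using A False by (intro Min_in) auto
    then have "Min A < Min (A - {Min A})" using A Min_le[of A "Min (A - {Min A})"] by fastforce
    moreover have "insert (Min A) (A - {Min A}) = A" using Min_in[OF A] by blast
    ultimately have "expand (Node l (A, f) r) = Node (expand (Node l (A - {Min A}, f) r)) (Min A, True) Leaf"
      using expand_insert[of "A - {Min A}" "Min A" l f r] A False by simp
    then show ?thesis by blast
  qed
qed

text \<open>Stripping the minimum keeps the maximum, hence the descent to the right child, but may
  spoil the edge from the parent. \<open>{Suc (Min B)}\<close> is an artificial parent label that
  lies above \<open>Min B\<close> and admits either flag. For this reason the inductions below
  quantify existentially over the parent.\<close>

lemma edges_ok_insert: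
  assumes "edges_ok P (Node l (insert a B, f) r)" "finite B" "B \<noteq> {}" "a < Min B"
  shows "edges_ok (Some {Suc (Min B)}) (Node l (B, f) r)"
proof -
  have "a < Max B" using assms(2-4) Min_le[of B "Max B"] Max_in[of B] by linarith
  then have "Max (insert a B) = Max B" using assms by simp
  then have "edges_ok (Some (insert a B)) r = edges_ok (Some B) r"
    by (cases r rule: labels.cases) (simp_all add: descent_def)
  then show ?thesis using assms(1) by (simp add: descent_def)
qed

lemma right_decreasing_expand:
  assumes "disjoint_labels t" "edges_ok P t"
  shows "right_decreasing (map_tree fst (expand t))"
proof -
  have "(\<exists>P. edges_ok P t) \<longrightarrow> right_decreasing (map_tree fst (expand t))" using assms(1)
  proof (induction t rule: disjoint_labels_induct)
    case (Single l a f r)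
    have "root_less (map_tree fst (expand r)) a" if "edges_ok (Some {a}) r"
    proof (cases r rule: labels.cases)
      case (2 l' A g r')
      then have "disjoint_labels (Node l' (A, g) r')" using Single by simp
      then obtain x m y where "expand r = Node x (Min A, m) y" using expand_root 2 by blast
      then show ?thesis using that 2 by (simp add: descent_def)
    qed auto
    then show ?case using Single by (auto simp: expand_single)
  next
    case (Insert l a B f r)
    then have "(\<exists>P. edges_ok P (Node l (insert a B, f) r)) \<longrightarrow> (\<exists>P. edges_ok P (Node l (B, f) r))"
      using edges_ok_insert by blast
    then show ?case using Insert by (simp add: expand_insert del: edges_ok.simps(2))
  qed auto
  then show ?thesis using assms(2) by blast
qed

lemma size_expand: "disjoint_labels t \<Longrightarrow> size (expand t) = card (labels t)"
proof -
  assume t: "disjoint_labels t"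
  have "card (labels t) = length (map fst (inorder (expand t)))"
    using distinct_card[OF distinct_expand[OF t]] set_expand[OF t] by simp
  then show ?thesis by simp
qed

text \<open>Each block contributes a mark for every element but its last, each captive node a mark
  on its parent, so marks and free nodes together number the elements. A flagged root is not free
  and its mark would sit outside the tree, hence the correction by 1.\<close>

lemma count_expand:
  assumes "disjoint_labels t" "edges_ok P t"
  shows "mark_count (expand t) + free_count t + (if flagged t then 1 else 0) = size (expand t)"
proof -
  have "(\<exists>P. edges_ok P t) \<longrightarrow>
    mark_count (expand t) + free_count t + (if flagged t then 1 else 0) = size (expand t)" using assms(1)
  proof (induction t rule: disjoint_labels_induct)
    case (Single l a f r)
    show ?case
    proof clarify
      fix P assume "edges_ok P (Node l ({a}, f) r)"
      then have "edges_ok None l" "edges_ok (Some {a}) r" by auto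
      then show "mark_count (expand (Node l ({a}, f) r)) + free_count (Node l ({a}, f) r) +
          (if flagged (Node l ({a}, f) r) then 1 else 0) = size (expand (Node l ({a}, f) r))"
        using Single.IH edges_ok_None_not_flagged[of l]
        by (auto simp: expand_single split: if_splits)
    qed
  next
    case (Insert l a B f r)
    then have "(\<exists>P. edges_ok P (Node l (insert a B, f) r)) \<longrightarrow> (\<exists>P. edges_ok P (Node l (B, f) r))"
      using edges_ok_insert by blast
    then show ?case using Insert by (simp add: expand_insert del: edges_ok.simps(2))
  qed auto
  then show ?thesis using assms(2) by blast
qed

text \<open>Only the flag of the root is lost, its mark being on a parent outside the tree; under
  \<open>edges_ok None t\<close> that flag is \<open>False\<close> already.\<close>

lemma collapse_expand:
  assumes "disjoint_labels t" "edges_ok P t"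
  shows "collapse (expand t) = set_flag False t"
proof -
  have "(\<exists>P. edges_ok P t) \<longrightarrow> collapse (expand t) = set_flag False t" using assms(1)
  proof (induction t rule: disjoint_labels_induct)
    case (Single l a f r)
    show ?case
    proof clarify
      fix P assume "edges_ok P (Node l ({a}, f) r)"
      then have e: "edges_ok None l" "edges_ok (Some {a}) r" by auto
      then have l: "collapse (expand l) = l"
        using Single.IH(1) edges_ok_None_not_flagged[of l] set_flag_flagged[of l] by metis
      have r: "collapse (expand r) = set_flag False r" using e Single.IH(2) by blast
      show "collapse (expand (Node l ({a}, f) r)) = set_flag False (Node l ({a}, f) r)"
      proof (cases "flagged r")
        case False
        then have "collapse (expand r) = r" using r set_flag_flagged[of r] by simp
        then show ?thesis using False l by (simp add: expand_single)
      next
        case True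
        then obtain l' A r' where r': "r = Node l' (A, True) r'" by (cases r rule: labels.cases) auto
        \<comment> \<open>The top label of a displaced subtree is therefore below \<open>a\<close>,
          and \<open>collapse\<close> does not mistake it for a continuation of the block.\<close>
        then have "Min A < a" using e by (simp add: descent_def)
        moreover have "expand r \<noteq> Leaf" using r' Single by simp
        ultimately show ?thesis using True l r r' by (simp add: expand_single)
      qed
    qed
  next
    case (Insert l a B f r)
    then have "(\<exists>P. edges_ok P (Node l (insert a B, f) r)) \<longrightarrow> (\<exists>P. edges_ok P (Node l (B, f) r))"
      using edges_ok_insert by blast
    then show ?case using Insert by (simp add: expand_insert del: edges_ok.simps(2))
  qed auto
  then show ?thesis using assms(2) by blast
qed

text \<open>The last conjunct carries the induction: the minimum of the root block is the root label
  of \<open>u\<close>. It turns decreasing right edges into descents and settles the comparison with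
  \<open>Min B\<close> in \<open>collapse\<close>.\<close>

lemma collapse_correct:
  assumes "distinct (map fst (inorder u))" "marks_ok u" "right_decreasing (map_tree fst u)"
  shows "disjoint_labels (collapse u) \<and> labels (collapse u) = fst ` set_tree u \<and> edges_ok None (collapse u) \<and>
    expand (collapse u) = u \<and>
    (\<forall>l a m r. u = Node l (a, m) r \<longrightarrow> (\<exists>l' B r'. collapse u = Node l' (B, False) r' \<and> Min B = a))"
  using assms
proof (induction u rule: marks_ok.induct)
  case (2 l a m r)
  have l: "distinct (map fst (inorder l))" "marks_ok l" "right_decreasing (map_tree fst l)"
    and r: "distinct (map fst (inorder r))" "marks_ok r" "right_decreasing (map_tree fst r)"
    using "2.prems" by simp_all
  have L: "disjoint_labels (collapse l)" "labels (collapse l) = fst ` set_tree l" "edges_ok None (collapse l)"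
    "expand (collapse l) = l" and
    Lr: "\<And>l1 a m r1. l = Node l1 (a, m) r1 \<Longrightarrow> \<exists>l' B r'. collapse l = Node l' (B, False) r' \<and> Min B = a"
    using "2.IH"(1)[OF l] by simp_all
  have R: "disjoint_labels (collapse r)" "labels (collapse r) = fst ` set_tree r" "edges_ok None (collapse r)"
    "expand (collapse r) = r" and
    Rr: "\<And>l1 a m r1. r = Node l1 (a, m) r1 \<Longrightarrow> \<exists>l' B r'. collapse r = Node l' (B, False) r' \<and> Min B = a"
    using "2.IH"(2)[OF r] by simp_all
  have d: "a \<notin> fst ` set_tree l" "a \<notin> fst ` set_tree r" "fst ` set_tree l \<inter> fst ` set_tree r = {}"
    using "2.prems"(1) by auto
  have eR: "edges_ok (Some {a}) (set_flag b (collapse r))" for b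
  proof (cases r rule: collapse.cases)
    case (2 l1 c m1 r1)
    then obtain l' B r' where B: "collapse r = Node l' (B, False) r'" "Min B = c" using Rr by blast
    moreover have "c < a" using \<open>right_decreasing (map_tree fst (Node l (a, m) r))\<close> 2 by simp
    ultimately show ?thesis using R(3) by (simp add: descent_def)
  qed auto
  then have eR': "edges_ok (Some {a}) (collapse r)" using set_flag_flagged[of "collapse r"] by metis
  consider "\<not> m" | "m" "r \<noteq> Leaf" | "m" "r = Leaf" by blast
  then show ?case
  proof cases
    case 1
    then show ?thesis using L R d eR' edges_ok_None_not_flagged[OF R(3)]
      by (auto simp: expand_single)
  next
    case 2
    have "l \<noteq> Leaf" using \<open>marks_ok (Node l (a, m) r)\<close> 2 by simp
    then have "collapse l \<noteq> Leaf" "collapse r \<noteq> Leaf" using L(4) R(4) 2 by auto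
    then show ?thesis using 2 L R d eR by (auto simp: expand_single)
  next
    case 3
    have "l \<noteq> Leaf" using \<open>marks_ok (Node l (a, m) r)\<close> 3 by simp
    then obtain l1 b m1 r1 where l: "l = Node l1 (b, m1) r1" by (cases l rule: collapse.cases) auto
    obtain l' B r' where B: "collapse l = Node l' (B, False) r'" "Min B = b" using Lr l by blast
    have fB: "finite B" "B \<noteq> {}" using L(1) B by auto
    show ?thesis
    proof (cases "a < b")
      case True
      have c: "collapse (Node l (a, m) r) = Node l' (insert a B, False) r'" using 3 B True by simp
      have "Min (insert a B) = a" using True B fB by (simp add: min_def)
      moreover have "edges_ok (Some (insert a B)) r'"
      proof -
        have "a < Max B" using fB True B Min_le[of B "Max B"] Max_in[of B] by linarith
        then have "Max (insert a B) = Max B" using fB by simp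
        then show ?thesis using L(3) B by (cases r' rule: labels.cases) (simp_all add: descent_def)
      qed
      moreover have "expand (Node l' (insert a B, False) r') = Node (expand (Node l' (B, False) r')) (a, True) Leaf"
        using fB True B by (intro expand_insert) auto
      moreover have "expand (Node l' (B, False) r') = l" using L(4) B by simp
      moreover have "B \<union> labels l' \<union> labels r' = fst ` set_tree l" using L(2) B by simp
      ultimately show ?thesis unfolding c using L(1,3) B d 3 by (auto)
    next
      case False
      \<comment> \<open>This is the descent demanded of the restored dashed edge.\<close>
      then have "b < a" using d l by force
      have c: "collapse (Node l (a, m) r) = Node Leaf ({a}, False) (Node l' (B, True) r')" using 3 B False by simp
      have "expand (Node l' (B, True) r') = l" using L(4) B(1) set_flag_simps(3)[of True "collapse l"] by simp
      moreover have "B \<union> labels l' \<union> labels r' = fst ` set_tree l" using L(2) B by simp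
      ultimately show ?thesis unfolding c using L(1,3) B d 3 \<open>b < a\<close>
        by (auto simp: expand_single descent_def)
    qed
  qed
qed auto

definition marked_trees :: "nat set \<Rightarrow> (nat \<times> bool) tree set" where
  "marked_trees X = {u. distinct (map fst (inorder u)) \<and> fst ` set_tree u = X \<and> marks_ok u \<and>
    right_decreasing (map_tree fst u)}"

lemma bij_betw_expand: "bij_betw expand (block_trees X) (marked_trees X)"
proof (rule bij_betw_byWitness[where f' = collapse])
  show "\<forall>t\<in>block_trees X. collapse (expand t) = t"
    unfolding block_trees_def using collapse_expand edges_ok_None_not_flagged set_flag_flagged
    by (metis (mono_tags, lifting) mem_Collect_eq)
  show "\<forall>u\<in>marked_trees X. expand (collapse u) = u"
    unfolding marked_trees_def using collapse_correct by blast
  show "expand ` block_trees X \<subseteq> marked_trees X"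
    unfolding block_trees_def marked_trees_def
    using distinct_expand set_expand marks_ok_expand right_decreasing_expand by blast
  show "collapse ` marked_trees X \<subseteq> block_trees X"
    unfolding block_trees_def marked_trees_def using collapse_correct by blast
qed

lemma split_inclusion:
  assumes "A \<subseteq> F" "B \<subseteq> G" "C \<subseteq> F" "D \<subseteq> G" "a \<notin> F" "a \<notin> G" "F \<inter> G = {}"
  shows "(if m then {a} else {}) \<union> A \<union> B \<subseteq> (if c then {} else {a}) \<union> C \<union> D \<longleftrightarrow>
    (m \<longrightarrow> \<not> c) \<and> A \<subseteq> C \<and> B \<subseteq> D"
proof -
  have "a \<notin> A" "a \<notin> B" "a \<notin> C" "a \<notin> D" "A \<inter> D = {}" "B \<inter> C = {}" using assms by blast+
  then show ?thesis by (cases m; cases c) (simp_all, blast+)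
qed

text \<open>Distinct labels allow one inclusion of sets to be split into a condition at the root and
  one for each subtree.\<close>

lemma marks_ok_iff:
  "distinct (map fst (inorder u)) \<Longrightarrow> marks_ok u \<longleftrightarrow> {a. (a, True) \<in> set_tree u} \<subseteq> left_parents (map_tree fst u)"
proof (induction u rule: marks_ok.induct)
  case (2 l a m r)
  let ?L = "left_parents (map_tree fst l)" and ?R = "left_parents (map_tree fst r)"
  have s: "?L \<subseteq> fst ` set_tree l" "?R \<subseteq> fst ` set_tree r"
    using left_parents_subset[of "map_tree fst l"] left_parents_subset[of "map_tree fst r"] by (auto simp: tree.set_map)
  have d: "a \<notin> fst ` set_tree l" "a \<notin> fst ` set_tree r" "fst ` set_tree l \<inter> fst ` set_tree r = {}"
    using 2(3) by auto
  have L: "{a. (a, True) \<in> set_tree l} \<subseteq> fst ` set_tree l" "{a. (a, True) \<in> set_tree r} \<subseteq> fst ` set_tree r" by force+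
  have "{b. (b, True) \<in> set_tree (Node l (a, m) r)} =
    (if m then {a} else {}) \<union> {a. (a, True) \<in> set_tree l} \<union> {a. (a, True) \<in> set_tree r}" by auto
  moreover have "left_parents (map_tree fst (Node l (a, m) r)) = (if l = Leaf then {} else {a}) \<union> ?L \<union> ?R" by auto
  ultimately have "{b. (b, True) \<in> set_tree (Node l (a, m) r)} \<subseteq> left_parents (map_tree fst (Node l (a, m) r)) \<longleftrightarrow>
    (m \<longrightarrow> l \<noteq> Leaf) \<and> {a. (a, True) \<in> set_tree l} \<subseteq> ?L \<and> {a. (a, True) \<in> set_tree r} \<subseteq> ?R"
    using split_inclusion[OF L s d, of m "l = Leaf"] by simp
  then show ?case using 2 by simp
qed auto

lemma card_marks: "distinct (map fst (inorder u)) \<Longrightarrow> card {a. (a, True) \<in> set_tree u} = mark_count u"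
proof -
  assume d: "distinct (map fst (inorder u))"
  have "{a. (a, True) \<in> set_tree u} = set (map fst (filter snd (inorder u)))" by force
  moreover have "distinct (map fst (filter snd (inorder u)))" using d by (simp add: distinct_map inj_on_def)
  ultimately have "card {a. (a, True) \<in> set_tree u} = length (map fst (filter snd (inorder u)))"
    by (simp only: distinct_card)
  then show ?thesis unfolding mark_count_def by simp
qed

lemma bij_betw_marked_trees:
  "bij_betw (\<lambda>u. (map_tree fst u, {a. (a, True) \<in> set_tree u})) {u \<in> marked_trees {1..n}. mark_count u = n - k} (U_trees n k)"
proof (rule bij_betw_byWitness[where f' = "\<lambda>(t, M). map_tree (\<lambda>a. (a, a \<in> M)) t"])
  have inord: "inorder (map_tree f t) = map f (inorder t)" for f :: "'a \<Rightarrow> 'b" and t by (rule inorder_map)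
  have U: "U_trees n k = {(t, M). distinct (inorder t) \<and> set_tree t = {1..n} \<and> right_decreasing t \<and>
    M \<subseteq> left_parents t \<and> card M = n - k}"
    unfolding U_trees_def left_parents_conv[symmetric] right_decreasing_iff ..
  show "\<forall>u\<in>{u \<in> marked_trees {1..n}. mark_count u = n - k}.
    (\<lambda>(t, M). map_tree (\<lambda>a. (a, a \<in> M)) t) (map_tree fst u, {a. (a, True) \<in> set_tree u}) = u"
  proof
    fix u assume "u \<in> {u \<in> marked_trees {1..n}. mark_count u = n - k}"
    then have inj: "inj_on fst (set_tree u)" unfolding marked_trees_def by (auto simp: distinct_map)
    have "(fst x, (fst x, True) \<in> set_tree u) = x" if x: "x \<in> set_tree u" for x
    proof -
      obtain a b where ab: "x = (a, b)" by (rule prod.exhaust)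
      have "(a, True) = (a, b)" if "(a, True) \<in> set_tree u"
        by (rule inj_onD[OF inj]) (use that x ab in simp_all)
      then have "(a, True) \<in> set_tree u \<longleftrightarrow> b" using x ab by (cases b) auto
      then show ?thesis unfolding ab by simp
    qed
    then show "(\<lambda>(t, M). map_tree (\<lambda>a. (a, a \<in> M)) t) (map_tree fst u, {a. (a, True) \<in> set_tree u}) = u"
      by (simp add: tree.map_comp comp_def tree.map_ident_strong)
  qed
  have marks: "{a. (a, True) \<in> set_tree (map_tree (\<lambda>a. (a, a \<in> M)) t)} = M" if "M \<subseteq> set_tree t" for t :: "nat tree" and M
    using that by (auto simp: tree.set_map)
  have fwd: "map_tree fst (map_tree (\<lambda>a. (a, a \<in> M)) t) = t" for t :: "nat tree" and M
    by (simp add: tree.map_comp comp_def tree.map_ident)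
  show "\<forall>a'\<in>U_trees n k. (\<lambda>u. (map_tree fst u, {a. (a, True) \<in> set_tree u})) ((\<lambda>(t, M). map_tree (\<lambda>a. (a, a \<in> M)) t) a') = a'"
  proof
    fix z assume "z \<in> U_trees n k"
    then obtain t M where z: "z = (t, M)" "M \<subseteq> left_parents t" unfolding U by auto
    then have "M \<subseteq> set_tree t" using left_parents_subset[of t] by blast
    then show "(\<lambda>u. (map_tree fst u, {a. (a, True) \<in> set_tree u})) ((\<lambda>(t, M). map_tree (\<lambda>a. (a, a \<in> M)) t) z) = z"
      using marks[of M t] fwd[of M t] z by simp
  qed
  show "(\<lambda>u. (map_tree fst u, {a. (a, True) \<in> set_tree u})) ` {u \<in> marked_trees {1..n}. mark_count u = n - k} \<subseteq> U_trees n k"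
    unfolding U marked_trees_def using marks_ok_iff card_marks
    by (auto simp: inord tree.set_map)
  show "(\<lambda>(t, M). map_tree (\<lambda>a. (a, a \<in> M)) t) ` U_trees n k \<subseteq> {u \<in> marked_trees {1..n}. mark_count u = n - k}"
  proof
    fix u assume "u \<in> (\<lambda>(t, M). map_tree (\<lambda>a. (a, a \<in> M)) t) ` U_trees n k"
    then obtain t M where u: "u = map_tree (\<lambda>a. (a, a \<in> M)) t" and t: "(t, M) \<in> U_trees n k" by auto
    then have tM: "distinct (inorder t)" "set_tree t = {1..n}" "right_decreasing t" "M \<subseteq> left_parents t" "card M = n - k"
      unfolding U by auto
    then have "M \<subseteq> set_tree t" using left_parents_subset[of t] by blast
    then have M: "{a. (a, True) \<in> set_tree u} = M" unfolding u by (rule marks)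
    have f: "map_tree fst u = t" unfolding u by (rule fwd)
    have d: "distinct (map fst (inorder u))" using tM(1) f inord[of fst u] by simp
    moreover have "fst ` set_tree u = {1..n}" using tM(2) f by (metis tree.set_map)
    moreover have "marks_ok u" using marks_ok_iff[OF d] M f tM(4) by simp
    moreover have "mark_count u = n - k" using card_marks[OF d] M tM(5) by simp
    ultimately show "u \<in> {u \<in> marked_trees {1..n}. mark_count u = n - k}" unfolding marked_trees_def using f tM(3) by simp
  qed
qed

lemma T_trees_eqpoll_U_trees:
  assumes "k \<le> n"
  shows "T_trees n k \<approx> U_trees n k"
proof -
  have "mark_count (expand t) = n - k \<longleftrightarrow> free_count t = k" if "t \<in> block_trees {1..n}" for t
  proof -
    have t: "disjoint_labels t" "labels t = {1..n}" "edges_ok None t" using that unfolding block_trees_def by auto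
    then have "mark_count (expand t) + free_count t = n"
      using count_expand[OF t(1,3)] edges_ok_None_not_flagged[OF t(3)] size_expand[OF t(1)] by simp
    then show ?thesis using assms by linarith
  qed
  then have "bij_betw expand {t \<in> block_trees {1..n}. free_count t = k} {u \<in> marked_trees {1..n}. mark_count u = n - k}"
    by (rule bij_betw_Collect[OF bij_betw_expand])
  then show ?thesis
    unfolding T_trees_conv eqpoll_def using bij_betw_trans[OF _ bij_betw_marked_trees] by blast
qed

section \<open>Level order codes of decorated trees\<close>

text \<open>
  Reading the right child as first child and the left child as next sibling, a binary tree is
  an ordered forest. \<open>level_order\<close> lists its nodes in breadth-first order, each together with
  the position of its parent (position 0 standing for a virtual root).
\<close>

fun siblings :: "'a tree \<Rightarrow> 'a list" where
  "siblings Leaf = []" |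
  "siblings (Node l x r) = x # siblings l"

fun offspring :: "'a tree \<Rightarrow> 'a tree list" where
  "offspring Leaf = []" |
  "offspring (Node l x r) = r # offspring l"

lemma length_offspring [simp]: "length (offspring t) = length (siblings t)"
  by (induction t) auto

lemma siblings_offspring_inject:
  "siblings t = siblings t' \<Longrightarrow> offspring t = offspring t' \<Longrightarrow> t = t'"
proof (induction t arbitrary: t')
  case Leaf
  then show ?case by (cases t') auto
next
  case (Node l x r)
  then show ?case by (cases t') auto
qed

lemma siblings_offspring_surj:
  "length xs = length ts \<Longrightarrow> \<exists>t. siblings t = xs \<and> offspring t = ts"
proof (induction xs ts rule: list_induct2)
  case Nil
  then show ?case by (intro exI[of _ Leaf]) simp
next
  case (Cons x xs y ys)
  then obtain t where "siblings t = xs" "offspring t = ys" by blast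
  then show ?case by (intro exI[of _ "Node t x y"]) simp
qed

lemma size1_offspring: "sum_list (map size1 (offspring t)) < size1 t"
  by (induction t) auto

function level_order :: "nat \<Rightarrow> 'a tree list \<Rightarrow> ('a \<times> nat) list" where
  "level_order k [] = []" |
  "level_order k (t # ts) = map (\<lambda>x. (x, k)) (siblings t) @ level_order (Suc k) (ts @ offspring t)"
  by pat_completeness auto
text \<open>\<open>size1\<close> is positive even for \<open>Leaf\<close>, so taking an empty forest
  off the queue lowers the measure too.\<close>

termination
  by (relation "Wellfounded.measure (\<lambda>(k, ts). sum_list (map size1 ts))") (use size1_offspring in auto)

text \<open>Describes a traversal in progress: \<open>k\<close> is the position whose children come
  next, \<open>m\<close> the length of the queue. Entry \<open>p\<close> of \<open>L\<close> has
  position \<open>k + m + p\<close>, and its parent must come earlier.\<close>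

definition code_shape :: "nat \<Rightarrow> nat \<Rightarrow> ('a \<times> nat) list \<Rightarrow> bool" where
  "code_shape k m L \<longleftrightarrow> sorted (map snd L) \<and> (\<forall>x\<in>set L. k \<le> snd x) \<and> (\<forall>p<length L. snd (L ! p) < k + m + p)"

text \<open>Serving position \<open>k\<close> with children \<open>w\<close> takes one forest off
  the queue and puts \<open>length w\<close> forests on it.\<close>

lemma code_shape_append:
  "code_shape k (Suc m) (map (\<lambda>x. (x, k)) w @ L) \<and> (\<forall>x\<in>set L. Suc k \<le> snd x) \<longleftrightarrow> code_shape (Suc k) (m + length w) L"
proof -
  let ?L = "map (\<lambda>x. (x, k)) w @ L"
  have "(\<forall>p<length ?L. snd (?L ! p) < k + Suc m + p) \<longleftrightarrow> (\<forall>p<length L. snd (L ! p) < Suc k + (m + length w) + p)"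
  proof
    assume l: "\<forall>p<length ?L. snd (?L ! p) < k + Suc m + p"
    show "\<forall>p<length L. snd (L ! p) < Suc k + (m + length w) + p"
    proof (intro allI impI)
      fix p assume "p < length L"
      then show "snd (L ! p) < Suc k + (m + length w) + p" using l[rule_format, of "length w + p"]
        by (simp add: nth_append)
    qed
  next
    assume r: "\<forall>p<length L. snd (L ! p) < Suc k + (m + length w) + p"
    show "\<forall>p<length ?L. snd (?L ! p) < k + Suc m + p"
    proof (intro allI impI)
      fix p assume p: "p < length ?L"
      show "snd (?L ! p) < k + Suc m + p"
      proof (cases "p < length w")
        case False
        then have "p - length w < length L" using p by simp
        then show ?thesis using r[rule_format, of "p - length w"] False by (simp add: nth_append)
      qed (simp add: nth_append)
    qed
  qed
  moreover have "sorted (map snd ?L) \<longleftrightarrow> sorted (map snd L)" if "\<forall>x\<in>set L. Suc k \<le> snd x"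
  proof -
    have "map snd ?L = replicate (length w) k @ map snd L" by (simp add: comp_def map_replicate_const)
    then show ?thesis using that by (auto simp: sorted_append)
  qed
  ultimately show ?thesis unfolding code_shape_def by auto
qed

lemma level_order_ge: "x \<in> set (level_order k ts) \<Longrightarrow> k \<le> snd x"
  by (induction k ts rule: level_order.induct) (auto dest: Suc_leD)

lemma code_shape_level_order: "code_shape k (length ts) (level_order k ts)"
proof (induction k ts rule: level_order.induct)
  case (2 k t ts)
  then have "code_shape (Suc k) (length ts + length (siblings t)) (level_order (Suc k) (ts @ offspring t))" by simp
  then show ?case unfolding code_shape_append[symmetric] by simp
qed (simp add: code_shape_def)

text \<open>The children of position \<open>k\<close> form the maximal prefix with parent
  \<open>k\<close>, so they can be read off.\<close>

lemma map_pair_append_eq: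
  assumes "map (\<lambda>x. (x, k)) w @ L = map (\<lambda>x. (x, k)) w' @ L'"
    and "\<forall>x\<in>set L. Suc k \<le> snd x" "\<forall>x\<in>set L'. Suc k \<le> snd x"
  shows "w = w' \<and> L = L'"
proof -
  have t: "takeWhile (\<lambda>x. snd x = k) (map (\<lambda>x. (x, k)) v @ M) = map (\<lambda>x. (x, k)) v"
    if "\<forall>x\<in>set M. Suc k \<le> snd x" for v :: "'a list" and M
    using that by (subst takeWhile_append2) (cases M; auto)+
  have "map (\<lambda>x. (x, k)) w = map (\<lambda>x. (x, k)) w'" using t[OF assms(2), of w] t[OF assms(3), of w'] assms(1) by simp
  moreover from this have "w = w'" by (rule map_injective) (simp add: inj_on_def)
  ultimately show ?thesis using assms(1) by simp
qed

lemma level_order_inject: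
  "level_order k ts = level_order k ts' \<Longrightarrow> length ts = length ts' \<Longrightarrow> ts = ts'"
proof (induction k ts arbitrary: ts' rule: level_order.induct)
  case (2 k t ts)
  then obtain u us where ts': "ts' = u # us" by (cases ts') auto
  have "siblings t = siblings u \<and> level_order (Suc k) (ts @ offspring t) = level_order (Suc k) (us @ offspring u)"
    using "2.prems"(1) unfolding ts' level_order.simps
    by (rule map_pair_append_eq) (auto dest: level_order_ge)
  then have s: "siblings t = siblings u" and l: "level_order (Suc k) (ts @ offspring t) = level_order (Suc k) (us @ offspring u)" by auto
  have "ts @ offspring t = us @ offspring u" using "2.IH"[OF l] "2.prems"(2) s ts' by simp
  then have "ts = us" "offspring t = offspring u" using "2.prems"(2) ts' by auto
  then show ?case using siblings_offspring_inject[OF s] ts' by simp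
qed simp

lemma level_order_surj:
  "code_shape k m L \<Longrightarrow> \<exists>ts. length ts = m \<and> level_order k ts = L"
\<comment> \<open>Serving a position removes one forest from the queue and moves
  \<open>length w\<close> units from the list to the queue, so the sum drops by 1.\<close>
proof (induction "length L + m" arbitrary: k m L)
  case 0
  then show ?case by simp
next
  case (Suc N)
  show ?case
  proof (cases m)
    case 0
    have "L = []"
    proof (rule ccontr)
      assume "L \<noteq> []"
      then have "k \<le> snd (L ! 0)" "snd (L ! 0) < k" using Suc.prems 0 unfolding code_shape_def by fastforce+
      then show False by simp
    qed
    then show ?thesis using 0 by simp
  next
    case (Suc m')
    define w where "w = map fst (takeWhile (\<lambda>x. snd x = k) L)"
    define L' where "L' = dropWhile (\<lambda>x. snd x = k) L"
    have tw: "takeWhile (\<lambda>x. snd x = k) L = map (\<lambda>x. (x, k)) w"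
      unfolding w_def by (auto simp: map_idI comp_def dest: set_takeWhileD intro!: map_idI[symmetric])
    have L: "L = map (\<lambda>x. (x, k)) w @ L'" unfolding tw[symmetric] L'_def by simp
    have ge: "\<forall>x\<in>set L'. Suc k \<le> snd x"
    proof (cases L')
      case (Cons y ys)
      have "snd y \<noteq> k" using hd_dropWhile[of "\<lambda>x. snd x = k" L] Cons unfolding L'_def by simp
      moreover have "k \<le> snd y" using Suc.prems L Cons unfolding code_shape_def by auto
      moreover have "sorted (map snd (y # ys))" using Suc.prems L Cons unfolding code_shape_def by (simp add: sorted_append)
      ultimately show ?thesis using Cons by auto
    qed simp
    have "code_shape (Suc k) (m' + length w) L'" using code_shape_append[of k m' w L'] Suc.prems Suc L ge by simp
    moreover have "N = length L' + (m' + length w)" using Suc.hyps(2) Suc L by simp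
    ultimately obtain us where us: "length us = m' + length w" "level_order (Suc k) us = L'" using Suc.hyps(1) by blast
    \<comment> \<open>The recursive call returns the rest of the queue followed by the child forests
      of \<open>w\<close>.\<close>
    obtain t where t: "siblings t = w" "offspring t = drop m' us" using siblings_offspring_surj[of w "drop m' us"] us by auto
    have "level_order k (t # take m' us) = L" using t us L by simp
    then show ?thesis using Suc us by (intro exI[of _ "t # take m' us"]) simp
  qed
qed

text \<open>\<open>Q\<close> holds the labels of the positions from \<open>k\<close> on that are in
  the queue, with \<open>None\<close> for the virtual root. An entry whose parent is later than that
  of its predecessor is a first child and hangs on its parent by a right edge; any other entry hangs
  on its predecessor by a left edge, where \<open>edge_ok None\<close> forbids the dash.\<close>

definition code_edges_ok :: "nat \<Rightarrow> nat set option list \<Rightarrow> ((nat set \<times> bool) \<times> nat) list \<Rightarrow> bool" where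
  "code_edges_ok k Q L \<longleftrightarrow> (\<forall>p<length L.
    edge_ok (if p = 0 \<or> snd (L ! (p - 1)) < snd (L ! p)
      then (Q @ map (\<lambda>x. Some (fst (fst x))) L) ! (snd (L ! p) - k) else None) (fst (L ! p)))"

fun siblings_ok :: "nat set option \<Rightarrow> (nat set \<times> bool) list \<Rightarrow> bool" where
  "siblings_ok P [] = True" |
  "siblings_ok P (x # xs) = (edge_ok P x \<and> (\<forall>y\<in>set xs. edge_ok None y))"

lemma siblings_ok_None: "siblings_ok None xs \<longleftrightarrow> (\<forall>y\<in>set xs. edge_ok None y)"
  by (cases xs) auto

lemma siblings_ok_nth:
  "siblings_ok P xs \<longleftrightarrow> (\<forall>p<length xs. edge_ok (if p = 0 then P else None) (xs ! p))"
proof (cases xs)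
  case (Cons y ys)
  have "(\<forall>z\<in>set ys. edge_ok None z) \<longleftrightarrow> (\<forall>p<length ys. edge_ok None (ys ! p))" by (auto simp: all_set_conv_all_nth)
  then show ?thesis using Cons by (auto simp: less_Suc_eq_0_disj)
qed simp

lemma edges_ok_siblings:
  "edges_ok P t \<longleftrightarrow> siblings_ok P (siblings t) \<and> list_all2 edges_ok (map (\<lambda>x. Some (fst x)) (siblings t)) (offspring t)"
proof (induction t arbitrary: P)
  case (Node l x r)
  obtain A f where x: "x = (A, f)" by force
  show ?case unfolding x using Node.IH(1)[of None] by (auto simp: siblings_ok_None)
qed simp

lemma code_edges_ok_append:
  assumes L: "\<forall>x\<in>set L. Suc k \<le> snd x"
  shows "code_edges_ok k (P # Q) (map (\<lambda>x. (x, k)) w @ L) \<longleftrightarrow>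
    siblings_ok P w \<and> code_edges_ok (Suc k) (Q @ map (\<lambda>x. Some (fst x)) w) L"
proof -
  let ?M = "map (\<lambda>x. (x, k)) w @ L"
  let ?e = "\<lambda>p. edge_ok (if p = 0 \<or> snd (?M ! (p - 1)) < snd (?M ! p)
      then ((P # Q) @ map (\<lambda>x. Some (fst (fst x))) ?M) ! (snd (?M ! p) - k) else None) (fst (?M ! p))"
  let ?g = "\<lambda>p. edge_ok (if p = 0 \<or> snd (L ! (p - 1)) < snd (L ! p)
      then ((Q @ map (\<lambda>x. Some (fst x)) w) @ map (\<lambda>x. Some (fst (fst x))) L) ! (snd (L ! p) - Suc k) else None) (fst (L ! p))"
  have 1: "?e p \<longleftrightarrow> edge_ok (if p = 0 then P else None) (w ! p)" if p: "p < length w" for p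
    using p by (auto simp: nth_append)
  have 2: "?e (length w + p) \<longleftrightarrow> ?g p" if p: "p < length L" for p
  proof -
    have M: "?M ! (length w + p) = L ! p" by (simp add: nth_append)
    have k: "Suc k \<le> snd (L ! p)" using L p by simp
    then have "snd (L ! p) - k = Suc (snd (L ! p) - Suc k)" by simp
    then have N: "((P # Q) @ map (\<lambda>x. Some (fst (fst x))) ?M) ! (snd (L ! p) - k) =
      ((Q @ map (\<lambda>x. Some (fst x)) w) @ map (\<lambda>x. Some (fst (fst x))) L) ! (snd (L ! p) - Suc k)"
      by (simp add: comp_def)
    have F: "length w + p = 0 \<or> snd (?M ! (length w + p - 1)) < snd (L ! p) \<longleftrightarrow> p = 0 \<or> snd (L ! (p - 1)) < snd (L ! p)"
    proof (cases p)
      case 0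
      then show ?thesis using k by (cases "length w") (auto simp: nth_append)
    next
      case (Suc q)
      then show ?thesis by (simp add: nth_append)
    qed
    show ?thesis unfolding M N F ..
  qed
  have "(\<forall>p<length ?M. ?e p) \<longleftrightarrow> (\<forall>p<length w. ?e p) \<and> (\<forall>p<length L. ?e (length w + p))"
  proof (intro iffI conjI allI impI)
    fix p assume a: "(\<forall>p<length w. ?e p) \<and> (\<forall>p<length L. ?e (length w + p))" and p: "p < length ?M"
    show "?e p"
    proof (cases "p < length w")
      case True
      then show ?thesis using a by blast
    next
      case False
      then have "p - length w < length L" "length w + (p - length w) = p" using p by auto
      then show ?thesis using a by metis
    qed
  next
    fix p assume a: "\<forall>p<length ?M. ?e p" and p: "p < length w"
    then have "p < length ?M" by simp
    then show "?e p" using a by blast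
  next
    fix p assume a: "\<forall>p<length ?M. ?e p" and p: "p < length L"
    then have "length w + p < length ?M" by simp
    then show "?e (length w + p)" using a by blast
  qed
  also have "\<dots> \<longleftrightarrow> siblings_ok P w \<and> (\<forall>p<length L. ?g p)"
    unfolding siblings_ok_nth using 1 2 by simp
  finally show ?thesis unfolding code_edges_ok_def .
qed

lemma code_edges_ok_level_order:
  "length Q = length ts \<Longrightarrow> code_edges_ok k Q (level_order k ts) \<longleftrightarrow> list_all2 edges_ok Q ts"
proof (induction k ts arbitrary: Q rule: level_order.induct)
  case (1 k)
  then show ?case by (simp add: code_edges_ok_def)
next
  case (2 k t ts)
  then obtain P Q' where Q: "Q = P # Q'" "length Q' = length ts" by (cases Q) auto
  have "\<forall>x\<in>set (level_order (Suc k) (ts @ offspring t)). Suc k \<le> snd x" using level_order_ge by blast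
  then have "code_edges_ok k Q (level_order k (t # ts)) \<longleftrightarrow> siblings_ok P (siblings t) \<and>
    code_edges_ok (Suc k) (Q' @ map (\<lambda>x. Some (fst x)) (siblings t)) (level_order (Suc k) (ts @ offspring t))"
    unfolding Q level_order.simps by (rule code_edges_ok_append)
  also have "\<dots> \<longleftrightarrow> siblings_ok P (siblings t) \<and>
    list_all2 edges_ok (Q' @ map (\<lambda>x. Some (fst x)) (siblings t)) (ts @ offspring t)"
    using "2.IH"[of "Q' @ map (\<lambda>x. Some (fst x)) (siblings t)"] Q by simp
  also have "\<dots> \<longleftrightarrow> list_all2 edges_ok Q (t # ts)"
    unfolding Q list_all2_Cons edges_ok_siblings[of P t] using Q(2) by (auto simp: list_all2_append)
  finally show ?case .
qed

lemma mset_siblings: "mset (siblings t) + (\<Sum>u\<leftarrow>offspring t. mset (inorder u)) = mset (inorder t)"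
  by (induction t) (auto simp: add_ac)

text \<open>The traversal permutes the nodes, so conditions on labels and the number of free nodes
  carry over.\<close>

lemma mset_level_order: "mset (map fst (level_order k ts)) = (\<Sum>t\<leftarrow>ts. mset (inorder t))"
proof (induction k ts rule: level_order.induct)
  case (2 k t ts)
  have "map fst (map (\<lambda>x. (x, k)) (siblings t)) = siblings t" by (simp add: comp_def)
  then have "mset (map fst (level_order k (t # ts))) = mset (siblings t) + mset (map fst (level_order (Suc k) (ts @ offspring t)))"
    by (simp only: level_order.simps map_append mset_append)
  also have "\<dots> = (mset (siblings t) + (\<Sum>u\<leftarrow>offspring t. mset (inorder u))) + (\<Sum>t\<leftarrow>ts. mset (inorder t))"
    unfolding 2 by simp
  finally show ?case unfolding mset_siblings by simp
qed simp

definition codes :: "nat set \<Rightarrow> ((nat set \<times> bool) \<times> nat) list set" where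
  "codes X = {L. code_shape 0 1 L \<and> code_edges_ok 0 [None] L \<and>
    distinct (map (\<lambda>x. fst (fst x)) L) \<and> partition_on X ((\<lambda>x. fst (fst x)) ` set L)}"

lemma bij_betw_level_order:
  assumes "finite X"
  shows "bij_betw (\<lambda>t. level_order 0 [t]) (block_trees X) (codes X)"
proof -
  have mem: "level_order 0 [t] \<in> codes X \<longleftrightarrow> t \<in> block_trees X" for t
  proof -
    let ?L = "level_order 0 [t]"
    have "mset (map fst ?L) = mset (inorder t)" using mset_level_order[of 0 "[t]"] by simp
    then have m: "mset (map fst (map fst ?L)) = mset (map fst (inorder t))" by (metis mset_map)
    have d: "distinct (map (\<lambda>x. fst (fst x)) ?L) \<longleftrightarrow> distinct (map fst (inorder t))"
      using mset_eq_imp_distinct_iff[OF m] by (simp add: comp_def)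
    have s: "(\<lambda>x. fst (fst x)) ` set ?L = fst ` set_tree t"
      using mset_eq_setD[OF m] by (simp add: image_image del: level_order.simps)
    have c: "code_shape 0 1 ?L" using code_shape_level_order[of 0 "[t]"] by simp
    have e: "code_edges_ok 0 [None] ?L \<longleftrightarrow> edges_ok None t" using code_edges_ok_level_order[of "[None]" "[t]" 0] by simp
    show ?thesis
      unfolding codes_def block_trees_def mem_Collect_eq d s e using c disjoint_labels_iff[OF assms, of t] by blast
  qed
  show ?thesis unfolding bij_betw_def
  proof
    show "inj_on (\<lambda>t. level_order 0 [t]) (block_trees X)"
      by (rule inj_onI) (use level_order_inject[of 0 "[_]" "[_]"] in simp)
    have "\<exists>t. level_order 0 [t] = L" if L: "L \<in> codes X" for L
    proof -
      have "code_shape 0 1 L" using L unfolding codes_def by blast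
      then obtain ts where "length ts = 1" "level_order 0 ts = L" using level_order_surj by blast
      then show ?thesis by (cases ts) auto
    qed
    then show "(\<lambda>t. level_order 0 [t]) ` block_trees X = codes X" using mem by blast
  qed
qed

definition code_free_count :: "((nat set \<times> bool) \<times> nat) list \<Rightarrow> nat" where
  "code_free_count L = length (filter (\<lambda>x. \<not> snd (fst x)) L)"

lemma code_free_count_level_order: "code_free_count (level_order 0 [t]) = free_count t"
proof -
  let ?L = "level_order 0 [t]"
  have "mset (map fst ?L) = mset (inorder t)" using mset_level_order[of 0 "[t]"] by simp
  then have "size (filter_mset (\<lambda>x. \<not> snd x) (mset (map fst ?L))) = size (filter_mset (\<lambda>x. \<not> snd x) (mset (inorder t)))" by simp
  then have "length (filter (\<lambda>x. \<not> snd x) (map fst ?L)) = length (filter (\<lambda>x. \<not> snd x) (inorder t))"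
    by (metis mset_filter size_mset)
  then show ?thesis unfolding code_free_count_def free_count_def by (simp add: filter_map comp_def case_prod_beta')
qed

lemma bij_betw_T_trees_codes:
  "bij_betw (\<lambda>t. level_order 0 [t]) (T_trees n k) {L \<in> codes {1..n}. code_free_count L = k}"
  unfolding T_trees_conv
  by (rule bij_betw_Collect[OF bij_betw_level_order]) (simp_all only: code_free_count_level_order finite_atLeastAtMost)

section \<open>Codes of points\<close>

lemma down_closed_nat_set:
  assumes "finite Q" "\<And>p q. q \<in> Q \<Longrightarrow> p < q \<Longrightarrow> p \<in> Q"
  shows "Q = {..<card Q}"
proof -
  define m where "m = (LEAST m. m \<notin> Q)"
  have ex: "\<exists>m. m \<notin> Q" using assms(1) ex_new_if_finite infinite_UNIV_nat by blast
  have "m \<notin> Q" unfolding m_def using ex by (rule LeastI_ex)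
  then have "q < m" if "q \<in> Q" for q using assms(2)[OF that] that by (metis linorder_neqE_nat)
  moreover have "q \<in> Q" if "q < m" for q using that not_less_Least unfolding m_def by blast
  ultimately have "Q = {..<m}" by auto
  then show ?thesis by simp
qed

text \<open>Lets an initial segment of the values be stored as its cardinality alone.\<close>

lemma nth_mem_down_closed:
  fixes xs :: "real list"
  assumes xs: "sorted_wrt (<) xs" and S: "S \<subseteq> set xs" "\<And>u w. u \<in> S \<Longrightarrow> w \<in> set xs \<Longrightarrow> w \<le> u \<Longrightarrow> w \<in> S"
    and q: "q < length xs"
  shows "xs ! q \<in> S \<longleftrightarrow> q < card S"
proof -
  let ?Q = "{q. q < length xs \<and> xs ! q \<in> S}"
  have d: "distinct xs" using xs by (simp add: strict_sorted_iff)
  have "(!) xs ` ?Q = S" using S(1) by (auto simp: in_set_conv_nth subset_iff)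
  moreover have "inj_on ((!) xs) ?Q" using d by (auto simp: inj_on_def nth_eq_iff_index_eq)
  ultimately have "bij_betw ((!) xs) ?Q S" unfolding bij_betw_def by blast
  then have c: "card S = card ?Q" by (simp add: bij_betw_same_card)
  have "?Q = {..<card ?Q}"
  proof (rule down_closed_nat_set)
    fix p q assume pq: "q \<in> ?Q" "p < q"
    then have "xs ! p < xs ! q" using sorted_wrt_nth_less[OF xs] by simp
    then show "p \<in> ?Q" using pq S(2)[of "xs ! q" "xs ! p"] by simp
  qed simp
  from eqset_imp_iff[OF this, of q] show ?thesis using q c by simp
qed

definition value_list :: "nat \<Rightarrow> (nat \<Rightarrow> real) \<Rightarrow> real list" where
  "value_list n g = sorted_list_of_set (g ` {1..n})"

definition value_block :: "nat \<Rightarrow> (nat \<Rightarrow> real) \<Rightarrow> real \<Rightarrow> nat set" where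
  "value_block n g v = {i \<in> {1..n}. g i = v}"

text \<open>For \<open>j < i\<close> the equation \<open>g j - g i = 1\<close> is one of the
  hyperplanes, so a flagged value is tied to the value 1 below it.\<close>

definition value_flag :: "nat \<Rightarrow> (nat \<Rightarrow> real) \<Rightarrow> real \<Rightarrow> bool" where
  "value_flag n g v \<longleftrightarrow> (\<exists>i\<in>{1..n}. \<exists>j\<in>{1..n}. j < i \<and> g j = v \<and> g i + 1 = v)"

definition low_values :: "nat \<Rightarrow> (nat \<Rightarrow> real) \<Rightarrow> real \<Rightarrow> real set" where
  "low_values n g v = {u \<in> g ` {1..n}. \<exists>i\<in>{1..n}. \<exists>j\<in>{1..n}. j < i \<and> u \<le> g i \<and> g i + 1 \<le> g j \<and> g j \<le> v}"

text \<open>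
  The relation of \<open>g j\<close> to \<open>g i + 1\<close> is recorded by the Shi arrangement only for \<open>j < i\<close>.
  The parent of a value \<open>v\<close> is the largest value \<open>u\<close> for which the recorded relations
  force \<open>u + 1 \<le> v\<close>.
\<close>

definition shi_code :: "nat \<Rightarrow> (nat \<Rightarrow> real) \<Rightarrow> ((nat set \<times> bool) \<times> nat) list" where
  "shi_code n g = map (\<lambda>v. ((value_block n g v, value_flag n g v), card (low_values n g v))) (value_list n g)"

definition shi_equiv :: "nat \<Rightarrow> (nat \<Rightarrow> real) \<Rightarrow> (nat \<Rightarrow> real) \<Rightarrow> bool" where
  "shi_equiv n g h \<longleftrightarrow> (\<forall>i j. 1 \<le> i \<and> i < j \<and> j \<le> n \<longrightarrow>
    (\<forall>c\<in>{0, 1}. (g i - g j < c \<longleftrightarrow> h i - h j < c) \<and> (g i - g j = c \<longleftrightarrow> h i - h j = c)))"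

lemma shi_equivD:
  assumes "shi_equiv n g h" "i \<in> {1..n}" "j \<in> {1..n}"
  shows "g i < g j \<longleftrightarrow> h i < h j" "g i = g j \<longleftrightarrow> h i = h j" "g i \<le> g j \<longleftrightarrow> h i \<le> h j"
    "j < i \<Longrightarrow> g i + 1 \<le> g j \<longleftrightarrow> h i + 1 \<le> h j" "j < i \<Longrightarrow> g i + 1 = g j \<longleftrightarrow> h i + 1 = h j"
proof -
  have r: "(g a - g b < c \<longleftrightarrow> h a - h b < c) \<and> (g a - g b = c \<longleftrightarrow> h a - h b = c)"
    if "a \<in> {1..n}" "b \<in> {1..n}" "a < b" "c \<in> {0, 1}" for a b c
    using assms(1) that unfolding shi_equiv_def by auto
  have "(g i < g j \<longleftrightarrow> h i < h j) \<and> (g i = g j \<longleftrightarrow> h i = h j)"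
  proof (cases i j rule: linorder_cases)
    case less
    then show ?thesis using r[OF assms(2,3) less, of 0] by simp
  next
    case greater
    then have "(g j < g i \<longleftrightarrow> h j < h i) \<and> (g j = g i \<longleftrightarrow> h j = h i)" using r[OF assms(3,2) greater, of 0] by simp
    then show ?thesis by (smt (verit))
  qed simp
  then show "g i < g j \<longleftrightarrow> h i < h j" "g i = g j \<longleftrightarrow> h i = h j" "g i \<le> g j \<longleftrightarrow> h i \<le> h j" by (auto simp: le_less)
  show "g i + 1 \<le> g j \<longleftrightarrow> h i + 1 \<le> h j" if "j < i"
    using r[OF assms(3,2) that, of 1] by (smt (verit) insert_iff)
  show "g i + 1 = g j \<longleftrightarrow> h i + 1 = h j" if "j < i"
    using r[OF assms(3,2) that, of 1] by (smt (verit) insert_iff)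
qed

lemma set_values [simp]: "set (value_list n g) = g ` {1..n}"
  and strict_sorted_values: "sorted_wrt (<) (value_list n g)"
  and distinct_values: "distinct (value_list n g)"
  unfolding value_list_def by (auto simp: strict_sorted_list_of_set)

lemma values_nth_less:
  "p < length (value_list n g) \<Longrightarrow> q < length (value_list n g) \<Longrightarrow> value_list n g ! p < value_list n g ! q \<longleftrightarrow> p < q"
  using sorted_wrt_nth_less[OF strict_sorted_values[of n g]] by (metis linorder_neqE_nat order.asym order.irrefl)

lemma values_index:
  assumes "i \<in> {1..n}" obtains p where "p < length (value_list n g)" "g i = value_list n g ! p"
  using assms by (metis imageI in_set_conv_nth set_values)

lemma low_values_less: "u \<in> low_values n g v \<Longrightarrow> u + 1 \<le> v"
  unfolding low_values_def by auto

lemma nth_mem_low_values: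
  "q < length (value_list n g) \<Longrightarrow> value_list n g ! q \<in> low_values n g v \<longleftrightarrow> q < card (low_values n g v)"
  by (rule nth_mem_down_closed[OF strict_sorted_values]) (auto simp: low_values_def intro: order_trans)

text \<open>Passing to \<open>low_values\<close> loses nothing: for a recorded pair it gives back
  the relation itself.\<close>

lemma mem_low_values_iff:
  assumes "i \<in> {1..n}" "j \<in> {1..n}" "j < i"
  shows "g i \<in> low_values n g (g j) \<longleftrightarrow> g i + 1 \<le> g j"
  using assms low_values_less[of "g i" n g "g j"] unfolding low_values_def by force

lemma low_values_mono: "v \<le> w \<Longrightarrow> low_values n g v \<subseteq> low_values n g w"
  unfolding low_values_def by force

lemma finite_low_values [simp]: "finite (low_values n g v)"
  unfolding low_values_def by simp

text \<open>Elements of \<open>low_values n g (g j)\<close> are at most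
  \<open>g j - 1 = g i\<close>, so \<open>g i\<close> is the largest of them, the parent. A bare
  flag thus tells which value lies exactly 1 below. The \<open>Suc\<close> is due to position 0
  being the virtual root.\<close>

lemma flag_parent:
  assumes ij: "i \<in> {1..n}" "j \<in> {1..n}" "j < i" and eq: "g i + 1 = g j"
    and p: "p < length (value_list n g)" "g i = value_list n g ! p"
  shows "Suc p = card (low_values n g (g j))"
proof -
  have "g i \<in> low_values n g (g j)" using mem_low_values_iff[OF ij] eq by simp
  then have "p < card (low_values n g (g j))" using nth_mem_low_values[OF p(1)] p by simp
  moreover have "\<not> Suc p < card (low_values n g (g j))"
  proof
    assume a: "Suc p < card (low_values n g (g j))"
    have "card (low_values n g (g j)) \<le> card (g ` {1..n})" by (rule card_mono) (auto simp: low_values_def)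
    also have "\<dots> = length (value_list n g)" using distinct_card[OF distinct_values[of n g]] by simp
    finally have l: "Suc p < length (value_list n g)" using a by simp
    then have "value_list n g ! Suc p \<in> low_values n g (g j)" using nth_mem_low_values[OF l] a by simp
    then have "value_list n g ! Suc p \<le> g i" using low_values_less eq by fastforce
    moreover have "value_list n g ! p < value_list n g ! Suc p" using values_nth_less p(1) l by simp
    ultimately show False using p by simp
  qed
  ultimately show ?thesis by simp
qed

text \<open>The map \<open>\<phi>\<close> from \<open>g i\<close> to \<open>h i\<close> is an order
  isomorphism of the value sets, and blocks, flags and parents are all expressed by recorded
  relations.\<close>

lemma shi_code_invariant:
  assumes eqv: "shi_equiv n g h"
  shows "shi_code n g = shi_code n h"
proof -
  note E = shi_equivD[OF eqv]
  define \<phi> where "\<phi> v = h (SOME i. i \<in> {1..n} \<and> g i = v)" for v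
  have \<phi>: "\<phi> (g i) = h i" if i: "i \<in> {1..n}" for i
  proof -
    have "(SOME k. k \<in> {1..n} \<and> g k = g i) \<in> {1..n} \<and> g (SOME k. k \<in> {1..n} \<and> g k = g i) = g i"
      by (rule someI[of "\<lambda>k. k \<in> {1..n} \<and> g k = g i" i]) (use i in simp)
    then show ?thesis unfolding \<phi>_def using E(2)[OF _ i] by blast
  qed
  have "value_list n h = map \<phi> (value_list n g)"
  proof (rule strict_sorted_equal)
    show "sorted_wrt (<) (map \<phi> (value_list n g))"
      unfolding sorted_wrt_map
    proof (rule sorted_wrt_mono_rel[OF _ strict_sorted_values])
      fix u v assume "u \<in> set (value_list n g)" "v \<in> set (value_list n g)" "u < v"
      then show "\<phi> u < \<phi> v" using \<phi> E(1) by auto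
    qed
    show "set (value_list n h) = set (map \<phi> (value_list n g))" using \<phi> by (auto simp: image_image)
  qed (rule strict_sorted_values)
  moreover have "value_block n h (\<phi> v) = value_block n g v" if "v \<in> g ` {1..n}" for v
    using that E(2) \<phi> unfolding value_block_def by auto
  moreover have "value_flag n h (\<phi> v) = value_flag n g v" if v: "v \<in> g ` {1..n}" for v
  proof -
    obtain k where k: "k \<in> {1..n}" "v = g k" using v by blast
    have "(j < i \<and> h j = h k \<and> h i + 1 = h k) = (j < i \<and> g j = g k \<and> g i + 1 = g k)"
      if "i \<in> {1..n}" "j \<in> {1..n}" for i j
      using E(2)[OF that(2) k(1)] E(5)[OF that] by auto
    then show ?thesis unfolding value_flag_def k(2) \<phi>[OF k(1)] by simp
  qed
  moreover have "card (low_values n h (\<phi> v)) = card (low_values n g v)" if v: "v \<in> g ` {1..n}" for v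
  proof -
    obtain k where k: "k \<in> {1..n}" "v = g k" using v by blast
    have lo: "h m \<in> low_values n h (h k) \<longleftrightarrow> g m \<in> low_values n g (g k)" if m: "m \<in> {1..n}" for m
    proof -
      have "(j < i \<and> h m \<le> h i \<and> h i + 1 \<le> h j \<and> h j \<le> h k) = (j < i \<and> g m \<le> g i \<and> g i + 1 \<le> g j \<and> g j \<le> g k)"
        if "i \<in> {1..n}" "j \<in> {1..n}" for i j
        using E(3)[OF m that(1)] E(4)[OF that] E(3)[OF that(2) k(1)] by auto
      then show ?thesis unfolding low_values_def using m by simp
    qed
    have "low_values n h (h k) = \<phi> ` low_values n g (g k)"
    proof
      show "low_values n h (h k) \<subseteq> \<phi> ` low_values n g (g k)"
      proof
        fix u assume u: "u \<in> low_values n h (h k)"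
        then obtain m where m: "m \<in> {1..n}" "u = h m" unfolding low_values_def by blast
        then show "u \<in> \<phi> ` low_values n g (g k)" using lo[of m] \<phi>[of m] u by (metis imageI)
      qed
      show "\<phi> ` low_values n g (g k) \<subseteq> low_values n h (h k)"
      proof
        fix u assume "u \<in> \<phi> ` low_values n g (g k)"
        then obtain w where w: "w \<in> low_values n g (g k)" "u = \<phi> w" by blast
        then obtain m where m: "m \<in> {1..n}" "w = g m" unfolding low_values_def by blast
        then show "u \<in> low_values n h (h k)" using lo[of m] \<phi>[of m] w by simp
      qed
    qed
    moreover have "inj_on \<phi> (g ` {1..n})" using \<phi> E(2) by (auto simp: inj_on_def)
    then have "inj_on \<phi> (low_values n g (g k))" by (rule inj_on_subset) (auto simp: low_values_def)
    ultimately show ?thesis using \<phi>[OF k(1)] k(2) by (simp add: card_image)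
  qed
  ultimately show ?thesis unfolding shi_code_def by (simp add: comp_def)
qed

text \<open>The blocks in their order give the comparisons with 0, the parents give
  \<open>g i + 1 \<le> g j\<close> for \<open>j < i\<close>, and the flags single out
  equality.\<close>

lemma shi_code_determines:
  assumes eq: "shi_code n g = shi_code n h"
  shows "shi_equiv n g h"
proof -
  have len: "length (value_list n g) = length (value_list n h)" using arg_cong[OF eq, of length] unfolding shi_code_def by simp
  have nth: "value_block n g (value_list n g ! p) = value_block n h (value_list n h ! p)"
    "value_flag n g (value_list n g ! p) = value_flag n h (value_list n h ! p)"
    "card (low_values n g (value_list n g ! p)) = card (low_values n h (value_list n h ! p))"
    if "p < length (value_list n g)" for p
    using arg_cong[OF eq, of "\<lambda>L. L ! p"] that len unfolding shi_code_def by simp_all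
  define idx where "idx g i = (SOME p. p < length (value_list n g) \<and> g i = value_list n g ! p)" for g :: "nat \<Rightarrow> real" and i
  have idx: "idx g i < length (value_list n g) \<and> g i = value_list n g ! idx g i" if "i \<in> {1..n}" for g :: "nat \<Rightarrow> real" and i
    unfolding idx_def by (rule someI_ex) (use values_index[OF that] in metis)
  have same: "idx h i = idx g i" if i: "i \<in> {1..n}" for i
  proof -
    have "i \<in> value_block n g (value_list n g ! idx g i)" using idx[OF i, of g] i unfolding value_block_def by simp
    then have "i \<in> value_block n h (value_list n h ! idx g i)" using nth(1)[of "idx g i"] idx[OF i, of g] by simp
    then have "h i = value_list n h ! idx g i" unfolding value_block_def by simp
    then show ?thesis
      using idx[OF i, of h] idx[OF i, of g] len distinct_values[of n h] by (metis nth_eq_iff_index_eq)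
  qed
  have 1: "g i < g j \<longleftrightarrow> h i < h j" if "i \<in> {1..n}" "j \<in> {1..n}" for i j
    using idx[OF that(1), of g] idx[OF that(2), of g] idx[OF that(1), of h] idx[OF that(2), of h]
      same[OF that(1)] same[OF that(2)] len
      values_nth_less[of "idx g i" n g "idx g j"] values_nth_less[of "idx h i" n h "idx h j"] by simp
  have le: "g i + 1 \<le> g j \<longleftrightarrow> idx g i < card (low_values n g (value_list n g ! idx g j))"
    if "i \<in> {1..n}" "j \<in> {1..n}" "j < i" for g i j
    using mem_low_values_iff[OF that, of g] nth_mem_low_values[of "idx g i" n g "g j"] idx[OF that(1), of g] idx[OF that(2), of g] by simp
  have eq1: "g i + 1 = g j \<longleftrightarrow> value_flag n g (value_list n g ! idx g j) \<and> Suc (idx g i) = card (low_values n g (value_list n g ! idx g j))"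
    if ij: "i \<in> {1..n}" "j \<in> {1..n}" "j < i" for g i j
  proof
    assume e: "g i + 1 = g j"
    then have "value_flag n g (g j)" using ij unfolding value_flag_def by blast
    then show "value_flag n g (value_list n g ! idx g j) \<and> Suc (idx g i) = card (low_values n g (value_list n g ! idx g j))"
      using flag_parent[OF ij e] idx[OF ij(1), of g] idx[OF ij(2), of g] by simp
  next
    assume a: "value_flag n g (value_list n g ! idx g j) \<and> Suc (idx g i) = card (low_values n g (value_list n g ! idx g j))"
    \<comment> \<open>The flag may be witnessed by another pair, but its lower value is the parent
      of the same block and hence equals \<open>g i\<close>.\<close>
    then obtain i' j' where i': "i' \<in> {1..n}" "j' \<in> {1..n}" "j' < i'" "g j' = g j" "g i' + 1 = g j"
      unfolding value_flag_def using idx[OF ij(2), of g] by metis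
    then have "Suc (idx g i') = card (low_values n g (g j'))" using flag_parent[of i' n j' g "idx g i'"] idx[OF i'(1), of g] by simp
    then have "idx g i' = idx g i" using a i'(4) idx[OF ij(2), of g] by simp
    then show "g i + 1 = g j" using idx[OF ij(1), of g] idx[OF i'(1), of g] i' by simp
  qed
  show ?thesis unfolding shi_equiv_def
  proof (intro allI impI ballI)
    fix i j :: nat and c :: real assume ij: "1 \<le> i \<and> i < j \<and> j \<le> n" and c: "c \<in> {0, 1}"
    then have i: "i \<in> {1..n}" and j: "j \<in> {1..n}" and ji: "i < j" by auto
    have "g i - g j < 0 \<longleftrightarrow> h i - h j < 0" "g i - g j = 0 \<longleftrightarrow> h i - h j = 0"
      using 1[OF i j] 1[OF j i] by (auto simp: not_less[symmetric] dest: less_imp_neq intro: antisym_conv3[THEN iffD1])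
    moreover have "g j + 1 \<le> g i \<longleftrightarrow> h j + 1 \<le> h i" "g j + 1 = g i \<longleftrightarrow> h j + 1 = h i"
      unfolding le[OF j i ji] eq1[OF j i ji] same[OF i] same[OF j] nth(2,3)[OF conjunct1[OF idx[OF i, of g]]]
      by (rule refl)+
    ultimately show "(g i - g j < c \<longleftrightarrow> h i - h j < c) \<and> (g i - g j = c \<longleftrightarrow> h i - h j = c)"
      using c by auto
  qed
qed

lemma length_shi_code [simp]: "length (shi_code n g) = length (value_list n g)"
  unfolding shi_code_def by simp

lemma nth_shi_code:
  "p < length (value_list n g) \<Longrightarrow> shi_code n g ! p =
    ((value_block n g (value_list n g ! p), value_flag n g (value_list n g ! p)), card (low_values n g (value_list n g ! p)))"
  unfolding shi_code_def by simp

lemma card_low_values_le: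
  assumes "p < length (value_list n g)" shows "card (low_values n g (value_list n g ! p)) \<le> p"
  using nth_mem_low_values[OF assms, of "value_list n g ! p"] low_values_less[of "value_list n g ! p" n g "value_list n g ! p"]
  by fastforce

text \<open>The pair showing that value \<open>c - 1\<close> is low for value \<open>p\<close> is
  pinned down from both sides: a smaller \<open>g j\<close> would make that value low for the
  predecessor of \<open>p\<close> already, and a larger \<open>g i\<close> would make a value beyond
  the parent low.\<close>

lemma first_child_witness:
  assumes p: "p < length (value_list n g)" and c: "c = card (low_values n g (value_list n g ! p))" "c > 0"
    and first: "p = 0 \<or> card (low_values n g (value_list n g ! (p - 1))) < c"
  obtains i j where "i \<in> {1..n}" "j \<in> {1..n}" "j < i" "g j = value_list n g ! p" "g i = value_list n g ! (c - 1)"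
proof -
  have cp: "c \<le> p" using card_low_values_le[OF p] c by simp
  then have p0: "p > 0" and lt: "c - 1 < length (value_list n g)" using c p by auto
  let ?u = "value_list n g ! (c - 1)"
  have "?u \<in> low_values n g (value_list n g ! p)" using nth_mem_low_values[OF lt] c by simp
  then obtain i j where ij: "i \<in> {1..n}" "j \<in> {1..n}" "j < i" "?u \<le> g i" "g i + 1 \<le> g j" "g j \<le> value_list n g ! p"
    unfolding low_values_def by blast
  have "?u \<notin> low_values n g (value_list n g ! (p - 1))" using nth_mem_low_values[OF lt] first p0 by auto
  moreover have "?u \<in> g ` {1..n}" using nth_mem[OF lt] by simp
  ultimately have nle: "\<not> g j \<le> value_list n g ! (p - 1)" using ij unfolding low_values_def by blast
  obtain q where q: "q < length (value_list n g)" "g j = value_list n g ! q" using values_index[OF ij(2)] .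
  have "\<not> p < q" using ij(6) q p values_nth_less[of p n g q] by simp
  moreover have "p - 1 < q" using nle q p p0 values_nth_less[of "p - 1" n g q] by simp
  ultimately have "q = p" using p0 by simp
  then have gj: "g j = value_list n g ! p" using q by simp
  have "g i \<in> low_values n g (g j)" using mem_low_values_iff[OF ij(1-3)] ij(5) by simp
  moreover obtain q' where q': "q' < length (value_list n g)" "g i = value_list n g ! q'" using values_index[OF ij(1)] .
  ultimately have "q' < c" using nth_mem_low_values[OF q'(1)] c gj by simp
  then have "\<not> c - 1 < q'" by simp
  then have "\<not> ?u < g i" using q' lt values_nth_less[of "c - 1" n g q'] by simp
  then have "g i \<le> ?u" by simp
  then show thesis using that[OF ij(1-3) gj] ij(4) by simp
qed

lemma shi_code_in_codes: "shi_code n g \<in> codes {1..n}"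
proof -
  let ?v = "value_list n g" and ?L = "shi_code n g"
  have "code_shape 0 1 ?L" unfolding code_shape_def
  proof (intro conjI allI impI ballI)
    show "sorted (map snd ?L)" unfolding sorted_iff_nth_mono
    proof (intro allI impI)
      fix p q assume pq: "p \<le> q" "q < length (map snd ?L)"
      then have "?v ! p \<le> ?v ! q" using values_nth_less[of q n g p] by simp
      then have "card (low_values n g (?v ! p)) \<le> card (low_values n g (?v ! q))" by (intro card_mono low_values_mono) auto
      then show "map snd ?L ! p \<le> map snd ?L ! q" using pq by (simp add: nth_shi_code)
    qed
    fix p assume "p < length ?L"
    then show "snd (?L ! p) < 0 + 1 + p" using card_low_values_le[of p n g] by (simp add: nth_shi_code)
  qed simp
  moreover have "code_edges_ok 0 [None] ?L" unfolding code_edges_ok_def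
  proof (intro allI impI)
    fix p assume "p < length ?L"
    then have p: "p < length ?v" by simp
    define c where "c = card (low_values n g (?v ! p))"
    have Lp: "?L ! p = ((value_block n g (?v ! p), value_flag n g (?v ! p)), c)" using nth_shi_code[OF p] c_def by simp
    have cp: "c \<le> p" using card_low_values_le[OF p] c_def by simp
    have flag: "\<exists>i j q. i \<in> {1..n} \<and> j \<in> {1..n} \<and> j < i \<and> g j = ?v ! p \<and> g i + 1 = ?v ! p \<and> q < length ?v \<and> g i = ?v ! q \<and> Suc q = c"
      if fl: "value_flag n g (?v ! p)"
    proof -
      obtain i j where ij: "i \<in> {1..n}" "j \<in> {1..n}" "j < i" "g j = ?v ! p" "g i + 1 = ?v ! p"
        using fl unfolding value_flag_def by blast
      obtain q where q: "q < length ?v" "g i = ?v ! q" using values_index[OF ij(1)] .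
      have "g i + 1 = g j" using ij by simp
      then have "Suc q = c" using flag_parent[OF ij(1-3) _ q] ij(4) c_def by simp
      then show ?thesis using ij q by blast
    qed
    let ?N = "[None] @ map (\<lambda>x. Some (fst (fst x))) ?L"
    show "edge_ok (if p = 0 \<or> snd (?L ! (p - 1)) < snd (?L ! p) then ?N ! (snd (?L ! p) - 0) else None) (fst (?L ! p))"
    proof (cases "p = 0 \<or> snd (?L ! (p - 1)) < snd (?L ! p)")
      case True
      then have first: "p = 0 \<or> card (low_values n g (?v ! (p - 1))) < c" using Lp p by (auto simp: nth_shi_code)
      show ?thesis
      proof (cases "c = 0")
        case True
        then have "\<not> value_flag n g (?v ! p)" using flag by auto
        then show ?thesis unfolding Lp using True by simp
      next
        case False
        then obtain i j where ij: "i \<in> {1..n}" "j \<in> {1..n}" "j < i" "g j = ?v ! p" "g i = ?v ! (c - 1)"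
          using first_child_witness[OF p c_def _ first] by auto
        have "i \<in> value_block n g (?v ! (c - 1))" "j \<in> value_block n g (?v ! p)" using ij unfolding value_block_def by auto
        moreover have "finite (value_block n g u)" for u unfolding value_block_def by simp
        ultimately have "i \<le> Max (value_block n g (?v ! (c - 1)))" "Min (value_block n g (?v ! p)) \<le> j" by auto
        then have "descent (value_block n g (?v ! (c - 1))) (value_block n g (?v ! p))" unfolding descent_def using ij(3) by simp
        moreover have "c - 1 < length ?v" using cp p by simp
        \<comment> \<open>The list \<open>?N\<close> begins with the virtual root, so entry
          \<open>c\<close> is the block of value \<open>c - 1\<close>.\<close>
        then have "?N ! c = Some (value_block n g (?v ! (c - 1)))" using False nth_shi_code[of "c - 1" n g] by (simp add: nth_Cons')
        ultimately show ?thesis using \<open>p = 0 \<or> snd (?L ! (p - 1)) < snd (?L ! p)\<close> unfolding Lp by simp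
      qed
    next
      case False
      then have p0: "p > 0" and le: "c \<le> card (low_values n g (?v ! (p - 1)))" using Lp p by (auto simp: nth_shi_code)
      \<comment> \<open>Were a later sibling flagged, its parent would lie exactly 1 below it and at
        least 1 below its smaller predecessor.\<close>
      have "\<not> value_flag n g (?v ! p)"
      proof
        assume "value_flag n g (?v ! p)"
        then obtain i j q where q: "g i + 1 = ?v ! p" "q < length ?v" "g i = ?v ! q" "Suc q = c" using flag by blast
        then have "g i \<in> low_values n g (?v ! (p - 1))" using nth_mem_low_values[of q n g] le by simp
        then have "?v ! p \<le> ?v ! (p - 1)" using low_values_less q(1) by fastforce
        moreover have "p - 1 < length ?v" using p by simp
        ultimately show False using values_nth_less[of "p - 1" n g p] p p0 by simp
      qed
      then show ?thesis using False unfolding Lp by simp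
    qed
  qed
  moreover have bl: "map (\<lambda>x. fst (fst x)) ?L = map (value_block n g) ?v" unfolding shi_code_def by simp
  have ne: "value_block n g u \<noteq> {}" if "u \<in> set ?v" for u using that unfolding value_block_def by auto
  have inj: "u = w" if "value_block n g u \<inter> value_block n g w \<noteq> {}" for u w using that unfolding value_block_def by auto
  have "inj_on (value_block n g) (set ?v)" using ne inj by (metis inj_onI inf.idem)
  then have "distinct (map (\<lambda>x. fst (fst x)) ?L)" unfolding bl using distinct_values by (simp only: distinct_map)
  moreover have "(\<lambda>x. fst (fst x)) ` set ?L = value_block n g ` set ?v" using bl by (metis list.set_map)
  moreover have "partition_on {1..n} (value_block n g ` set ?v)"
  proof (rule partition_onI)
    show "\<Union> (value_block n g ` set ?v) = {1..n}" unfolding value_block_def by auto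
    fix A B assume "A \<in> value_block n g ` set ?v" "B \<in> value_block n g ` set ?v" "A \<noteq> B"
    then show "disjnt A B" using inj unfolding disjnt_def by blast
  next
    show "{} \<notin> value_block n g ` set ?v" using ne by force
  qed
  ultimately show ?thesis unfolding codes_def by simp
qed

text \<open>Values are chosen greedily from below. The next one must exceed the last value and lie
  in the half-open interval from \<open>v (c r - 1) + 1\<close> to \<open>v (c r) + 1\<close>, at
  its left end exactly if flagged; monotonicity of \<open>c\<close> keeps this possible.\<close>

lemma realize_parents:
  fixes c :: "nat \<Rightarrow> nat" and f :: "nat \<Rightarrow> bool"
  assumes "\<And>p. p < r \<Longrightarrow> c p \<le> p" "\<And>p. Suc p < r \<Longrightarrow> c p \<le> c (Suc p)"
    and "\<And>p. p < r \<Longrightarrow> f p \<Longrightarrow> 0 < c p" "\<And>p. Suc p < r \<Longrightarrow> f (Suc p) \<Longrightarrow> c p < c (Suc p)"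
  shows "\<exists>v :: nat \<Rightarrow> real. \<forall>p<r. \<forall>q<p. v q < v p \<and> (v q + 1 \<le> v p \<longleftrightarrow> q < c p) \<and>
    (v q + 1 = v p \<longleftrightarrow> f p \<and> Suc q = c p)"
  using assms
proof (induction r)
  case 0
  then show ?case by simp
next
  case (Suc r)
  have "\<exists>v :: nat \<Rightarrow> real. \<forall>p<r. \<forall>q<p. v q < v p \<and> (v q + 1 \<le> v p \<longleftrightarrow> q < c p) \<and>
    (v q + 1 = v p \<longleftrightarrow> f p \<and> Suc q = c p)" by (rule Suc.IH) (use Suc.prems in auto)
  then obtain v :: "nat \<Rightarrow> real" where v: "\<And>p q. p < r \<Longrightarrow> q < p \<Longrightarrow> v q < v p \<and> (v q + 1 \<le> v p \<longleftrightarrow> q < c p) \<and>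
    (v q + 1 = v p \<longleftrightarrow> f p \<and> Suc q = c p)" by blast
  have mono: "v q \<le> v p" if "q \<le> p" "p < r" for p q using v[of p q] that by (cases "q = p") auto
  have "\<exists>y. \<forall>q<r. v q < y \<and> (v q + 1 \<le> y \<longleftrightarrow> q < c r) \<and> (v q + 1 = y \<longleftrightarrow> f r \<and> Suc q = c r)"
  proof (cases r)
    case 0
    then show ?thesis by simp
  next
    case (Suc s)
    have cr: "c r \<le> r" "c s \<le> c r" using Suc.prems(1)[of r] Suc.prems(2)[of s] Suc by auto
    \<comment> \<open>Values from position \<open>c s\<close> on are less than 1 below the last
      value \<open>v s\<close>, so the upper bound \<open>v (c r) + 1\<close> is compatible with
      exceeding \<open>v s\<close>.\<close>
    have top: "v s < v q + 1" if "c s \<le> q" "q < r" for q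
    proof (cases "q = s")
      case False
      then have "q < s" using that Suc by simp
      then show ?thesis using v[of s q] Suc that by auto
    qed simp
    show ?thesis
    proof (cases "f r")
      case True
      have c: "0 < c r" "c s < c r" using Suc.prems(3)[of r] Suc.prems(4)[of s] True Suc by auto
      \<comment> \<open>A flag forces the new value to be \<open>v d + 1\<close>; the strict
        increase \<open>c s < c r\<close> puts it above \<open>v s\<close>.\<close>
      define d where "d = c r - 1"
      have d: "c r = Suc d" "d < r" "c s \<le> d" using c cr d_def by auto
      show ?thesis
      proof (intro exI[of _ "v d + 1"] allI impI)
        fix q assume q: "q < r"
        have "v q \<le> v s" using mono[of q s] q Suc by simp
        then have "v q < v d + 1" using top[OF d(3,2)] by simp
        moreover have "v q \<le> v d \<longleftrightarrow> q \<le> d" using mono[of q d] v[of q d] q d by (cases "q \<le> d") auto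
        moreover have "v q = v d \<longleftrightarrow> q = d" using v[of q d] v[of d q] q d by (cases q d rule: linorder_cases) auto
        ultimately show "v q < v d + 1 \<and> (v q + 1 \<le> v d + 1 \<longleftrightarrow> q < c r) \<and> (v q + 1 = v d + 1 \<longleftrightarrow> f r \<and> Suc q = c r)"
          using True d by auto
      qed
    next
      case False
      \<comment> \<open>\<open>lo\<close> is the larger of the two strict lower bounds, the second
        being absent for \<open>c r = 0\<close>. For \<open>c r = r\<close> there is no upper bound,
        otherwise \<open>y\<close> is the midpoint.\<close>
      define lo where "lo = (if c r = 0 then v s else max (v s) (v (c r - 1) + 1))"
      define y where "y = (if c r = r then lo + 1 else (lo + (v (c r) + 1)) / 2)"
      have up: "lo < v (c r) + 1" if "c r < r"
        using top[OF cr(2) that] v[of "c r" "c r - 1"] that unfolding lo_def by auto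
      have lo_y: "lo < y" using up cr(1) unfolding y_def by (auto simp: field_simps)
      have y_up: "y < v (c r) + 1" if "c r < r" using up[OF that] that unfolding y_def by (auto simp: field_simps)
      show ?thesis
      proof (intro exI[of _ y] allI impI)
        fix q assume q: "q < r"
        have "v q \<le> v s" using mono[of q s] q Suc by simp
        moreover have "v s \<le> lo" unfolding lo_def by auto
        ultimately have "v q < y" using lo_y by simp
        moreover have "v q + 1 < y" if "q < c r"
        proof -
          have "v q \<le> v (c r - 1)" using mono[of q "c r - 1"] that cr by simp
          moreover have "v (c r - 1) + 1 \<le> lo" using that unfolding lo_def by auto
          ultimately show ?thesis using lo_y by simp
        qed
        moreover have "y < v q + 1" if "\<not> q < c r"
          using mono[of "c r" q] that q y_up by fastforce
        ultimately show "v q < y \<and> (v q + 1 \<le> y \<longleftrightarrow> q < c r) \<and> (v q + 1 = y \<longleftrightarrow> f r \<and> Suc q = c r)"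
          using False by (cases "q < c r") auto
      qed
    qed
  qed
  then obtain y where y: "\<And>q. q < r \<Longrightarrow> v q < y \<and> (v q + 1 \<le> y \<longleftrightarrow> q < c r) \<and> (v q + 1 = y \<longleftrightarrow> f r \<and> Suc q = c r)" by blast
  show ?case
  proof (intro exI[of _ "v(r := y)"] allI impI)
    fix p q assume pq: "p < Suc r" "q < p"
    show "(v(r := y)) q < (v(r := y)) p \<and> ((v(r := y)) q + 1 \<le> (v(r := y)) p \<longleftrightarrow> q < c p) \<and>
      ((v(r := y)) q + 1 = (v(r := y)) p \<longleftrightarrow> f p \<and> Suc q = c p)"
      using pq y[of q] v[of p q] by (cases "p = r") auto
  qed
qed

lemma shi_code_surj:
  assumes L: "L \<in> codes {1..n}"
  shows "\<exists>g. shi_code n g = L"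
proof -
  define r where "r = length L"
  define A where "A p = fst (fst (L ! p))" for p
  define f where "f p = snd (fst (L ! p))" for p
  define c where "c p = snd (L ! p)" for p
  have shape: "code_shape 0 1 L" and edges: "code_edges_ok 0 [None] L" and dist: "distinct (map (\<lambda>x. fst (fst x)) L)"
    and part: "partition_on {1..n} ((\<lambda>x. fst (fst x)) ` set L)" using L unfolding codes_def by auto
  have cle: "c p \<le> p" if "p < r" for p using shape that unfolding code_shape_def c_def r_def by auto
  have cmono: "c p \<le> c q" if "p \<le> q" "q < r" for p q
    using shape that unfolding code_shape_def c_def r_def by (auto simp: sorted_iff_nth_mono)
  have edge: "edge_ok (if p = 0 \<or> c (p - 1) < c p then ([None] @ map (\<lambda>x. Some (fst (fst x))) L) ! c p else None) (A p, f p)"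
    if "p < r" for p
    using spec[OF edges[unfolded code_edges_ok_def], of p] that unfolding c_def A_def f_def r_def
    by (simp only: diff_zero prod.collapse simp_thms)
  have parent: "([None] @ map (\<lambda>x. Some (fst (fst x))) L) ! c p = (if c p = 0 then None else Some (A (c p - 1)))" if "p < r" for p
    using cle[OF that] that unfolding A_def r_def by (cases "c p") auto
  have flag: "0 < c p \<and> (p = 0 \<or> c (p - 1) < c p)" if "p < r" "f p" for p
    using edge[OF that(1)] parent[OF that(1)] that(2) by (auto split: if_splits)
  have desc: "descent (A (c p - 1)) (A p)" if "p < r" "0 < c p" "p = 0 \<or> c (p - 1) < c p" for p
    using edge[OF that(1)] parent[OF that(1)] that(2,3) by auto
  have A_img: "(\<lambda>x. fst (fst x)) ` set L = A ` {..<r}"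
    unfolding A_def r_def by (force simp: set_conv_nth image_iff)
  have A_ne: "A p \<noteq> {}" and A_sub: "A p \<subseteq> {1..n}" if "p < r" for p
    using part that unfolding A_img partition_on_def by auto
  have A_fin: "finite (A p)" if "p < r" for p using A_sub[OF that] finite_subset by blast
  have A_disj: "p = q" if "p < r" "q < r" "i \<in> A p" "i \<in> A q" for p q i
  proof -
    have "A p = A q" using part that unfolding A_img partition_on_def pairwise_def disjnt_def by blast
    then have "map (\<lambda>x. fst (fst x)) L ! p = map (\<lambda>x. fst (fst x)) L ! q" using that unfolding A_def r_def by simp
    then show ?thesis using dist that unfolding r_def by (simp only: nth_eq_iff_index_eq length_map)
  qed
  have A_cover: "\<exists>p<r. i \<in> A p" if "i \<in> {1..n}" for i
    using part that unfolding A_img partition_on_def by blast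
  have "\<exists>v :: nat \<Rightarrow> real. \<forall>p<r. \<forall>q<p. v q < v p \<and> (v q + 1 \<le> v p \<longleftrightarrow> q < c p) \<and>
    (v q + 1 = v p \<longleftrightarrow> f p \<and> Suc q = c p)"
  proof (rule realize_parents)
    fix p assume "Suc p < r" "f (Suc p)"
    then show "c p < c (Suc p)" using flag[of "Suc p"] by simp
  qed (use cle cmono flag in auto)
  then obtain v :: "nat \<Rightarrow> real" where v: "\<And>p q. p < r \<Longrightarrow> q < p \<Longrightarrow> v q < v p \<and> (v q + 1 \<le> v p \<longleftrightarrow> q < c p) \<and>
    (v q + 1 = v p \<longleftrightarrow> f p \<and> Suc q = c p)" by blast
  have v_less: "v q < v p \<longleftrightarrow> q < p" if "p < r" "q < r" for p q
    using v[of p q] v[of q p] that by (cases p q rule: linorder_cases) auto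
  have v_eq: "v q = v p \<longleftrightarrow> q = p" if "p < r" "q < r" for p q
    using v_less[OF that] v_less[OF that(2,1)] by (cases p q rule: linorder_cases) auto
  define g where "g i = v (THE p. p < r \<and> i \<in> A p)" for i
  have g: "g i = v p" if "p < r" "i \<in> A p" for p i
  proof -
    have "(THE p. p < r \<and> i \<in> A p) = p" by (rule the_equality) (use that A_disj in auto)
    then show ?thesis unfolding g_def by simp
  qed
  have gi: "\<exists>p<r. i \<in> A p \<and> g i = v p" if "i \<in> {1..n}" for i using A_cover[OF that] g by blast
  have img: "g ` {1..n} = v ` {..<r}"
  proof
    show "g ` {1..n} \<subseteq> v ` {..<r}" using gi by blast
    show "v ` {..<r} \<subseteq> g ` {1..n}"
    proof
      fix u assume "u \<in> v ` {..<r}"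
      then obtain p where p: "p < r" "u = v p" by blast
      then obtain i where "i \<in> A p" using A_ne by blast
      then have "u = g i" "i \<in> {1..n}" using g[OF p(1)] A_sub[OF p(1)] p by auto
      then show "u \<in> g ` {1..n}" by (rule image_eqI)
    qed
  qed
  have vals: "value_list n g = map v [0..<r]"
  proof (rule strict_sorted_equal[symmetric])
    show "sorted_wrt (<) (map v [0..<r])" unfolding sorted_wrt_iff_nth_less using v_less by simp
    show "set (map v [0..<r]) = set (value_list n g)" using img by (auto simp: atLeast0LessThan)
  qed (rule strict_sorted_values)
  have block: "value_block n g (v p) = A p" if p: "p < r" for p
  proof
    show "value_block n g (v p) \<subseteq> A p"
    proof
      fix i assume "i \<in> value_block n g (v p)"
      then have i: "i \<in> {1..n}" "g i = v p" unfolding value_block_def by auto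
      then obtain q where "q < r" "i \<in> A q" "g i = v q" using gi by blast
      then show "i \<in> A p" using i v_eq[of p q] p by auto
    qed
    show "A p \<subseteq> value_block n g (v p)" unfolding value_block_def using g[OF p] A_sub[OF p] by auto
  qed
  \<comment> \<open>The descent at a first child yields a recorded pair: the maximum of the parent
    block and the minimum of the block.\<close>
  have witness: "\<exists>i\<in>{1..n}. \<exists>j\<in>{1..n}. j < i \<and> g i = v (c p - 1) \<and> g j = v p"
    if "p < r" "0 < c p" "p = 0 \<or> c (p - 1) < c p" for p
  proof -
    have d: "Min (A p) < Max (A (c p - 1))" using desc[OF that] unfolding descent_def .
    have c1: "c p - 1 < r" using cle[OF that(1)] that by simp
    have "Max (A (c p - 1)) \<in> A (c p - 1)" "Min (A p) \<in> A p" using A_fin A_ne c1 that(1) by simp_all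
    then show ?thesis using d g[OF c1] g[OF that(1)] A_sub[OF c1] A_sub[OF that(1)] by blast
  qed
  have vflag: "value_flag n g (v p) = f p" if p: "p < r" for p
  proof
    assume "value_flag n g (v p)"
    then obtain i j where ij: "i \<in> {1..n}" "g i + 1 = v p" unfolding value_flag_def by blast
    then obtain q where q: "q < r" "g i = v q" using gi by blast
    then have "v q < v p" using ij by simp
    then have "q < p" using v_less[OF p q(1)] by simp
    then show "f p" using v[OF p] ij q by auto
  next
    assume fp: "f p"
    then have c0: "0 < c p" using flag[OF p] by simp
    have "c p - 1 < p" using c0 cle[OF p] by simp
    then have "v (c p - 1) + 1 = v p" using v[OF p, of "c p - 1"] c0 fp by simp
    then show "value_flag n g (v p)" unfolding value_flag_def using witness[OF p c0] flag[OF p fp] by metis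
  qed
  have low: "low_values n g (v p) = v ` {..<c p}" if p: "p < r" for p
  proof
    show "low_values n g (v p) \<subseteq> v ` {..<c p}"
    proof
      fix u assume u: "u \<in> low_values n g (v p)"
      then have "u \<in> v ` {..<r}" unfolding low_values_def img by blast
      then obtain q where q: "q < r" "u = v q" by blast
      have le: "v q + 1 \<le> v p" using low_values_less[OF u] q by simp
      then have "v q < v p" by linarith
      then have "q < p" using v_less[OF p q(1)] by simp
      then have "q < c p" using v[OF p] le by blast
      then show "u \<in> v ` {..<c p}" using q by blast
    qed
    show "v ` {..<c p} \<subseteq> low_values n g (v p)"
    proof
      fix u assume "u \<in> v ` {..<c p}"
      then obtain q where q: "q < c p" "u = v q" by blast
      \<comment> \<open>The block at \<open>p\<close> need not form a descent with its parent, but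
        the first child \<open>p'\<close> of that parent does, and its recorded pair serves all
        later siblings.\<close>
      define p' where "p' = (LEAST p'. c p' = c p)"
      have cp': "c p' = c p" unfolding p'_def by (rule LeastI[of _ p]) simp
      have le: "p' \<le> p" unfolding p'_def by (rule Least_le) simp
      then have p': "p' < r" using p by simp
      have "c (p' - 1) < c p'" if "p' \<noteq> 0"
      proof -
        have "p' - 1 < p'" using that by simp
        then have "c (p' - 1) \<noteq> c p" using not_less_Least unfolding p'_def by blast
        then show ?thesis using cmono[of "p' - 1" p'] p' cp' by simp
      qed
      then have "p' = 0 \<or> c (p' - 1) < c p'" by blast
      moreover have "0 < c p'" using cp' q by simp
      ultimately obtain i j where ij: "i \<in> {1..n}" "j \<in> {1..n}" "j < i" "g i = v (c p - 1)" "g j = v p'"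
        using witness[OF p'] unfolding cp' by blast
      have c1: "c p - 1 < p'" "c p - 1 < r" using cle[OF p'] cp' q p' by auto
      have "v (c p - 1) + 1 \<le> v p'" using v[OF p' c1(1)] cp' q by auto
      moreover have "v p' \<le> v p" using v_less[OF p' p] le by (simp add: not_less[symmetric])
      moreover have "v q \<le> v (c p - 1)" using v_less[of q "c p - 1"] q c1 by (simp add: not_less[symmetric])
      moreover have "q < r" using q c1 by simp
      then have "v q \<in> g ` {1..n}" unfolding img by blast
      ultimately show "u \<in> low_values n g (v p)" unfolding low_values_def using ij q(2) by force
    qed
  qed
  have "card (low_values n g (v p)) = c p" if p: "p < r" for p
  proof -
    have "inj_on v {..<c p}" using v_eq cle[OF p] p by (intro inj_onI) auto
    then show ?thesis unfolding low[OF p] by (simp add: card_image)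
  qed
  then have "shi_code n g = L"
    unfolding shi_code_def vals using block vflag
    by (intro nth_equalityI) (auto simp: A_def f_def c_def r_def)
  then show ?thesis by blast
qed

section \<open>Faces\<close>

text \<open>The indicator vectors of the fibres are orthogonal and nonzero, hence a basis.\<close>

lemma dim_constant_on_fibres:
  fixes \<kappa> :: "'d::finite \<Rightarrow> 'b"
  shows "subspace {y :: real ^ 'd. \<forall>a b. \<kappa> a = \<kappa> b \<longrightarrow> y $ a = y $ b}" (is "subspace ?V")
    and "dim {y :: real ^ 'd. \<forall>a b. \<kappa> a = \<kappa> b \<longrightarrow> y $ a = y $ b} = card (range \<kappa>)"
proof -
  show V: "subspace ?V"
  proof (rule subspaceI)
    show "0 \<in> ?V" by simp
    fix y z :: "real ^ 'd" and t :: real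
    assume "y \<in> ?V"
    then have y: "y $ a = y $ b" if "\<kappa> a = \<kappa> b" for a b using that by blast
    show "t *\<^sub>R y \<in> ?V"
    proof (intro CollectI allI impI)
      fix a b assume "\<kappa> a = \<kappa> b"
      then show "(t *\<^sub>R y) $ a = (t *\<^sub>R y) $ b" using y[of a b] by simp
    qed
    assume "z \<in> ?V"
    then have z: "z $ a = z $ b" if "\<kappa> a = \<kappa> b" for a b using that by blast
    show "y + z \<in> ?V"
    proof (intro CollectI allI impI)
      fix a b assume "\<kappa> a = \<kappa> b"
      then show "(y + z) $ a = (y + z) $ b" using y[of a b] z[of a b] by simp
    qed
  qed
  define b :: "'b \<Rightarrow> real ^ 'd" where "b k = (\<chi> a. if \<kappa> a = k then 1 else 0)" for k
  have b_nth: "b k $ a = (if \<kappa> a = k then 1 else 0)" for k a unfolding b_def by simp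
  have inj: "inj_on b (range \<kappa>)"
  proof (rule inj_onI)
    fix k l assume "k \<in> range \<kappa>" "b k = b l"
    then obtain a where "k = \<kappa> a" "b k $ a = b l $ a" by auto
    then show "k = l" by (auto simp: b_nth split: if_splits)
  qed
  have "pairwise orthogonal (b ` range \<kappa>)"
    unfolding pairwise_def orthogonal_def
    by (auto simp: inner_vec_def b_nth intro!: sum.neutral)
  moreover have "0 \<notin> b ` range \<kappa>"
  proof
    assume "0 \<in> b ` range \<kappa>"
    then obtain a where "b (\<kappa> a) = 0" by auto
    then have "b (\<kappa> a) $ a = 0" by simp
    then show False by (simp add: b_nth)
  qed
  ultimately have ind: "independent (b ` range \<kappa>)" by (rule pairwise_orthogonal_independent)
  have "span (b ` range \<kappa>) = ?V"
  proof
    have "b ` range \<kappa> \<subseteq> ?V" by (auto simp: b_nth)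
    then show "span (b ` range \<kappa>) \<subseteq> ?V" using V by (rule span_minimal)
    show "?V \<subseteq> span (b ` range \<kappa>)"
    proof
      fix y assume y: "y \<in> ?V"
      define Y where "Y k = y $ (SOME a. \<kappa> a = k)" for k
      have Y: "y $ a = Y (\<kappa> a)" for a
      proof -
        have "\<kappa> (SOME c. \<kappa> c = \<kappa> a) = \<kappa> a" by (rule someI[of _ a]) simp
        then have "y $ (SOME c. \<kappa> c = \<kappa> a) = y $ a" using y by blast
        then show ?thesis unfolding Y_def by simp
      qed
      have "y = (\<Sum>k\<in>range \<kappa>. Y k *\<^sub>R b k)"
      proof (subst vec_eq_iff, intro allI)
        fix a
        have "(\<Sum>k\<in>range \<kappa>. Y k *\<^sub>R b k) $ a = (\<Sum>k\<in>range \<kappa>. if \<kappa> a = k then Y k else 0)"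
          by (simp add: b_nth if_distrib cong: if_cong)
        also have "\<dots> = Y (\<kappa> a)" by (subst sum.delta') auto
        finally show "y $ a = (\<Sum>k\<in>range \<kappa>. Y k *\<^sub>R b k) $ a" using Y by simp
      qed
      also have "\<dots> \<in> span (b ` range \<kappa>)"
        by (intro span_sum span_scale span_base imageI)
      finally show "y \<in> span (b ` range \<kappa>)" .
    qed
  qed
  then have "dim ?V = card (b ` range \<kappa>)" using dim_span_eq_card_independent[OF ind] by simp
  then show "dim ?V = card (range \<kappa>)" using inj by (simp add: card_image)
qed

definition shi_face :: "nat \<Rightarrow> (nat \<Rightarrow> 'd::finite) \<Rightarrow> real ^ 'd \<Rightarrow> (real ^ 'd) set" where
  "shi_face n e x = {z. shi_equiv n (\<lambda>i. x $ e i) (\<lambda>i. z $ e i)}"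

text \<open>Any point of a face determines the relations chosen, so a face is the class of each of
  its points.\<close>

lemma shi_faces_conv: "shi_faces n e = range (shi_face n e)"
proof
  show "shi_faces n e \<subseteq> range (shi_face n e)"
  proof
    fix F assume "F \<in> shi_faces n e"
    then obtain \<sigma> where ne: "F \<noteq> {}" and \<sigma>: "\<And>i j c. \<sigma> i j c \<in> {(<), (=), (>)}"
      and F: "F = {x. \<forall>i j. 1 \<le> i \<and> i < j \<and> j \<le> n \<longrightarrow> (\<forall>c\<in>{0, 1}. \<sigma> i j c (x $ e i - x $ e j) c)}"
      unfolding shi_faces_def by blast
    obtain x where x: "x \<in> F" using ne by blast
    have key: "\<sigma> i j c z c \<longleftrightarrow> (u < c \<longleftrightarrow> z < c) \<and> (u = c \<longleftrightarrow> z = c)" if "\<sigma> i j c u c" for i j c u and z :: real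
    proof -
      consider "\<sigma> i j c = (<)" | "\<sigma> i j c = (=)" | "\<sigma> i j c = (>)" using \<sigma>[of i j c] by blast
      then show ?thesis using that by cases auto
    qed
    have "z \<in> F \<longleftrightarrow> z \<in> shi_face n e x" for z
    proof -
      have "\<sigma> i j c (z $ e i - z $ e j) c \<longleftrightarrow>
        (x $ e i - x $ e j < c \<longleftrightarrow> z $ e i - z $ e j < c) \<and> (x $ e i - x $ e j = c \<longleftrightarrow> z $ e i - z $ e j = c)"
        if "1 \<le> i \<and> i < j \<and> j \<le> n" "c \<in> {0, 1}" for i j c
        by (rule key) (use x that in \<open>auto simp: F\<close>)
      then show ?thesis unfolding F shi_face_def shi_equiv_def mem_Collect_eq by simp
    qed
    then show "F \<in> range (shi_face n e)" by blast
  qed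
  show "range (shi_face n e) \<subseteq> shi_faces n e"
  proof
    fix F assume "F \<in> range (shi_face n e)"
    then obtain x where F: "F = shi_face n e x" by blast
    define \<sigma> :: "nat \<Rightarrow> nat \<Rightarrow> real \<Rightarrow> real \<Rightarrow> real \<Rightarrow> bool" where
      "\<sigma> i j c = (if x $ e i - x $ e j < c then (<) else if x $ e i - x $ e j = c then (=) else (>))" for i j c
    have key: "\<sigma> i j c z c \<longleftrightarrow> (x $ e i - x $ e j < c \<longleftrightarrow> z < c) \<and> (x $ e i - x $ e j = c \<longleftrightarrow> z = c)" for i j c z
      unfolding \<sigma>_def by auto
    have "x \<in> F" unfolding F shi_face_def shi_equiv_def by simp
    moreover have "\<forall>i j c. \<sigma> i j c \<in> {(<), (=), (>)}" unfolding \<sigma>_def by simp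
    moreover have "F = {z. \<forall>i j. 1 \<le> i \<and> i < j \<and> j \<le> n \<longrightarrow> (\<forall>c\<in>{0, 1}. \<sigma> i j c (z $ e i - z $ e j) c)}"
      unfolding F shi_face_def shi_equiv_def key ..
    ultimately show "F \<in> shi_faces n e" unfolding shi_faces_def by blast
  qed
qed

text \<open>The equations valid at \<open>x\<close> define an affine space \<open>H\<close> through
  \<open>x\<close> and the strict inequalities are open, so the face is nonempty and relatively open
  in \<open>H\<close>. In the direction space a difference fixed to 0 or 1 becomes equality of
  coordinates.\<close>

lemma aff_dim_shi_face:
  fixes x :: "real ^ 'd::finite"
  shows "aff_dim (shi_face n e x) = int (dim {y :: real ^ 'd. \<forall>i j. 1 \<le> i \<and> i < j \<and> j \<le> n \<longrightarrow>
    x $ e i - x $ e j \<in> {0, 1} \<longrightarrow> y $ e i = y $ e j})" (is "_ = int (dim ?V)")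
proof -
  have V: "subspace ?V"
  proof (rule subspaceI)
    show "0 \<in> ?V" by simp
    fix y z :: "real ^ 'd" and t :: real
    assume "y \<in> ?V"
    then have y: "y $ e i = y $ e j" if "1 \<le> i \<and> i < j \<and> j \<le> n" "x $ e i - x $ e j \<in> {0, 1}" for i j using that by blast
    show "t *\<^sub>R y \<in> ?V"
    proof (intro CollectI allI impI)
      fix i j assume "1 \<le> i \<and> i < j \<and> j \<le> n" "x $ e i - x $ e j \<in> {0, 1}"
      then show "(t *\<^sub>R y) $ e i = (t *\<^sub>R y) $ e j" using y[of i j] by simp
    qed
    assume "z \<in> ?V"
    then have z: "z $ e i = z $ e j" if "1 \<le> i \<and> i < j \<and> j \<le> n" "x $ e i - x $ e j \<in> {0, 1}" for i j using that by blast
    show "y + z \<in> ?V"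
    proof (intro CollectI allI impI)
      fix i j assume "1 \<le> i \<and> i < j \<and> j \<le> n" "x $ e i - x $ e j \<in> {0, 1}"
      then show "(y + z) $ e i = (y + z) $ e j" using y[of i j] z[of i j] by simp
    qed
  qed
  define H where "H = (+) x ` ?V"
  define I :: "(nat \<times> nat \<times> real) set" where "I = {(i, j, c). 1 \<le> i \<and> i < j \<and> j \<le> n \<and> c \<in> {0, 1}}"
  \<comment> \<open>Where equality holds at \<open>x\<close>, both factors are \<open>UNIV\<close>;
    that equation is left to \<open>H\<close>.\<close>
  define W :: "nat \<times> nat \<times> real \<Rightarrow> (real ^ 'd) set" where "W = (\<lambda>(i, j, c).
    (if x $ e i - x $ e j < c then {z. z $ e i - z $ e j < c} else UNIV) \<inter>
    (if c < x $ e i - x $ e j then {z. c < z $ e i - z $ e j} else UNIV))"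
  have oW: "open (W k)" for k
    unfolding W_def by (auto split: prod.splits intro!: open_Collect_less continuous_intros open_Int)
  have "finite I" by (rule finite_subset[of _ "{1..n} \<times> {1..n} \<times> {0, 1}"]) (auto simp: I_def)
  then have oI: "open (\<Inter>k\<in>I. W k)" using oW by (intro open_INT) auto
  have memH: "z \<in> H \<longleftrightarrow> z - x \<in> ?V" for z
  proof
    assume "z - x \<in> ?V"
    then have "x + (z - x) \<in> H" unfolding H_def by (rule imageI)
    then show "z \<in> H" by simp
  qed (auto simp: H_def)
  have memI: "(\<forall>k\<in>I. P k) \<longleftrightarrow> (\<forall>i j. 1 \<le> i \<and> i < j \<and> j \<le> n \<longrightarrow> (\<forall>c\<in>{0, 1}. P (i, j, c)))" for P
    unfolding I_def by auto
  have tri: "(u < c \<longleftrightarrow> w < c) \<and> (u = c \<longleftrightarrow> w = c) \<longleftrightarrow> (u = c \<longrightarrow> w = c) \<and> (u < c \<longrightarrow> w < c) \<and> (c < u \<longrightarrow> c < w)" for u w c :: real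
    by auto
  have "z \<in> shi_face n e x \<longleftrightarrow> z \<in> H \<inter> (\<Inter>k\<in>I. W k)" for z
  proof -
    have pt: "(case (i, j, c) of (i, j, c) \<Rightarrow> x $ e i - x $ e j = c \<longrightarrow> z $ e i - z $ e j = c) \<and> z \<in> W (i, j, c) \<longleftrightarrow>
      (x $ e i - x $ e j < c \<longleftrightarrow> z $ e i - z $ e j < c) \<and> (x $ e i - x $ e j = c \<longleftrightarrow> z $ e i - z $ e j = c)" for i j c
      unfolding tri W_def by simp
    have "z \<in> shi_face n e x \<longleftrightarrow>
      (\<forall>k\<in>I. (case k of (i, j, c) \<Rightarrow> x $ e i - x $ e j = c \<longrightarrow> z $ e i - z $ e j = c) \<and> z \<in> W k)"
      unfolding shi_face_def shi_equiv_def mem_Collect_eq memI pt ..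
    moreover have "z \<in> H \<longleftrightarrow> (\<forall>k\<in>I. case k of (i, j, c) \<Rightarrow> x $ e i - x $ e j = c \<longrightarrow> z $ e i - z $ e j = c)"
      unfolding memI memH by (auto simp: algebra_simps)
    ultimately show ?thesis unfolding ball_conj_distrib by (simp only: Int_iff INT_iff)
  qed
  then have face: "shi_face n e x = H \<inter> (\<Inter>k\<in>I. W k)" by blast
  have "affine H" unfolding H_def using V subspace_imp_affine affine_translation by blast
  moreover have "openin (top_of_set H) (shi_face n e x)" unfolding face using oI by (simp add: openin_open_Int)
  moreover have "shi_face n e x \<noteq> {}" unfolding shi_face_def shi_equiv_def by blast
  ultimately have "aff_dim (shi_face n e x) = aff_dim H" using aff_dim_openin by blast
  also have "\<dots> = aff_dim ?V" unfolding H_def by (rule aff_dim_translation_eq)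
  also have "\<dots> = int (dim ?V)" using V by (rule aff_dim_subspace)
  finally show ?thesis .
qed

text \<open>Dashed edges are followed upwards to a free position. The parent of list index
  \<open>p\<close> has list index \<open>c p - 1\<close>, as \<open>c p = 0\<close> means the
  virtual root; the guard \<open>c p \<le> p\<close> makes the index decrease.\<close>

function free_ancestor :: "(nat \<Rightarrow> bool) \<Rightarrow> (nat \<Rightarrow> nat) \<Rightarrow> nat \<Rightarrow> nat" where
  "free_ancestor f c p = (if f p \<and> 0 < c p \<and> c p \<le> p then free_ancestor f c (c p - 1) else p)"
  by pat_completeness auto
termination by (relation "Wellfounded.measure (\<lambda>(f, c, p). p)") auto

declare free_ancestor.simps [simp del]

lemma free_ancestor_free:
  assumes "\<And>p. p < r \<Longrightarrow> f p \<Longrightarrow> 0 < c p \<and> c p \<le> p" "p < r"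
  shows "free_ancestor f c p < r \<and> \<not> f (free_ancestor f c p)"
  using assms(2)
proof (induction p rule: less_induct)
  case (less p)
  show ?case
  proof (cases "f p")
    case True
    then have c: "0 < c p" "c p \<le> p" using assms(1)[OF less.prems] by auto
    then have "free_ancestor f c p = free_ancestor f c (c p - 1)" using True by (subst free_ancestor.simps) simp
    then show ?thesis using less.IH[of "c p - 1"] c less.prems by simp
  next
    case False
    then have "free_ancestor f c p = p" by (subst free_ancestor.simps) simp
    then show ?thesis using False less.prems by simp
  qed
qed

text \<open>Directions of the face are constant on blocks and along dashed edges.
  \<open>\<kappa>\<close> sends a coordinate to the free block at which its dashed chain ends, so
  its fibres correspond to the free nodes.\<close>

lemma dim_shi_face:
  fixes x :: "real ^ 'd::finite"
  assumes e: "bij_betw e {1..n} UNIV"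
  shows "aff_dim (shi_face n e x) = int (code_free_count (shi_code n (\<lambda>i. x $ e i)))"
proof -
  define g where "g i = x $ e i" for i
  let ?v = "value_list n g"
  define r where "r = length ?v"
  define f where "f p = value_flag n g (?v ! p)" for p
  define c where "c p = card (low_values n g (?v ! p))" for p
  define idx where "idx i = (SOME p. p < r \<and> g i = ?v ! p)" for i
  have idx: "idx i < r" "g i = ?v ! idx i" if i: "i \<in> {1..n}" for i
  proof -
    have "\<exists>p. p < r \<and> g i = ?v ! p" using values_index[OF i, of g] unfolding r_def by metis
    then have "idx i < r \<and> g i = ?v ! idx i" unfolding idx_def by (rule someI_ex)
    then show "idx i < r" "g i = ?v ! idx i" by auto
  qed
  have idx_eq: "idx i = p" if "i \<in> {1..n}" "p < r" "g i = ?v ! p" for i p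
    using idx[OF that(1)] that distinct_values[of n g] unfolding r_def by (metis nth_eq_iff_index_eq)
  have ex: "\<exists>i\<in>{1..n}. idx i = p" if "p < r" for p
  proof -
    have "?v ! p \<in> g ` {1..n}" using nth_mem[of p ?v] that unfolding r_def by simp
    then obtain i where "i \<in> {1..n}" "g i = ?v ! p" by auto
    then show ?thesis using idx_eq that by blast
  qed
  have parent: "f (idx j) \<and> Suc (idx i) = c (idx j)" if "i \<in> {1..n}" "j \<in> {1..n}" "j < i" "g i + 1 = g j" for i j
  proof -
    have "Suc (idx i) = card (low_values n g (g j))"
      using flag_parent[OF that, of "idx i"] idx[OF that(1)] unfolding r_def by simp
    moreover have "value_flag n g (g j)" unfolding value_flag_def using that by blast
    ultimately show ?thesis unfolding f_def c_def using idx(2)[OF that(2)] by simp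
  qed
  have flagD: "\<exists>i j. i \<in> {1..n} \<and> j \<in> {1..n} \<and> j < i \<and> g i + 1 = g j \<and> idx j = p" if "p < r" "f p" for p
    using that idx_eq unfolding f_def value_flag_def by metis
  have cle: "0 < c p \<and> c p \<le> p" if p: "p < r" "f p" for p
  proof -
    obtain i j where "i \<in> {1..n}" "j \<in> {1..n}" "j < i" "g i + 1 = g j" "idx j = p" using flagD[OF p] by blast
    then have "Suc (idx i) = c p" using parent by blast
    then show ?thesis using card_low_values_le[of p n g] p unfolding c_def r_def by simp
  qed
  define \<iota> where "\<iota> = inv_into {1..n} e"
  have \<iota>: "\<iota> d \<in> {1..n}" "e (\<iota> d) = d" for d
    using e inv_into_into[of d e "{1..n}"] f_inv_into_f[of d e "{1..n}"] unfolding \<iota>_def bij_betw_def by simp_all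
  have \<iota>e: "\<iota> (e i) = i" if "i \<in> {1..n}" for i
    using e that unfolding \<iota>_def bij_betw_def by (simp add: inv_into_f_f)
  define \<kappa> where "\<kappa> d = free_ancestor f c (idx (\<iota> d))" for d
  have step: "free_ancestor f c (idx j) = free_ancestor f c (idx i)"
    if ij: "i \<in> {1..n}" "j \<in> {1..n}" "j < i" "g i + 1 = g j" for i j
  proof -
    have "f (idx j)" "c (idx j) - 1 = idx i" using parent[OF ij] by auto
    moreover have "0 < c (idx j) \<and> c (idx j) \<le> idx j" using cle idx(1)[OF ij(2)] \<open>f (idx j)\<close> by blast
    ultimately show ?thesis by (subst free_ancestor.simps) simp
  qed
  have range: "range \<kappa> = {p. p < r \<and> \<not> f p}"
  proof
    show "range \<kappa> \<subseteq> {p. p < r \<and> \<not> f p}"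
      using free_ancestor_free[of r f c] cle idx(1) \<iota>(1) unfolding \<kappa>_def by blast
    show "{p. p < r \<and> \<not> f p} \<subseteq> range \<kappa>"
    proof
      fix p assume p: "p \<in> {p. p < r \<and> \<not> f p}"
      then obtain i where "i \<in> {1..n}" "idx i = p" using ex by blast
      then have "\<kappa> (e i) = p" unfolding \<kappa>_def using \<iota>e p by (subst free_ancestor.simps) simp
      then show "p \<in> range \<kappa>" by blast
    qed
  qed
  let ?V = "{y :: real ^ 'd. \<forall>i j. 1 \<le> i \<and> i < j \<and> j \<le> n \<longrightarrow> x $ e i - x $ e j \<in> {0, 1} \<longrightarrow> y $ e i = y $ e j}"
  have "?V = {y. \<forall>a b. \<kappa> a = \<kappa> b \<longrightarrow> y $ a = y $ b}"
  proof (intro set_eqI iffI)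
    fix y assume "y \<in> ?V"
    then have y: "y $ e i = y $ e j" if "1 \<le> i" "i < j" "j \<le> n" "g i - g j \<in> {0, 1}" for i j
      using that unfolding g_def by blast
    have same: "y $ e i = y $ e j" if ij: "i \<in> {1..n}" "j \<in> {1..n}" "g i = g j" for i j
    proof (cases i j rule: linorder_cases)
      case less
      then show ?thesis using ij by (intro y) auto
    next
      case greater
      then show ?thesis using ij by (intro y[symmetric]) auto
    qed simp
    \<comment> \<open>Induction along the dashed chain. The equation leading to the parent block may
      involve another coordinate \<open>j\<close> of the block than \<open>i\<close>, which
      \<open>same\<close> repairs.\<close>
    have key: "y $ e i = y $ e i'" if "i \<in> {1..n}" "i' \<in> {1..n}" "idx i = p" "idx i' = free_ancestor f c p" for i i' p
      using that
    proof (induction p arbitrary: i rule: less_induct)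
      case (less p)
      have p: "p < r" using idx(1)[OF less.prems(1)] less.prems by simp
      show ?case
      proof (cases "f p")
        case True
        then obtain k j where kj: "k \<in> {1..n}" "j \<in> {1..n}" "j < k" "g k + 1 = g j" "idx j = p" using flagD[OF p] by blast
        have "idx k < p" using parent[OF kj(1-4)] cle[OF p True] kj(5) by auto
        then have "y $ e k = y $ e i'" using less.IH[of "idx k" k] kj less.prems step[OF kj(1-4)] by simp
        moreover have "y $ e j = y $ e k" using y[of j k] kj by auto
        moreover have "g i = g j" using less.prems(3) kj(5) idx(2)[OF less.prems(1)] idx(2)[OF kj(2)] by simp
        then have "y $ e i = y $ e j" by (rule same[OF less.prems(1) kj(2)])
        ultimately show ?thesis by simp
      next
        case False
        then have "free_ancestor f c p = p" by (subst free_ancestor.simps) simp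
        then have "g i = g i'" using less.prems(3,4) idx(2)[OF less.prems(1)] idx(2)[OF less.prems(2)] by simp
        then show ?thesis by (rule same[OF less.prems(1,2)])
      qed
    qed
    show "y \<in> {y. \<forall>a b. \<kappa> a = \<kappa> b \<longrightarrow> y $ a = y $ b}"
    proof (intro CollectI allI impI)
      fix a b assume ab: "\<kappa> a = \<kappa> b"
      have "\<kappa> a < r" using range by blast
      then obtain i where i: "i \<in> {1..n}" "idx i = \<kappa> a" using ex by blast
      have "y $ e (\<iota> a) = y $ e i" "y $ e (\<iota> b) = y $ e i"
        using key[OF \<iota>(1)[of a] i(1) refl] key[OF \<iota>(1)[of b] i(1) refl] i(2) ab unfolding \<kappa>_def by simp_all
      then show "y $ a = y $ b" using \<iota>(2) by simp
    qed
  next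
    fix y :: "real ^ 'd" assume "y \<in> {y. \<forall>a b. \<kappa> a = \<kappa> b \<longrightarrow> y $ a = y $ b}"
    then have y: "y $ a = y $ b" if "\<kappa> a = \<kappa> b" for a b using that by blast
    show "y \<in> ?V"
    proof (intro CollectI allI impI)
      fix i j assume ij: "1 \<le> i \<and> i < j \<and> j \<le> n" and eq: "x $ e i - x $ e j \<in> {0, 1}"
      have i: "i \<in> {1..n}" and j: "j \<in> {1..n}" using ij by auto
      consider "g i = g j" | "g j + 1 = g i" using eq unfolding g_def by auto
      then have "free_ancestor f c (idx i) = free_ancestor f c (idx j)"
      proof cases
        case 1
        then have "idx i = idx j" using idx_eq[OF i] idx[OF j] by simp
        then show ?thesis by simp
      next
        case 2
        then show ?thesis using step[OF j i] ij by simp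
      qed
      then have "\<kappa> (e i) = \<kappa> (e j)" unfolding \<kappa>_def using \<iota>e[OF i] \<iota>e[OF j] by simp
      then show "y $ e i = y $ e j" by (rule y)
    qed
  qed
  then have "dim ?V = card {p. p < r \<and> \<not> f p}" using dim_constant_on_fibres(2)[of \<kappa>] range by simp
  also have "\<dots> = code_free_count (shi_code n g)"
    unfolding code_free_count_def length_filter_conv_card r_def f_def
    by (rule arg_cong[of _ _ card]) (auto simp: nth_shi_code)
  also have "g = (\<lambda>i. x $ e i)" using g_def by (rule ext)
  finally show ?thesis unfolding aff_dim_shi_face by (rule arg_cong)
qed

text \<open>By \<open>shi_code_invariant\<close> and \<open>shi_code_determines\<close> the faces
  are the fibres of the code map, and by \<open>shi_code_surj\<close> every code is
  attained.\<close>

lemma bij_betw_codes_shi_faces: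
  fixes e :: "nat \<Rightarrow> 'd::finite"
  assumes e: "bij_betw e {1..n} UNIV"
  shows "bij_betw (\<lambda>L. {z. shi_code n (\<lambda>i. z $ e i) = L}) {L \<in> codes {1..n}. code_free_count L = k} (shi_faces_dim n e k)"
proof -
  let ?c = "\<lambda>z :: real ^ 'd. shi_code n (\<lambda>i. z $ e i)"
  have face: "shi_face n e x = {z. ?c z = ?c x}" for x
    unfolding shi_face_def using shi_code_invariant shi_code_determines by metis
  have surj: "\<exists>x. ?c x = L" if L: "L \<in> codes {1..n}" for L
  proof -
    obtain g where g: "shi_code n g = L" using shi_code_surj[OF L] by blast
    define x :: "real ^ 'd" where "x = (\<chi> d. g (inv_into {1..n} e d))"
    have "x $ e i = g i" if "i \<in> {1..n}" for i
      using e that unfolding x_def bij_betw_def by (simp add: inv_into_f_f)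
    then have "shi_equiv n (\<lambda>i. x $ e i) g" unfolding shi_equiv_def by simp
    then have "?c x = L" using shi_code_invariant g by metis
    then show ?thesis by blast
  qed
  have dim: "aff_dim {z. ?c z = ?c x} = int (code_free_count (?c x))" for x
    using dim_shi_face[OF e, of x] face by simp
  show ?thesis unfolding bij_betw_def
  proof
    show "inj_on (\<lambda>L. {z. ?c z = L}) {L \<in> codes {1..n}. code_free_count L = k}"
    proof (rule inj_onI)
      fix L L' assume L: "L \<in> {L \<in> codes {1..n}. code_free_count L = k}" and eq: "{z. ?c z = L} = {z. ?c z = L'}"
      obtain x where "?c x = L" using surj L by blast
      then show "L = L'" using eq by blast
    qed
    show "(\<lambda>L. {z. ?c z = L}) ` {L \<in> codes {1..n}. code_free_count L = k} = shi_faces_dim n e k"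
    proof
      show "(\<lambda>L. {z. ?c z = L}) ` {L \<in> codes {1..n}. code_free_count L = k} \<subseteq> shi_faces_dim n e k"
      proof
        fix F assume "F \<in> (\<lambda>L. {z. ?c z = L}) ` {L \<in> codes {1..n}. code_free_count L = k}"
        then obtain L where L: "L \<in> codes {1..n}" "code_free_count L = k" "F = {z. ?c z = L}" by blast
        then obtain x where x: "?c x = L" using surj by blast
        then have "F = shi_face n e x" using L face by simp
        moreover have "aff_dim F = int k" using dim[of x] x L by simp
        ultimately show "F \<in> shi_faces_dim n e k" unfolding shi_faces_dim_def shi_faces_conv by blast
      qed
      show "shi_faces_dim n e k \<subseteq> (\<lambda>L. {z. ?c z = L}) ` {L \<in> codes {1..n}. code_free_count L = k}"
      proof
        fix F assume "F \<in> shi_faces_dim n e k"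
        then obtain x where x: "F = {z. ?c z = ?c x}" "aff_dim F = int k"
          unfolding shi_faces_dim_def shi_faces_conv face by blast
        then have "code_free_count (?c x) = k" using dim[of x] by simp
        then show "F \<in> (\<lambda>L. {z. ?c z = L}) ` {L \<in> codes {1..n}. code_free_count L = k}"
          using x shi_code_in_codes by blast
      qed
    qed
  qed
qed

theorem theorem5p1:
  fixes n k :: nat
  assumes "n \<ge> 1" and "k \<in> {1..n}"
  shows "T_trees n k \<approx> U_trees n k \<and> U_trees n k \<approx> V_trees n k \<and> V_trees n k \<approx> W_pairs n k \<and>
    (\<forall>e :: nat \<Rightarrow> 'd::finite. bij_betw e {1..n} UNIV \<longrightarrow>
       finite (shi_faces_dim n e k) \<and>
       card (shi_faces_dim n e k) = card (T_trees n k) \<and>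
       card (T_trees n k) = card (U_trees n k) \<and>
       card (U_trees n k) = card (V_trees n k) \<and>
       card (V_trees n k) = card (W_pairs n k))"
proof -
  note U = card_U_trees[OF assms(1), of k] and V = card_V_trees[OF assms(1), of k]
  have TU: "T_trees n k \<approx> U_trees n k" using T_trees_eqpoll_U_trees assms(2) by simp
  have fT: "finite (T_trees n k)" using eqpoll_finite_iff[OF TU] U(2) by simp
  have cT: "card (T_trees n k) = card (U_trees n k)" using TU fT U(2) by (simp add: eqpoll_iff_card)
  have "finite (shi_faces_dim n e k) \<and> card (shi_faces_dim n e k) = card (T_trees n k)"
    if "bij_betw e {1..n} UNIV" for e :: "nat \<Rightarrow> 'd"
    using bij_betw_trans[OF bij_betw_T_trees_codes bij_betw_codes_shi_faces[OF that]] fT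
    by (metis bij_betw_finite bij_betw_same_card)
  \<comment> \<open>Only cardinalities are compared here, so finiteness is what yields
    equipollence.\<close>
  moreover have "U_trees n k \<approx> V_trees n k" "V_trees n k \<approx> W_pairs n k"
    using U V finite_W_pairs[of n k] by (simp_all add: eqpoll_iff_card)
  ultimately show ?thesis using TU cT U(1) V(1) by simp
qed

end
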